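(* Let $m,p\ge 2$ be integers. The admissible families of minors for the space $\mathcal{M}^{\ge 0}_{m,p}(\mathbb{R})$ of $m\times p$ totally nonnegative real matrices are exactly the families $\mathcal{M}(w)$ for $w\in\mathcal{S}$, where $\mathcal{S}=\{w\in S_{m+p}\mid -p\le w(i)-i\le m \text{ for all } i=1,\dots,m+p\}$.
   Context: Notation: $[a,b]$ denotes $\{a,a+1,\dots,b\}$. For $I\subseteq[1,m]$, $\Lambda\subseteq[1,p]$ with $|I|=|\Lambda|$, $[I|\Lambda]$ denotes the minor (a polynomial function on $m\times p$ matrices) given by the determinant of the submatrix with rows $I$ and columns $\Lambda$ (rows and columns in increasing order); the empty minor $[\emptyset|\emptyset]=1$ is also allowed. Totally nonnegative cells: a real $m\times p$ matrix is totally nonnegative (tnn) if all of its minors are nonnegative; $\mathcal{M}^{\ge 0}_{m,p}(\mathbb{R})$ is the set of these. For a family $\mathcal{F}$ of minors, the tnn cell is $S_{\mathcal{F}}=\{M\in \mathcal{M}^{\ge 0}_{m,p}(\mathbb{R})\mid [I|J](M)=0 \text{ if and only if } [I|J]\in\mathcal{F}\}$, where $[I|J]$ runs through all minors. The family $\mathcal{F}$ is admissible if $S_{\mathcal{F}}\neq\emptyset$. The families $\mathcal{M}(w)$: set $N=m+p$. For a positive integer $r$ let $w_\circ^r\in S_r$ be $w_\circ^r(i)=r+1-i$. For finite $I,J\subset\mathbb{N}$ with $|I|=|J|=t$, $I=\{i_1<\dots<i_t\}$, $J=\{j_1<\dots<j_t\}$, write $I\le J$ if $i_l\le j_l$ for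 all $l$. For $w\in\mathcal{S}$, $\mathcal{M}(w)$ is the set of minors $[I|\Lambda]$ with $I\subseteq[1,m]$, $\Lambda\subseteq[1,p]$, $|I|=|\Lambda|$, satisfying at least one of the following conditions: (1) $I\not\le w_\circ^m w(L)$ for all $L\subseteq[1,p]\cap w^{-1}[1,m]$ such that $|L|=|I|$ and $L\le\Lambda$. (2) $m+\Lambda\not\le w\,w_\circ^N(L)$ for all $L\subseteq[1,m]\cap w_\circ^N w^{-1}[m+1,N]$ such that $|L|=|\Lambda|$ and $L\le I$ (here $m+\Lambda=\{m+\lambda\mid\lambda\in\Lambda\}$). (3) There exist $1\le r\le s\le p$ such that $|\Lambda\cap[r,s]|>|[r,s]\setminus w^{-1}[m+r,m+s]|$. (4) There exist $1\le r\le s\le m$ such that $|I\cap[r,s]|>|w_\circ^N[r,s]\setminus w^{-1}w_\circ^m[r,s]|$. *)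

theory Defs
  imports "Jordan_Normal_Form.Determinant" "Jordan_Normal_Form.DL_Submatrix" "HOL-Combinatorics.Permutations"
begin

text \<open>
  Row and column index sets are sets of natural numbers counted from 1, so that the intervals
  and permutations below can be read literally. The minor with rows \<open>I\<close> and columns \<open>\<Lambda>\<close>, as a
  function on \<open>m \<times> p\<close> matrices, is represented by its label \<open>(I, \<Lambda>)\<close>: distinct labels give
  distinct polynomial functions. The label \<open>({}, {})\<close> is that of the empty minor.
\<close>

definition minors :: "nat \<Rightarrow> nat \<Rightarrow> (nat set \<times> nat set) set" where
  "minors m p = {(I, \<Lambda>). I \<subseteq> {1..m} \<and> \<Lambda> \<subseteq> {1..p} \<and> card I = card \<Lambda>}"

text \<open>Matrices are indexed from 0; hence the shift of the index sets.\<close>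

definition minor :: "nat set \<Rightarrow> nat set \<Rightarrow> 'a :: comm_ring_1 mat \<Rightarrow> 'a" where
  "minor I \<Lambda> M = det (submatrix M {i. Suc i \<in> I} {j. Suc j \<in> \<Lambda>})"

definition tnn_mats :: "nat \<Rightarrow> nat \<Rightarrow> real mat set" where
  "tnn_mats m p = {M \<in> carrier_mat m p. \<forall>(I, \<Lambda>) \<in> minors m p. minor I \<Lambda> M \<ge> 0}"

definition tnn_cell :: "nat \<Rightarrow> nat \<Rightarrow> (nat set \<times> nat set) set \<Rightarrow> real mat set" where
  "tnn_cell m p F =
     {M \<in> tnn_mats m p. \<forall>(I, \<Lambda>) \<in> minors m p. minor I \<Lambda> M = 0 \<longleftrightarrow> (I, \<Lambda>) \<in> F}"

definition admissible :: "nat \<Rightarrow> nat \<Rightarrow> (nat set \<times> nat set) set \<Rightarrow> bool" where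
  "admissible m p F \<longleftrightarrow> F \<subseteq> minors m p \<and> tnn_cell m p F \<noteq> {}"

text \<open>
  The longest element of the symmetric group on \<open>{1..r}\<close>, extended by the identity as is
  customary for \<^const>\<open>permutes\<close>.
\<close>

definition w_circ :: "nat \<Rightarrow> nat \<Rightarrow> nat" where
  "w_circ r i = (if i \<in> {1..r} then r + 1 - i else i)"

text \<open>
  Elementwise comparison of the increasing enumerations of two finite sets; it fails if the
  cardinalities differ.
\<close>

definition set_le :: "nat set \<Rightarrow> nat set \<Rightarrow> bool" (infix "\<le>\<^sub>s" 50) where
  "I \<le>\<^sub>s J \<longleftrightarrow> list_all2 (\<le>) (sorted_list_of_set I) (sorted_list_of_set J)"

definition restricted_perms :: "nat \<Rightarrow> nat \<Rightarrow> (nat \<Rightarrow> nat) set" where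
  "restricted_perms m p =
     {w. w permutes {1..m + p} \<and>
         (\<forall>i\<in>{1..m + p}. - int p \<le> int (w i) - int i \<and> int (w i) - int i \<le> int m)}"

definition M_cond1 :: "nat \<Rightarrow> nat \<Rightarrow> (nat \<Rightarrow> nat) \<Rightarrow> nat set \<Rightarrow> nat set \<Rightarrow> bool" where
  "M_cond1 m p w I \<Lambda> \<longleftrightarrow>
     (\<forall>L. L \<subseteq> {1..p} \<inter> w -` {1..m} \<and> card L = card I \<and> L \<le>\<^sub>s \<Lambda> \<longrightarrow>
          \<not> I \<le>\<^sub>s w_circ m ` w ` L)"

definition M_cond2 :: "nat \<Rightarrow> nat \<Rightarrow> (nat \<Rightarrow> nat) \<Rightarrow> nat set \<Rightarrow> nat set \<Rightarrow> bool" where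
  "M_cond2 m p w I \<Lambda> \<longleftrightarrow>
     (\<forall>L. L \<subseteq> {1..m} \<inter> w_circ (m + p) ` w -` {m + 1..m + p} \<and> card L = card \<Lambda> \<and> L \<le>\<^sub>s I \<longrightarrow>
          \<not> (+) m ` \<Lambda> \<le>\<^sub>s w ` w_circ (m + p) ` L)"

definition M_cond3 :: "nat \<Rightarrow> nat \<Rightarrow> (nat \<Rightarrow> nat) \<Rightarrow> nat set \<Rightarrow> nat set \<Rightarrow> bool" where
  "M_cond3 m p w I \<Lambda> \<longleftrightarrow>
     (\<exists>r s. 1 \<le> r \<and> r \<le> s \<and> s \<le> p \<and>
        card (\<Lambda> \<inter> {r..s}) > card ({r..s} - w -` {m + r..m + s}))"

definition M_cond4 :: "nat \<Rightarrow> nat \<Rightarrow> (nat \<Rightarrow> nat) \<Rightarrow> nat set \<Rightarrow> nat set \<Rightarrow> bool" where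
  "M_cond4 m p w I \<Lambda> \<longleftrightarrow>
     (\<exists>r s. 1 \<le> r \<and> r \<le> s \<and> s \<le> m \<and>
        card (I \<inter> {r..s}) > card (w_circ (m + p) ` {r..s} - w -` w_circ m ` {r..s}))"

definition M_family :: "nat \<Rightarrow> nat \<Rightarrow> (nat \<Rightarrow> nat) \<Rightarrow> (nat set \<times> nat set) set" where
  "M_family m p w =
     {(I, \<Lambda>) \<in> minors m p.
        M_cond1 m p w I \<Lambda> \<or> M_cond2 m p w I \<Lambda> \<or> M_cond3 m p w I \<Lambda> \<or> M_cond4 m p w I \<Lambda>}"

end

theory Submission
  imports Defs "HOL-Library.Function_Algebras"
begin

text \<open>
  Read the columns of an \<open>m \<times> p\<close> matrix as vectors \<open>v 1, \<dots>, v p\<close> of \<open>\<real>\<^sup>m\<close> and append the unit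
  vectors, with alternating signs and in reverse order, as \<open>v (p + 1), \<dots>, v (m + p)\<close>. Expanding a
  maximal minor of this \<open>m \<times> (m + p)\<close> matrix along its unit columns leaves a minor of the original
  matrix, and every minor arises exactly once (\<open>minor_eq_plucker\<close>, \<open>ex_plucker_index\<close>). So a totally
  nonnegative matrix is a vector configuration whose Pluecker coordinates are all nonnegative, and
  its vanishing minors are the \<open>m\<close>-sets that are not bases of the matroid of the configuration.

  Nonnegativity makes this matroid very special: it is determined by the ranks of the cyclic
  intervals of \<open>{1..m + p}\<close> (\<open>nonfree_imp_cyclic_rank_violation\<close>). Indeed, let \<open>J\<close> be an \<open>m\<close>-set that
  is not a basis, and \<open>C\<close> a circuit inside \<open>J\<close>. The three-term Pluecker relation, all of whose terms
  are nonnegative, shows that in a basis of the contraction by \<open>C\<close> an element can only be exchanged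
  for an element of the same arc of the complement of \<open>C\<close> on the circle (\<open>no_crossing\<close>). Hence all
  these bases have equally many elements in each arc. As \<open>J - C\<close> is smaller than such a basis, it has
  too few elements in some arc, hence too many in the complement of that arc, a cyclic interval.

  The ranks of cyclic intervals of any configuration are in turn recorded by a permutation: \<open>w l\<close> is
  the first position, going backwards around the circle, such that the vectors from there up to \<open>v l\<close>,
  without \<open>v l\<close> itself, span \<open>v l\<close>. It is injective by the exchange property of spans, and because the last \<open>m\<close> vectors are a
  basis it lies in the set of restricted permutations (\<open>ex_encoding\<close>). Counting greedily,
  the rank of an interval is a number of values of \<open>w\<close> (\<open>window_basis\<close>). Thus the vanishing minors
  are those violating a rank bound for some cyclic interval. The four conditions that define the
  family of \<open>w\<close> are these bounds for the four kinds of cyclic intervals: intervals of columns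
  (\<open>M_cond3\<close>), the complements of intervals of rows (\<open>M_cond4\<close>), and the intervals containing exactly
  one of the two boundaries between rows and columns (\<open>M_cond1\<close>, \<open>M_cond2\<close>). In the last two cases the
  bounds are the cut conditions for the existence of a linkage \<open>L\<close> (\<open>ex_linkage_iff\<close>), and
  \<open>ex_violated_iff_M_cond\<close> puts the four cases together.

  Conversely every restricted permutation comes from a nonnegative configuration
  (\<open>ex_config_encoding\<close>). One starts from the zero matrix, whose permutation fixes every element of
  the circle, and adds vectors to earlier ones: adding \<open>v j\<close> to \<open>v i\<close>, where every element between
  \<open>i\<close> and \<open>j\<close> is a loop or a coloop, interchanges the values of the permutation at \<open>i\<close> and \<open>j\<close> if
  this creates an ascent, and with the right sign it keeps all Pluecker coordinates nonnegative (locale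
  \<open>bridge\<close>). A change of basis brings the final configuration into the form given by a matrix
  (\<open>ex_matrix\<close>).
\<close>

section \<open>Free families of vectors and determinants\<close>

text \<open>
  Vectors of \<open>\<real>\<^sup>m\<close> are functions that vanish from \<open>m\<close> on, so that the dimension need not be a type.
\<close>

definition smul :: "real \<Rightarrow> (nat \<Rightarrow> real) \<Rightarrow> nat \<Rightarrow> real" (infixr "*\<^sub>f" 75)
  where "c *\<^sub>f f = (\<lambda>i. c * f i)"

lemma smul_apply [simp]: "(c *\<^sub>f f) i = c * f i"
  by (simp add: smul_def)

interpretation fv: vector_space smul
  by unfold_locales (auto simp: fun_eq_iff algebra_simps)

text \<open>
  Linear independence of an indexed family: unlike for the set of its members, a repeated vector
  makes the family dependent.
\<close>

definition free :: "('i \<Rightarrow> nat \<Rightarrow> real) \<Rightarrow> 'i set \<Rightarrow> bool" where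
  "free v K \<longleftrightarrow> (\<forall>k\<in>K. v k \<notin> fv.span (v ` (K - {k})))"

lemma free_subset:
  assumes "free v K" "L \<subseteq> K"
  shows "free v L"
  unfolding free_def
proof
  fix k assume "k \<in> L"
  then have "v k \<notin> fv.span (v ` (K - {k}))" using assms by (auto simp: free_def)
  moreover have "fv.span (v ` (L - {k})) \<subseteq> fv.span (v ` (K - {k}))"
    using assms(2) by (intro fv.span_mono) auto
  ultimately show "v k \<notin> fv.span (v ` (L - {k}))" by auto
qed

lemma free_insert:
  assumes "free v K" "v x \<notin> fv.span (v ` K)"
  shows "free v (insert x K)"
  unfolding free_def
proof
  have xK: "x \<notin> K"
    using assms(2) by (meson fv.span_base image_eqI)
  fix k assume k: "k \<in> insert x K"
  show "v k \<notin> fv.span (v ` (insert x K - {k}))"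
  proof (cases "k = x")
    case True
    then show ?thesis using assms(2) xK by simp
  next
    case False
    then have kK: "k \<in> K" using k by simp
    show ?thesis
    proof
      assume "v k \<in> fv.span (v ` (insert x K - {k}))"
      then have "v k \<in> fv.span (insert (v x) (v ` (K - {k})))"
        using False by (simp add: insert_Diff_if)
      moreover have "v k \<notin> fv.span (v ` (K - {k}))"
        using assms(1) kK by (auto simp: free_def)
      ultimately have "v x \<in> fv.span (insert (v k) (v ` (K - {k})))"
        by (rule fv.in_span_insert)
      then show False using assms(2) kK by (metis image_insert insert_Diff)
    qed
  qed
qed

lemma free_card_le:
  assumes "free v K" "finite C" "v ` K \<subseteq> fv.span C"
  shows "finite K \<and> card K \<le> card C"
proof -
  have inj: "inj_on v K"
  proof (rule inj_onI, rule ccontr)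
    fix x y assume "x \<in> K" "y \<in> K" "v x = v y" "x \<noteq> y"
    then have "v x \<in> v ` (K - {x})" by auto
    then show False using assms(1) \<open>x \<in> K\<close> by (auto simp: free_def intro: fv.span_base)
  qed
  have "fv.independent (v ` K)"
  proof
    assume "fv.dependent (v ` K)"
    then obtain k where k: "k \<in> K" "v k \<in> fv.span (v ` K - {v k})"
      by (auto simp: fv.dependent_def)
    have "v ` K - {v k} \<subseteq> v ` (K - {k})" by auto
    then have "v k \<in> fv.span (v ` (K - {k}))" using k(2) fv.span_mono by blast
    then show False using assms(1) k(1) by (auto simp: free_def)
  qed
  then show ?thesis
    using fv.independent_span_bound[OF assms(2) _ assms(3)] inj
    by (metis card_image finite_imageD)
qed

lemma free_extend:
  assumes "free v K" "K \<subseteq> F" "finite F"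
  obtains B where "K \<subseteq> B" "B \<subseteq> F" "free v B" "v ` F \<subseteq> fv.span (v ` B)"
proof -
  let ?S = "{B. K \<subseteq> B \<and> B \<subseteq> F \<and> free v B}"
  have "finite ?S" using assms(3) by (auto intro: finite_subset[of _ "Pow F"])
  moreover have "K \<in> ?S" using assms by auto
  ultimately obtain B where B: "B \<in> ?S" "\<And>C. C \<in> ?S \<Longrightarrow> B \<subseteq> C \<Longrightarrow> C = B"
    by (metis (no_types, lifting) finite_has_maximal2)
  have "v x \<in> fv.span (v ` B)" if "x \<in> F" for x
  proof (rule ccontr)
    assume n: "v x \<notin> fv.span (v ` B)"
    then have "insert x B \<in> ?S" using free_insert B(1) that by auto
    then have "x \<in> B" using B(2)[of "insert x B"] by auto
    then show False using n by (simp add: fv.span_base)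
  qed
  then show thesis using that B(1) by blast
qed

text \<open>
  The determinant of a list of vectors restricted to a list of coordinates. The coordinates are a
  list as well because expanding along a unit vector deletes one of them.
\<close>

definition detv :: "nat list \<Rightarrow> (nat \<Rightarrow> real) list \<Rightarrow> real" where
  "detv rs vs = det (mat (length vs) (length vs) (\<lambda>(i, j). (vs ! j) (rs ! i)))"

text \<open>
  Multilinearity in one vector, with the cofactors as coefficients. They do not depend on that
  vector, hence can be taken at the zero vector.
\<close>

lemma detv_expand:
  "\<exists>c. \<forall>x. detv rs (xs @ x # ys) = (\<Sum>i<length xs + Suc (length ys). x (rs ! i) * c i)"
proof -
  let ?n = "length xs + Suc (length ys)"
  let ?A = "\<lambda>x. mat ?n ?n (\<lambda>(i, j). ((xs @ x # ys) ! j) (rs ! i))"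
  let ?c = "\<lambda>i. cofactor (?A 0) i (length xs)"
  have "detv rs (xs @ x # ys) = (\<Sum>i<?n. x (rs ! i) * ?c i)" for x
  proof -
    have "detv rs (xs @ x # ys) = (\<Sum>i<?n. ?A x $$ (i, length xs) * cofactor (?A x) i (length xs))"
      using laplace_expansion_column[of "?A x" ?n "length xs"] by (simp add: detv_def)
    also have "\<dots> = (\<Sum>i<?n. x (rs ! i) * ?c i)"
    proof (rule sum.cong[OF refl])
      fix i assume i: "i \<in> {..<?n}"
      have "mat_delete (?A x) i (length xs) = mat_delete (?A 0) i (length xs)"
        by (rule eq_matI) (auto simp: mat_delete_def nth_append nth_Cons')
      then show "?A x $$ (i, length xs) * cofactor (?A x) i (length xs) = x (rs ! i) * ?c i"
        using i by (simp add: cofactor_def)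
    qed
    finally show ?thesis .
  qed
  then show ?thesis by (intro exI allI)
qed

lemma detv_add:
  "detv rs (xs @ (x + y) # ys) = detv rs (xs @ x # ys) + detv rs (xs @ y # ys)"
proof -
  obtain c where c: "\<And>x. detv rs (xs @ x # ys) = (\<Sum>i<length xs + Suc (length ys). x (rs ! i) * c i)"
    using detv_expand by metis
  show ?thesis unfolding c by (simp add: sum.distrib ring_distribs)
qed

lemma detv_smul: "detv rs (xs @ (a *\<^sub>f x) # ys) = a * detv rs (xs @ x # ys)"
proof -
  obtain c where c: "\<And>x. detv rs (xs @ x # ys) = (\<Sum>i<length xs + Suc (length ys). x (rs ! i) * c i)"
    using detv_expand by metis
  show ?thesis unfolding c sum_distrib_left by (intro sum.cong) simp_all
qed

lemma detv_repeat:
  assumes "i < length vs" "j < length vs" "i \<noteq> j" "vs ! i = vs ! j"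
  shows "detv rs vs = 0"
proof -
  let ?A = "mat (length vs) (length vs) (\<lambda>(i, j). (vs ! j) (rs ! i))"
  have "col ?A i = col ?A j"
    using assms(1,2) by (intro eq_vecI) (simp_all add: assms(4))
  then show ?thesis
    unfolding detv_def using det_identical_columns[of ?A "length vs" i j] assms(1-3) by simp
qed

lemma detv_mem_left: "x \<in> set xs \<Longrightarrow> detv rs (xs @ x # ys) = 0"
proof -
  assume "x \<in> set xs"
  then obtain j where "j < length xs" "xs ! j = x" by (auto simp: in_set_conv_nth)
  then show ?thesis
    by (intro detv_repeat[of j _ "length xs"]) (auto simp: nth_append)
qed

lemma detv_mem_right: "x \<in> set ys \<Longrightarrow> detv rs (xs @ x # ys) = 0"
proof -
  assume "x \<in> set ys"
  then obtain j where "j < length ys" "ys ! j = x" by (auto simp: in_set_conv_nth)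
  then show ?thesis
    by (intro detv_repeat[of "length xs" _ "Suc (length xs + j)"]) (auto simp: nth_append)
qed

text \<open>
  Vanishing of a determinant is a linear condition on each of its vectors, so it passes from
  generators to their span.
\<close>

lemma detv_span:
  assumes "x \<in> fv.span S" "\<And>s. s \<in> S \<Longrightarrow> detv rs (xs @ s # ys) = 0"
  shows "detv rs (xs @ x # ys) = 0"
  using assms(1)
proof (rule fv.span_induct[where P = "\<lambda>x. detv rs (xs @ x # ys) = 0"])
  have "detv rs (xs @ 0 # ys) = 0" using detv_smul[of rs xs 0 0 ys] by (simp add: fun_eq_iff)
  then show "fv.subspace {x. detv rs (xs @ x # ys) = 0}"
    by (auto simp: fv.subspace_def detv_add detv_smul)
qed (use assms(2) in auto)

lemma detv_swap: "detv rs (xs @ x # y # ys) = - detv rs (xs @ y # x # ys)"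
proof -
  have "0 = detv rs (xs @ (x + y) # (x + y) # ys)" by (simp add: detv_mem_right)
  also have "\<dots> = detv rs (xs @ x # (x + y) # ys) + detv rs (xs @ y # (x + y) # ys)"
    by (rule detv_add)
  also have "detv rs (xs @ x # (x + y) # ys) = detv rs (xs @ x # y # ys)"
    using detv_add[of rs "xs @ [x]" x y ys] detv_mem_right[of x "x # ys" rs xs] by simp
  also have "detv rs (xs @ y # (x + y) # ys) = detv rs (xs @ y # x # ys)"
    using detv_add[of rs "xs @ [y]" x y ys] detv_mem_right[of y "y # ys" rs xs] by simp
  finally show ?thesis by simp
qed

lemma detv_move: "detv rs (xs @ x # ys @ zs) = (-1) ^ length ys * detv rs (xs @ ys @ x # zs)"
proof (induction ys arbitrary: xs)
  case (Cons y ys)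
  have "detv rs (xs @ x # y # ys @ zs) = - detv rs ((xs @ [y]) @ x # ys @ zs)"
    using detv_swap[of rs xs x y "ys @ zs"] by simp
  then show ?case using Cons.IH[of "xs @ [y]"] by simp
qed simp

definition plucker :: "nat \<Rightarrow> (nat \<Rightarrow> nat \<Rightarrow> real) \<Rightarrow> nat set \<Rightarrow> real" where
  "plucker m v K = detv [0..<m] (map v (sorted_list_of_set K))"

text \<open>
  A vector in the span of the others makes the determinant vanish by \<open>detv_span\<close>; a vector in the
  kernel of a singular matrix expresses one column by the others.
\<close>

lemma plucker_nonzero_iff:
  assumes K: "finite K" "card K = m" and v: "\<And>k i. k \<in> K \<Longrightarrow> m \<le> i \<Longrightarrow> v k i = 0"
  shows "plucker m v K \<noteq> 0 \<longleftrightarrow> free v K"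
proof
  assume nz: "plucker m v K \<noteq> 0"
  show "free v K" unfolding free_def
  proof (intro ballI notI)
    fix k assume k: "k \<in> K" "v k \<in> fv.span (v ` (K - {k}))"
    obtain xs ys where xy: "sorted_list_of_set K = xs @ k # ys"
      using k(1) K(1) by (metis set_sorted_list_of_set split_list)
    have "distinct (xs @ k # ys)" using xy by (metis distinct_sorted_list_of_set)
    moreover have "set (xs @ k # ys) = K" using xy K(1) by (metis set_sorted_list_of_set)
    ultimately have others: "K - {k} = set xs \<union> set ys" by auto
    have "detv [0..<m] (map v xs @ s # map v ys) = 0" if "s \<in> v ` (K - {k})" for s
    proof -
      have "s \<in> set (map v xs) \<or> s \<in> set (map v ys)" using that unfolding others by auto
      then show ?thesis using detv_mem_left detv_mem_right by blast
    qed
    then have "detv [0..<m] (map v xs @ v k # map v ys) = 0"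
      using detv_span[OF k(2)] by blast
    then show False using nz by (simp add: plucker_def xy)
  qed
next
  assume fr: "free v K"
  let ?ks = "sorted_list_of_set K"
  let ?A = "mat m m (\<lambda>(i, j). v (?ks ! j) i)"
  have len: "length ?ks = m" using K by simp
  show "plucker m v K \<noteq> 0"
  proof
    assume "plucker m v K = 0"
    moreover have "plucker m v K = det ?A"
      unfolding plucker_def detv_def length_map len
      by (intro arg_cong[of _ _ det] eq_matI) (simp_all add: K)
    ultimately obtain x where x: "x \<in> carrier_vec m" "x \<noteq> 0\<^sub>v m" "?A *\<^sub>v x = 0\<^sub>v m"
      using det_0_iff_vec_prod_zero[of ?A m] by auto
    then obtain t where t: "t < m" "x $ t \<noteq> 0" by (metis carrier_vecD eq_vecI index_zero_vec)
    let ?k = "?ks ! t"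
    have inj: "?ks ! j = ?ks ! t \<longleftrightarrow> j = t" if "j < m" for j
      using that t(1) len nth_eq_iff_index_eq[OF distinct_sorted_list_of_set, of j K t] by metis
    have kK: "?ks ! j \<in> K" if "j < m" for j using that len K(1) by (metis nth_mem set_sorted_list_of_set)
    have z: "(\<Sum>j<m. x $ j * v (?ks ! j) i) = 0" for i
    proof (cases "i < m")
      case True
      then have "(?A *\<^sub>v x) $ i = 0" using x(3) by simp
      then show ?thesis using True x(1)
        by (simp add: scalar_prod_def mult.commute lessThan_atLeast0)
    next
      case False
      then show ?thesis using v kK by (simp add: not_less)
    qed
    have "v ?k = (\<Sum>j\<in>{..<m} - {t}. (- x $ j / x $ t) *\<^sub>f v (?ks ! j))"
    proof
      fix i
      have "x $ t * v ?k i + (\<Sum>j\<in>{..<m} - {t}. x $ j * v (?ks ! j) i) = 0"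
        using z[of i] t(1) by (subst (asm) sum.remove[of _ t]) auto
      then have "v ?k i = (\<Sum>j\<in>{..<m} - {t}. x $ j * v (?ks ! j) i) * (- 1 / x $ t)"
        using t(2) by (simp add: field_simps)
      also have "\<dots> = (\<Sum>j\<in>{..<m} - {t}. (- x $ j / x $ t) * v (?ks ! j) i)"
        unfolding sum_distrib_right by (rule sum.cong) (auto simp: field_simps)
      also have "\<dots> = (\<Sum>j\<in>{..<m} - {t}. (- x $ j / x $ t) *\<^sub>f v (?ks ! j)) i"
        by (induction rule: infinite_finite_induct[of _ "{..<m} - {t}"]) auto
      finally show "v ?k i = (\<Sum>j\<in>{..<m} - {t}. (- x $ j / x $ t) *\<^sub>f v (?ks ! j)) i" .
    qed
    also have "\<dots> \<in> fv.span (v ` (K - {?k}))"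
      using kK inj by (intro fv.span_sum fv.span_scale fv.span_base) auto
    finally show False using fr kK[OF t(1)] by (auto simp: free_def)
  qed
qed

section \<open>The three-term Pluecker relation\<close>

lemma span_unit_vectors:
  assumes "\<And>i. m \<le> i \<Longrightarrow> f i = 0"
  shows "f \<in> fv.span ((\<lambda>i j. if j = i then 1 else 0) ` {..<m})"
proof -
  have "f = (\<Sum>i<m. f i *\<^sub>f (\<lambda>j. if j = i then 1 else 0))"
  proof
    fix j
    have "(\<Sum>i<k. f i *\<^sub>f (\<lambda>j. if j = i then 1 else 0)) j = (if j < k then f j else 0)" for k
      by (induction k) (auto simp: less_Suc_eq)
    then show "f j = (\<Sum>i<m. f i *\<^sub>f (\<lambda>j. if j = i then 1 else 0)) j"
      using assms by (simp add: not_less)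
  qed
  also have "\<dots> \<in> fv.span ((\<lambda>i j. if j = i then 1 else 0) ` {..<m})"
    by (intro fv.span_sum fv.span_scale fv.span_base) auto
  finally show ?thesis .
qed

lemma sorted_list_of_set_insert_split:
  fixes x :: nat
  assumes "finite A" "x \<notin> A"
  shows "sorted_list_of_set (insert x A) =
    sorted_list_of_set {a \<in> A. a < x} @ x # sorted_list_of_set {a \<in> A. x < a}" (is ?insert)
    and "sorted_list_of_set A = sorted_list_of_set {a \<in> A. a < x} @ sorted_list_of_set {a \<in> A. x < a}"
      (is ?split)
proof -
  have uniq: "sorted_list_of_set B = xs" if "sorted_wrt (<) xs" "set xs = B" for B and xs :: "nat list"
  proof -
    have "finite B" using that(2) by auto
    then show ?thesis
      by (intro strict_sorted_equal[OF that(1) strict_sorted_list_of_set]) (simp add: that(2))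
  qed
  show ?insert
  proof (rule uniq)
    show "sorted_wrt (<) (sorted_list_of_set {a \<in> A. a < x} @ x # sorted_list_of_set {a \<in> A. x < a})"
      using assms(1) by (auto simp: sorted_wrt_append)
    show "set (sorted_list_of_set {a \<in> A. a < x} @ x # sorted_list_of_set {a \<in> A. x < a}) = insert x A"
      using assms by (auto simp: neq_iff)
  qed
  show ?split
  proof (rule uniq)
    show "sorted_wrt (<) (sorted_list_of_set {a \<in> A. a < x} @ sorted_list_of_set {a \<in> A. x < a})"
      using assms(1) by (auto simp: sorted_wrt_append)
    show "set (sorted_list_of_set {a \<in> A. a < x} @ sorted_list_of_set {a \<in> A. x < a}) = A"
      using assms by auto (metis nat_neq_iff)
  qed
qed

text \<open>
  In the sorted list of columns, the new one is moved to the end past the larger ones; this is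
  the source of the signs in the relations between Pluecker coordinates.
\<close>

lemma detv_insert:
  fixes x :: nat
  assumes "finite A" "x \<notin> A"
  shows "detv rs (map v (sorted_list_of_set (insert x A)) @ zs) =
    (-1) ^ card {a \<in> A. x < a} * detv rs (map v (sorted_list_of_set A) @ v x # zs)"
  unfolding sorted_list_of_set_insert_split(1)[OF assms] sorted_list_of_set_insert_split(2)[OF assms]
  using detv_move[of rs "map v (sorted_list_of_set {a \<in> A. a < x})" "v x"
      "map v (sorted_list_of_set {a \<in> A. x < a})" zs] assms(1) by simp

locale vector_config =
  fixes n m :: nat and v :: "nat \<Rightarrow> nat \<Rightarrow> real"
  assumes supp: "m \<le> i \<Longrightarrow> v k i = 0"
begin

lemma free_card_le_dim: "free v K \<Longrightarrow> finite K \<and> card K \<le> m"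
proof -
  let ?U = "(\<lambda>i j. if j = i then 1 else 0 :: real) ` {..<m}"
  assume "free v K"
  moreover have "v ` K \<subseteq> fv.span ?U" using span_unit_vectors supp by blast
  ultimately have "finite K \<and> card K \<le> card ?U" by (intro free_card_le) auto
  then show ?thesis using card_image_le[of "{..<m}" "\<lambda>i j. if j = i then 1 else 0 :: real"] by simp
qed

lemma basis_spans:
  assumes "free v K" "card K = m"
  shows "v x \<in> fv.span (v ` K)"
proof (rule ccontr)
  assume n: "v x \<notin> fv.span (v ` K)"
  then have "x \<notin> K" by (meson fv.span_base image_eqI)
  moreover have "finite K" using assms free_card_le_dim by blast
  ultimately have "card (insert x K) = Suc m" using assms by simp
  then show False using free_card_le_dim[OF free_insert[OF assms(1) n]] by simp
qed

lemma plucker_nonzero: "finite K \<Longrightarrow> card K = m \<Longrightarrow> plucker m v K \<noteq> 0 \<longleftrightarrow> free v K"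
  by (rule plucker_nonzero_iff) (auto simp: supp)

text \<open>
  Up to signs, the coordinate of \<open>A\<close> together with two elements is an alternating bilinear form of
  their vectors. The difference of the two sides is linear in \<open>v c\<close> and vanishes on a basis.
\<close>

lemma plucker3:
  assumes A: "finite A" "card A + 2 = m" and ord: "a < b" "b < c" "c < d"
    and nin: "a \<notin> A" "b \<notin> A" "c \<notin> A" "d \<notin> A"
    and fr: "free v (insert a (insert b A))"
  shows "plucker m v (insert a (insert c A)) * plucker m v (insert b (insert d A)) =
    plucker m v (insert a (insert b A)) * plucker m v (insert c (insert d A)) +
    plucker m v (insert a (insert d A)) * plucker m v (insert b (insert c A))"
proof -
  define \<delta> where "\<delta> x y = detv [0..<m] (map v (sorted_list_of_set A) @ [x, y])" for x y
  define s where "s x = ((-1) ^ card {a \<in> A. x < a} :: real)" for x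
  have ss: "s x * s x = 1" for x unfolding s_def by (simp flip: power_add)
  have plu2: "plucker m v (insert x (insert y A)) = s x * s y * \<delta> (v x) (v y)"
    if "x < y" "x \<notin> A" "y \<notin> A" for x y
  proof -
    have "plucker m v (insert y (insert x A)) = (-1) ^ card {a \<in> insert x A. y < a} *
        detv [0..<m] (map v (sorted_list_of_set (insert x A)) @ [v y])"
      unfolding plucker_def
      using detv_insert[of "insert x A" y "[0..<m]" v "[]"] that A by simp
    also have "{a \<in> insert x A. y < a} = {a \<in> A. y < a}" using that by auto
    also have "detv [0..<m] (map v (sorted_list_of_set (insert x A)) @ [v y]) = s x * \<delta> (v x) (v y)"
      using detv_insert[of A x "[0..<m]" v "[v y]"] that A by (simp add: \<delta>_def s_def)
    finally show ?thesis by (simp add: s_def insert_commute)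
  qed
  have lin1: "\<delta> (x + x') y = \<delta> x y + \<delta> x' y" "\<delta> (r *\<^sub>f x) y = r * \<delta> x y" for x x' y r
    by (simp_all add: \<delta>_def detv_add detv_smul)
  have lin2: "\<delta> y (x + x') = \<delta> y x + \<delta> y x'" "\<delta> y (r *\<^sub>f x) = r * \<delta> y x" for x x' y r
    using detv_add[of _ "map v (sorted_list_of_set A) @ [y]" x x' "[]"]
      detv_smul[of _ "map v (sorted_list_of_set A) @ [y]" r x "[]"]
    by (simp_all add: \<delta>_def)
  have alt: "\<delta> x y = - \<delta> y x" for x y
    using detv_swap[of _ "map v (sorted_list_of_set A)" x y "[]"] by (simp add: \<delta>_def)
  have alt0: "\<delta> x x = 0" for x using alt[of x x] by simp
  have A0: "\<delta> (v x) y = 0" if "x \<in> A" for x y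
    using that A unfolding \<delta>_def by (intro detv_mem_left) simp
  have A0': "\<delta> y (v x) = 0" if "x \<in> A" for x y
    using A0[OF that] alt[of y "v x"] by simp
  \<comment> \<open>the relation as a linear form in the vector \<open>z\<close> of \<open>c\<close>\<close>
  define T where "T z = \<delta> (v a) (v b) * \<delta> z (v d) - \<delta> (v a) z * \<delta> (v b) (v d)
      + \<delta> (v a) (v d) * \<delta> (v b) z" for z
  have T0: "T z = 0" if "z \<in> v ` (insert a (insert b A))" for z
    using that alt[of "v b" "v a"] by (auto simp: T_def alt0 A0 A0')
  have "fv.subspace {z. T z = 0}"
  proof -
    have "\<delta> 0 y = 0" "\<delta> y 0 = 0" for y
      using lin1(2)[of 0 0 y] lin2(2)[of y 0 0] by simp_all
    then have T00: "T 0 = 0" by (simp add: T_def)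
    have Tadd: "T (x + y) = T x + T y" for x y by (simp add: T_def lin1 lin2 algebra_simps)
    have Tsc: "T (r *\<^sub>f x) = r * T x" for r x by (simp add: T_def lin1 lin2 algebra_simps)
    show ?thesis by (auto simp: fv.subspace_def T00 Tadd Tsc)
  qed
  moreover have "v c \<in> fv.span (v ` insert a (insert b A))"
    using A ord nin fr by (intro basis_spans) auto
  ultimately have "T (v c) = 0" using fv.span_induct[of "v c" _ "\<lambda>z. T z = 0"] T0 by blast
  then have "\<delta> (v a) (v c) * \<delta> (v b) (v d) =
     \<delta> (v a) (v b) * \<delta> (v c) (v d) + \<delta> (v a) (v d) * \<delta> (v b) (v c)"
    by (simp add: T_def)
  then have "(s a * s b * s c * s d) * (\<delta> (v a) (v c) * \<delta> (v b) (v d)) =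
     (s a * s b * s c * s d) * (\<delta> (v a) (v b) * \<delta> (v c) (v d) + \<delta> (v a) (v d) * \<delta> (v b) (v c))"
    by simp
  then show ?thesis using ord nin by (simp add: plu2 algebra_simps)
qed

end

locale nonneg_config = vector_config +
  assumes nonneg: "K \<subseteq> {1..n} \<Longrightarrow> card K = m \<Longrightarrow> 0 \<le> plucker m v K"
begin

text \<open>
  In the three-term relation the right-hand side is positive here, so both factors on the left
  are nonzero. This is the only way in which nonnegativity enters the description of the
  bases.
\<close>

lemma no_crossing:
  assumes A: "A \<subseteq> {1..n}" "card A + 2 = m" and ord: "1 \<le> a" "a < b" "b < c" "c < d" "d \<le> n"
    and nin: "a \<notin> A" "b \<notin> A" "c \<notin> A" "d \<notin> A"
    and fr: "free v (insert a (insert b A))" "free v (insert b (insert c A))"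
      "free v (insert c (insert d A))" "free v (insert a (insert d A))"
  shows "free v (insert a (insert c A))" "free v (insert b (insert d A))"
proof -
  have fA: "finite A" using A(1) finite_subset by blast
  have ge: "0 \<le> plucker m v (insert x (insert y A))"
    and nz: "plucker m v (insert x (insert y A)) \<noteq> 0 \<longleftrightarrow> free v (insert x (insert y A))"
    if "x \<in> {a,b,c,d}" "y \<in> {a,b,c,d}" "x < y" for x y
  proof -
    have "x \<notin> A" "y \<notin> A" "x \<noteq> y" using that nin by auto
    then have "card (insert x (insert y A)) = m" using A(2) fA by simp
    moreover have "insert x (insert y A) \<subseteq> {1..n}" using that ord A(1) by auto
    ultimately show "0 \<le> plucker m v (insert x (insert y A))"
      "plucker m v (insert x (insert y A)) \<noteq> 0 \<longleftrightarrow> free v (insert x (insert y A))"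
      using nonneg plucker_nonzero fA by simp_all
  qed
  have "0 < plucker m v (insert x (insert y A))"
    if "free v (insert x (insert y A))" "x \<in> {a,b,c,d}" "y \<in> {a,b,c,d}" "x < y" for x y
    using ge[of x y] nz[of x y] that by linarith
  then have "0 < plucker m v (insert a (insert b A)) * plucker m v (insert c (insert d A)) +
    plucker m v (insert a (insert d A)) * plucker m v (insert b (insert c A))"
    using fr ord by (intro add_pos_pos mult_pos_pos) simp_all
  then have "plucker m v (insert a (insert c A)) * plucker m v (insert b (insert d A)) \<noteq> 0"
    using plucker3[OF fA A(2) ord(2-4) nin fr(1)] by simp
  then show "free v (insert a (insert c A))" "free v (insert b (insert d A))"
    using nz[of a c] nz[of b d] ord by simp_all
qed

end

section \<open>Nonnegative configurations: bases and cyclic intervals\<close>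

lemma card_exchange:
  assumes "finite B" "b \<in> B" "d \<notin> B"
  shows "card (insert d (B - {b})) = card B"
  using assms card_Suc_Diff1[OF assms(1,2)] by simp

lemma minimal_nonfree_subset:
  assumes "finite J" "\<not> free v J"
  obtains C where "C \<subseteq> J" "C \<noteq> {}" "\<And>a. a \<in> C \<Longrightarrow> free v (C - {a})"
    "\<And>a. a \<in> C \<Longrightarrow> v a \<in> fv.span (v ` (C - {a}))"
proof -
  let ?S = "{C. C \<subseteq> J \<and> \<not> free v C}"
  have "finite ?S" using assms(1) by (auto intro: finite_subset[of _ "Pow J"])
  moreover have "J \<in> ?S" using assms by auto
  ultimately obtain C where C: "C \<in> ?S" "\<And>D. D \<in> ?S \<Longrightarrow> D \<subseteq> C \<Longrightarrow> D = C"
    by (metis (no_types, lifting) finite_has_minimal2)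
  have fr: "free v (C - {a})" if "a \<in> C" for a
    using C(1) C(2)[of "C - {a}"] that by blast
  have "v a \<in> fv.span (v ` (C - {a}))" if "a \<in> C" for a
  proof (rule ccontr)
    assume "v a \<notin> fv.span (v ` (C - {a}))"
    then have "free v (insert a (C - {a}))" using fr[OF that] by (rule free_insert[rotated])
    then show False using that C(1) by (simp add: insert_absorb)
  qed
  moreover have "C \<noteq> {}" using C(1) by (auto simp: free_def)
  ultimately show thesis using that C(1) fr by blast
qed

definition cyclic_interval :: "nat \<Rightarrow> nat set \<Rightarrow> bool" where
  "cyclic_interval n F \<longleftrightarrow>
     (\<exists>c d. 1 \<le> c \<and> c \<le> d \<and> d \<le> n \<and> F = {c..d}) \<or>
     (\<exists>c d. 1 \<le> d \<and> d < c \<and> c \<le> n \<and> F = {c..n} \<union> {1..d})"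

text \<open>
  A label for the arc of the complement of \<open>C\<close> on the circle that contains \<open>x\<close>: the element of \<open>C\<close>
  at its start, or 0 for the arc that runs from the maximum of \<open>C\<close> through the end and the beginning
  of the ground set to the minimum of \<open>C\<close>.
\<close>

definition gap :: "nat set \<Rightarrow> nat \<Rightarrow> nat" where
  "gap C x = (if (\<exists>c\<in>C. c < x) \<and> (\<exists>c\<in>C. x < c) then Max {c \<in> C. c < x} else 0)"

lemma gap_neq_imp_separated:
  assumes "x < y" "gap C x \<noteq> gap C y" "x \<notin> C" "y \<notin> C"
  obtains c c' where "c \<in> C" "c' \<in> C" "x < c" "c < y" "c' < x \<or> y < c'"
proof -
  have "\<exists>c\<in>C. x < c \<and> c < y"
  proof (rule ccontr)
    assume none: "\<not> (\<exists>c\<in>C. x < c \<and> c < y)"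
    then have same: "c < x \<longleftrightarrow> c < y" "x < c \<longleftrightarrow> y < c" if "c \<in> C" for c
      using assms(1,3,4) that by (metis less_trans linorder_neqE_nat)+
    have "gap C x = gap C y"
      unfolding gap_def using same by (simp cong: bex_cong conj_cong)
    then show False using assms(2) by simp
  qed
  moreover have "\<exists>c'\<in>C. c' < x \<or> y < c'"
  proof (rule ccontr)
    assume "\<not> (\<exists>c'\<in>C. c' < x \<or> y < c')"
    then have "gap C x = 0" "gap C y = 0" by (auto simp: gap_def)
    then show False using assms(2) by simp
  qed
  ultimately show thesis using that by blast
qed

lemma cyclic_interval_Diff_gap:
  assumes C: "C \<subseteq> {1..n}" "C \<noteq> {}" and y: "y \<in> {1..n} - C" "gap C y = j"
  shows "cyclic_interval n ({1..n} - {x \<in> {1..n} - C. gap C x = j})"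
proof -
  have fC: "finite C" using C(1) finite_subset by blast
  show ?thesis
  proof (cases "j = 0")
    case True
    have iff: "gap C x = 0 \<longleftrightarrow> x < Min C \<or> Max C < x" if "x \<notin> C" for x
    proof -
      have "(\<exists>c\<in>C. c < x) \<longleftrightarrow> \<not> x < Min C"
        using Min_less_iff[OF fC C(2), of x] Min_in[OF fC C(2)] that by (metis linorder_neqE_nat less_asym)
      moreover have "(\<exists>c\<in>C. x < c) \<longleftrightarrow> \<not> Max C < x"
        using Max_gr_iff[OF fC C(2), of x] Max_in[OF fC C(2)] that by (metis linorder_neqE_nat less_asym)
      moreover have "Max {c \<in> C. c < x} \<noteq> 0" if "\<exists>c\<in>C. c < x"
      proof -
        have "Max {c \<in> C. c < x} \<in> {c \<in> C. c < x}" using that fC by (intro Max_in) auto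
        then show ?thesis using C(1) by auto
      qed
      ultimately show ?thesis by (auto simp: gap_def)
    qed
    have mem: "Min C \<le> x" "x \<le> Max C" if "x \<in> C" for x using that fC by auto
    have "1 \<le> Min C" "Min C \<le> Max C" "Max C \<le> n"
      using Min_in[OF fC C(2)] Max_in[OF fC C(2)] C(1) fC by auto
    have "x \<in> {1..n} - {x \<in> {1..n} - C. gap C x = j} \<longleftrightarrow> x \<in> {Min C..Max C}" for x
      using iff[of x] mem[of x] True \<open>1 \<le> Min C\<close> \<open>Max C \<le> n\<close>
      by (cases "x \<in> C") (auto simp: not_less)
    then have "{1..n} - {x \<in> {1..n} - C. gap C x = j} = {Min C..Max C}" by blast
    then show ?thesis
      unfolding cyclic_interval_def using \<open>1 \<le> Min C\<close> \<open>Min C \<le> Max C\<close> \<open>Max C \<le> n\<close> by blast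
  next
    case False
    then have ex: "\<exists>c\<in>C. c < y" "\<exists>c\<in>C. y < c" and j: "j = Max {c \<in> C. c < y}"
      using y by (auto simp: gap_def split: if_splits)
    have "j \<in> {c \<in> C. c < y}" unfolding j using ex(1) fC by (intro Max_in) auto
    then have jin: "j \<in> C" "j < y" by simp_all
    have jmax: "c \<le> j" if "c \<in> C" "c < y" for c using that fC j by simp
    define k where "k = Min {c \<in> C. y < c}"
    have "k \<in> {c \<in> C. y < c}" unfolding k_def using ex(2) fC by (intro Min_in) auto
    then have kin: "k \<in> C" "y < k" by simp_all
    have kmin: "k \<le> c" if "c \<in> C" "y < c" for c using that fC k_def by simp
    have out: "c \<le> j \<or> k \<le> c" if "c \<in> C" for c
      using jmax[OF that] kmin[OF that] y(1) that by (metis DiffD2 linorder_neqE_nat)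
    have iff: "gap C x = j \<longleftrightarrow> j < x \<and> x < k" if "x \<notin> C" for x
    proof
      assume "j < x \<and> x < k"
      then have "c \<le> j" if "c \<in> C" "c < x" for c using out[OF that(1)] that(2) by linarith
      then have "Max {c \<in> C. c < x} = j"
        using jin \<open>j < x \<and> x < k\<close> fC by (intro Max_eqI) auto
      then show "gap C x = j" using \<open>j < x \<and> x < k\<close> jin kin by (auto simp: gap_def)
    next
      assume g: "gap C x = j"
      then have e: "\<exists>c\<in>C. c < x" "\<exists>c\<in>C. x < c" and m: "Max {c \<in> C. c < x} = j"
        using False by (auto simp: gap_def split: if_splits)
      have "j \<in> {c \<in> C. c < x}" unfolding m[symmetric] using e(1) fC by (intro Max_in) auto
      then have "j < x" by simp
      moreover have "x < k"
      proof (rule ccontr)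
        assume "\<not> x < k"
        moreover have "k \<noteq> x" using kin(1) that by auto
        ultimately have "k \<in> {c \<in> C. c < x}" using kin(1) by simp
        then have "k \<le> Max {c \<in> C. c < x}" using fC by (intro Max_ge) auto
        then have "k \<le> j" using m by simp
        then show False using jin kin by simp
      qed
      ultimately show "j < x \<and> x < k" by simp
    qed
    have jk: "1 \<le> j" "j < k" "k \<le> n" using jin kin C(1) by auto
    have "x \<in> {1..n} - {x \<in> {1..n} - C. gap C x = j} \<longleftrightarrow> x \<in> {k..n} \<union> {1..j}" for x
    proof (cases "x \<in> C")
      case True
      then show ?thesis using out[OF True] C(1) by auto
    next
      case False
      then show ?thesis using iff[OF False] jk by (auto simp: not_less)
    qed
    then have "{1..n} - {x \<in> {1..n} - C. gap C x = j} = {k..n} \<union> {1..j}" by blast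
    then show ?thesis unfolding cyclic_interval_def using jk by blast
  qed
qed

context nonneg_config
begin

text \<open>
  The witness \<open>F\<close> is the complement of an arc that a circuit inside \<open>J\<close> cuts out of the circle and in
  which \<open>J\<close> has fewer elements than the bases of the contraction by this circuit; \<open>card X\<close> bounds the
  rank of \<open>F\<close>.
\<close>

theorem nonfree_imp_cyclic_rank_violation:
  assumes base: "B0 \<subseteq> {1..n}" "free v B0" "card B0 = m"
    and J: "J \<subseteq> {1..n}" "card J = m" "\<not> free v J"
  obtains F X where "cyclic_interval n F" "F \<subseteq> {1..n}" "finite X" "v ` F \<subseteq> fv.span (v ` X)"
    "card X < card (J \<inter> F)"
proof -
  let ?E = "{1..n}"
  have fJ: "finite J" using J(1) finite_subset by blast
  obtain C where C: "C \<subseteq> J" "C \<noteq> {}" "\<And>a. a \<in> C \<Longrightarrow> free v (C - {a})"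
    "\<And>a. a \<in> C \<Longrightarrow> v a \<in> fv.span (v ` (C - {a}))"
    using minimal_nonfree_subset[OF fJ J(3)] by metis
  then obtain a0 where a0: "a0 \<in> C" by blast
  have fC: "finite C" and CE: "C \<subseteq> ?E" using C(1) fJ J(1) finite_subset by auto
  have cC: "card C \<ge> 1" using a0 fC by (metis One_nat_def Suc_leI card_gt_0_iff empty_iff)
  have cC1: "card (C - {a}) = card C - 1" if "a \<in> C" for a using that fC by simp
  \<comment> \<open>the bases of the contraction by the circuit \<open>C\<close>; by \<open>ctr_free\<close> the choice of \<open>a0\<close> is immaterial\<close>
  define ctr where "ctr B \<longleftrightarrow> B \<subseteq> ?E - C \<and> card B + card C = m + 1 \<and> free v ((C - {a0}) \<union> B)" for B
  have ctr_fin: "finite B" if "ctr B" for B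
    using that finite_subset[of B "?E - C"] by (simp add: ctr_def)
  have ctr_card: "card ((C - {a}) \<union> B) = m" if "ctr B" "a \<in> C" for a B
  proof -
    have "(C - {a}) \<inter> B = {}" using that by (auto simp: ctr_def)
    then have "card ((C - {a}) \<union> B) = card C - 1 + card B"
      using ctr_fin[OF that(1)] fC by (simp add: card_Un_disjoint cC1[OF that(2)])
    moreover have "card B + card C = m + 1" using that(1) by (simp add: ctr_def)
    ultimately show ?thesis using cC by linarith
  qed
  have ctr_free: "free v ((C - {a}) \<union> B)" if B: "ctr B" and a: "a \<in> C" for a B
  proof (cases "a = a0")
    case False
    define D where "D = (C - {a, a0}) \<union> B"
    have eq: "(C - {a0}) \<union> B = insert a D" "(C - {a}) \<union> B = insert a0 D"
      using False a a0 by (auto simp: D_def)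
    have aD: "a \<notin> D" using a B by (auto simp: D_def ctr_def)
    have frD: "free v (insert a D)" using B eq by (simp add: ctr_def)
    have "v a0 \<notin> fv.span (v ` D)"
    proof
      assume "v a0 \<in> fv.span (v ` D)"
      moreover have "v ` (C - {a, a0}) \<subseteq> fv.span (v ` D)"
        by (auto simp: D_def intro: fv.span_base)
      ultimately have "v ` (C - {a}) \<subseteq> fv.span (v ` D)" using a by auto
      then have "fv.span (v ` (C - {a})) \<subseteq> fv.span (v ` D)"
        by (simp add: fv.span_minimal)
      then have "v a \<in> fv.span (v ` D)" using C(4)[OF a] by blast
      then show False using frD aD by (auto simp: free_def)
    qed
    moreover have "free v D" using frD by (rule free_subset) auto
    ultimately show ?thesis unfolding eq by (rule free_insert[rotated])
  qed (use B in \<open>simp add: ctr_def\<close>)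
  have Cnon: "\<not> free v D" if "C \<subseteq> D" for D
    using that free_subset[of v D C] C(4)[OF a0] a0 by (auto simp: free_def)
  have same_gap: "gap C b = gap C d"
    if B: "ctr B" and B': "ctr (insert d (B - {b}))" and b: "b \<in> B" and d: "d \<notin> B" for B b d
  proof (rule ccontr)
    assume ne: "gap C b \<noteq> gap C d"
    have bd: "b \<in> ?E" "d \<in> ?E" "b \<notin> C" "d \<notin> C" using B B' b by (auto simp: ctr_def)
    have "b \<noteq> d" using b d by auto
    have "False" if xy: "x < y" "x = b \<and> y = d \<or> x = d \<and> y = b" for x y
    proof -
      have "gap C x \<noteq> gap C y" "x \<notin> C" "y \<notin> C" using xy ne bd by auto
      then obtain c c' where c: "c \<in> C" "c' \<in> C" "x < c" "c < y" "c' < x \<or> y < c'"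
        using gap_neq_imp_separated[OF xy(1)] by metis
      have cc': "c \<noteq> c'" using c xy by auto
      define A where "A = (C - {c, c'}) \<union> (B - {b})"
      have "card A = card (C - {c, c'}) + card (B - {b})"
        unfolding A_def using B fC ctr_fin[OF B] by (intro card_Un_disjoint) (auto simp: ctr_def)
      also have "card (C - {c, c'}) = card C - 2" using c cc' fC by (simp add: card_Diff_subset)
      also have "card (B - {b}) = card B - 1" using b ctr_fin[OF B] by simp
      finally have cA: "card A + 2 = m"
      proof -
        assume "card A = card C - 2 + (card B - 1)"
        moreover have "card {c, c'} \<le> card C" using c fC by (intro card_mono) auto
        moreover have "card B \<ge> 1" using b ctr_fin[OF B] by (metis One_nat_def Suc_leI card_gt_0_iff empty_iff)
        moreover have "card B + card C = m + 1" using B by (simp add: ctr_def)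
        ultimately show ?thesis using cc' by simp
      qed
      have AE: "A \<subseteq> ?E" using B CE by (auto simp: A_def ctr_def)
      have nin: "c \<notin> A" "c' \<notin> A" "b \<notin> A" "d \<notin> A"
        using B bd b d c by (auto simp: A_def ctr_def)
      have cE: "c \<in> ?E" "c' \<in> ?E" using c CE by auto
      have f: "free v (insert e (insert z A))" "free v (insert z (insert e A))"
        if e: "e \<in> {c, c'}" and z: "z \<in> {b, d}" for e z
      proof -
        obtain e' where e': "e' \<in> C" "{e, e'} = {c, c'}" using e c by auto
        then have ee: "insert e (C - {c, c'}) = C - {e'}" using e c cc' by auto
        show "free v (insert e (insert z A))"
        proof (cases "z = b")
          case True
          have "insert e (insert z A) = (C - {e'}) \<union> B" using ee True b by (auto simp: A_def)
          then show ?thesis using ctr_free[OF B e'(1)] by simp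
        next
          case False
          then have "insert e (insert z A) = (C - {e'}) \<union> insert d (B - {b})"
            using ee z by (auto simp: A_def)
          then show ?thesis using ctr_free[OF B' e'(1)] by simp
        qed
        then show "free v (insert z (insert e A))" by (simp add: insert_commute)
      qed
      have non: "\<not> free v (insert c (insert c' A))" "\<not> free v (insert c' (insert c A))"
        by (auto simp: A_def intro!: Cnon)
      have xyE: "1 \<le> x" "y \<le> n" and xyA: "x \<notin> A" "y \<notin> A" "x \<in> {b, d}" "y \<in> {b, d}"
        using xy bd nin by auto
      \<comment> \<open>the two elements of \<open>C\<close> separate \<open>b\<close> and \<open>d\<close>; all mixed pairs complete \<open>A\<close> to a basis, so they would as well\<close>
      from c(5) show False
      proof
        assume "c' < x"
        then have "free v (insert c' (insert c A))"
          using no_crossing(1)[OF AE cA, of c' x c y] cE c(3,4) xyE xyA nin f by auto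
        then show False using non by simp
      next
        assume "y < c'"
        then have "free v (insert c (insert c' A))"
          using no_crossing(2)[OF AE cA, of x c y c'] cE c(3,4) xyE xyA nin f by auto
        then show False using non by simp
      qed
    qed
    then show False using \<open>b \<noteq> d\<close> by (metis linorder_neqE_nat)
  qed
  have const: "card {x \<in> B. gap C x = j} = card {x \<in> B'. gap C x = j}"
    if "ctr B" "ctr B'" for B B' j
    using that(1)
  proof (induction "card (B - B')" arbitrary: B rule: less_induct)
    case less
    show ?case
    proof (cases "B \<subseteq> B'")
      case True
      moreover have "card B = card B'" using less.prems that(2) by (simp add: ctr_def)
      ultimately have "B = B'" using ctr_fin[OF that(2)] by (simp add: card_subset_eq)
      then show ?thesis by simp
    next
      case False
      then obtain b where b: "b \<in> B" "b \<notin> B'" by blast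
      let ?W = "(C - {a0}) \<union> (B - {b})"
      have fB: "finite B" using ctr_fin less.prems by blast
      have "\<exists>d\<in>B'. v d \<notin> fv.span (v ` ?W)"
      proof (rule ccontr)
        assume "\<not> ?thesis"
        then have "v ` ((C - {a0}) \<union> B') \<subseteq> fv.span (v ` ?W)"
          by (auto intro: fv.span_base)
        moreover have "finite (v ` ?W)" using fC fB by simp
        ultimately have "card ((C - {a0}) \<union> B') \<le> card (v ` ?W)"
          using free_card_le[OF ctr_free[OF that(2) a0]] by simp
        also have "\<dots> \<le> card ?W" using fC fB by (intro card_image_le) auto
        also have "?W = ((C - {a0}) \<union> B) - {b}" using b less.prems by (auto simp: ctr_def)
        also have "card \<dots> = m - 1" using ctr_card[OF less.prems a0] b fC fB by (simp add: card_Diff_singleton)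
        finally have "m \<le> m - 1" using ctr_card[OF that(2) a0] by simp
        moreover have "m > 0" using ctr_card[OF less.prems a0] b fC fB by (auto simp: card_gt_0_iff)
        ultimately show False by simp
      qed
      then obtain d where d: "d \<in> B'" "v d \<notin> fv.span (v ` ?W)" by blast
      have dB: "d \<notin> B"
      proof
        assume "d \<in> B"
        then have "d \<in> ?W" using d(1) b(2) by auto
        then have "v d \<in> fv.span (v ` ?W)" by (intro fv.span_base imageI)
        then show False using d(2) by simp
      qed
      have dC: "d \<in> ?E - C" using d that(2) by (auto simp: ctr_def)
      have "free v ?W" using ctr_free[OF less.prems a0] by (rule free_subset) auto
      then have "free v (insert d ?W)" using d(2) by (rule free_insert)
      moreover have "insert d ?W = (C - {a0}) \<union> insert d (B - {b})" by auto
      ultimately have free': "free v ((C - {a0}) \<union> insert d (B - {b}))" by metis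
      have card': "card (insert d (B - {b})) = card B"
        using dB b fB by (intro card_exchange) auto
      have ctr': "ctr (insert d (B - {b}))"
        unfolding ctr_def
      proof (intro conjI)
        show "insert d (B - {b}) \<subseteq> ?E - C" using less.prems dC by (auto simp: ctr_def)
        show "card (insert d (B - {b})) + card C = m + 1" using less.prems card' by (simp add: ctr_def)
      qed (fact free')
      have g: "gap C b = gap C d" using same_gap[OF less.prems ctr' b(1) dB] .
      have "insert d (B - {b}) - B' = (B - B') - {b}" using d by auto
      then have "card (insert d (B - {b}) - B') < card (B - B')"
        using b fB card_Diff1_less[of "B - B'" b] by simp
      then have "card {x \<in> insert d (B - {b}). gap C x = j} = card {x \<in> B'. gap C x = j}"
        using less.hyps ctr' by blast
      moreover have "card {x \<in> insert d (B - {b}). gap C x = j} = card {x \<in> B. gap C x = j}"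
      proof (cases "gap C d = j")
        case True
        then have "{x \<in> insert d (B - {b}). gap C x = j} = insert d ({x \<in> B. gap C x = j} - {b})" by auto
        moreover have "card (insert d ({x \<in> B. gap C x = j} - {b})) = card {x \<in> B. gap C x = j}"
          using True g b dB fB by (intro card_exchange) auto
        ultimately show ?thesis by simp
      next
        case False
        then have "{x \<in> insert d (B - {b}). gap C x = j} = {x \<in> B. gap C x = j}" using g by auto
        then show ?thesis by simp
      qed
      ultimately show ?thesis by simp
    qed
  qed
  have ctr_of_basis: "ctr (B - C) \<and> a0 \<notin> B" if B: "B \<subseteq> ?E" "C - {a0} \<subseteq> B" "free v B" "card B = m" for B
  proof -
    have fB: "finite B" using B(1) finite_subset by blast
    have a0B: "a0 \<notin> B"
    proof
      assume "a0 \<in> B"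
      then have "C \<subseteq> B" using B(2) by auto
      then show False using Cnon B(3) by blast
    qed
    then have "(C - {a0}) \<union> (B - C) = B" using B(2) by auto
    moreover have "card (B - C) = m - (card C - 1)"
    proof -
      have "B - C = B - (C - {a0})" using a0B by auto
      then show ?thesis using B(2,4) fC cC1[OF a0] by (simp add: card_Diff_subset)
    qed
    moreover have "card C - 1 \<le> m" using card_mono[OF fB B(2)] cC1[OF a0] B(4) by simp
    ultimately show ?thesis using B cC a0B by (auto simp: ctr_def)
  qed
  have extend: "\<exists>B. Y \<subseteq> B \<and> B \<subseteq> ?E \<and> free v B \<and> card B = m" if Y: "free v Y" "Y \<subseteq> ?E" for Y
  proof -
    obtain B where B: "Y \<subseteq> B" "B \<subseteq> ?E" "free v B" "v ` ?E \<subseteq> fv.span (v ` B)"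
      using free_extend[OF Y] by blast
    have fB: "finite B" using B(2) finite_subset by blast
    have "v ` B0 \<subseteq> fv.span (v ` B)" using B(4) base(1) by blast
    then have "card B0 \<le> card (v ` B)" using free_card_le[OF base(2), of "v ` B"] fB by simp
    then have "m \<le> card B" using base(3) card_image_le[OF fB, of v] by simp
    moreover have "card B \<le> m" using free_card_le_dim[OF B(3)] by simp
    ultimately show ?thesis using B by auto
  qed
  obtain B1 where B1: "ctr B1"
    using extend[OF C(3)[OF a0]] CE ctr_of_basis by (metis Diff_subset subset_trans)
  \<comment> \<open>pigeonhole: \<open>J - C\<close> has one element less than \<open>B1\<close>\<close>
  have "\<exists>j. card {x \<in> J - C. gap C x = j} < card {x \<in> B1. gap C x = j}"
  proof (rule ccontr)
    assume n: "\<not> ?thesis"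
    let ?T = "gap C ` (B1 \<union> J)"
    have fB1: "finite B1" using ctr_fin[OF B1] .
    have grp: "card S = (\<Sum>j\<in>?T. card {x \<in> S. gap C x = j})" if "finite S" "S \<subseteq> B1 \<union> J" for S
      using sum.group[of S ?T "gap C" "\<lambda>_. 1 :: nat", OF that(1) _ image_mono[OF that(2)]] fB1 fJ
      by simp
    have "card B1 \<le> card (J - C)"
      unfolding grp[OF fB1 Un_upper1]
      by (subst grp[of "J - C"]) (use fJ n in \<open>auto intro!: sum_mono simp: not_less\<close>)
    moreover have "card (J - C) = m - card C" using C(1) fC J(2) by (simp add: card_Diff_subset)
    moreover have "card B1 + card C = m + 1" using B1 by (simp add: ctr_def)
    moreover have "card C \<le> m" using card_mono[OF fJ C(1)] J(2) by simp
    ultimately show False by simp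
  qed
  then obtain j where j: "card {x \<in> J - C. gap C x = j} < card {x \<in> B1. gap C x = j}" by blast
  \<comment> \<open>\<open>X\<close> is a basis of the complement of the arc, and \<open>B\<close> extends it to a basis of everything\<close>
  define G where "G = {x \<in> ?E - C. gap C x = j}"
  define F where "F = ?E - G"
  have "{x \<in> B1. gap C x = j} \<noteq> {}" using j by (metis card.empty not_less_zero)
  then obtain y where "y \<in> B1" "gap C y = j" by blast
  then have cyc: "cyclic_interval n F"
    unfolding F_def G_def using B1 C(2) CE by (intro cyclic_interval_Diff_gap[of C n y]) (auto simp: ctr_def)
  have FE: "F \<subseteq> ?E" by (auto simp: F_def)
  have CF: "C \<subseteq> F" using CE by (auto simp: F_def G_def)
  have fF: "finite F" using FE finite_subset by blast
  have CF': "C - {a0} \<subseteq> F" using CF by auto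
  obtain X where X: "C - {a0} \<subseteq> X" "X \<subseteq> F" "free v X" "v ` F \<subseteq> fv.span (v ` X)"
    using free_extend[OF C(3)[OF a0] CF' fF] by metis
  obtain B where B: "X \<subseteq> B" "B \<subseteq> ?E" "free v B" "card B = m"
    using extend[OF X(3)] X(2) FE by blast
  have fB: "finite B" using B(2) finite_subset by blast
  have "ctr (B - C)" using ctr_of_basis[of B] B X(1) by auto
  then have "card {x \<in> B - C. gap C x = j} = card {x \<in> B1. gap C x = j}" using const B1 by blast
  moreover have "{x \<in> B - C. gap C x = j} = B \<inter> G" using B(2) by (auto simp: G_def)
  moreover have "{x \<in> J - C. gap C x = j} = J \<inter> G" using J(1) by (auto simp: G_def)
  ultimately have JG: "card (J \<inter> G) < card (B \<inter> G)" using j by simp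
  have split: "card (S \<inter> F) + card (S \<inter> G) = card S" if "S \<subseteq> ?E" for S
  proof -
    have "finite S" using that finite_subset by blast
    then have "card ((S \<inter> F) \<union> (S \<inter> G)) = card (S \<inter> F) + card (S \<inter> G)"
      by (intro card_Un_disjoint) (auto simp: F_def)
    moreover have "(S \<inter> F) \<union> (S \<inter> G) = S" using that by (auto simp: F_def)
    ultimately show ?thesis by simp
  qed
  have "card X \<le> card (B \<inter> F)" using B(1) X(2) fB by (intro card_mono) auto
  moreover have "card (B \<inter> F) < card (J \<inter> F)"
    using split[OF B(2)] split[OF J(1)] JG B(4) J(2) by linarith
  moreover have "finite X" using B(1) fB finite_subset by blast
  ultimately show thesis using that[OF cyc FE _ X(4)] by linarith
qed

end

section \<open>The permutation of a configuration\<close>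

declare smul_apply [simp del]

text \<open>
  The circle is cut open in front of the last \<open>m\<close> elements, which are repeated at the end: positions
  \<open>1, \<dots>, m\<close> carry the elements \<open>p + 1, \<dots>, m + p\<close>, and the positions from \<open>m + 1\<close> on carry \<open>1, 2, \<dots>\<close>. Every
  cyclic interval is then an interval of positions, except possibly those containing the consecutive
  elements \<open>p, \<dots>, m + p, 1\<close>. These have full rank, so no \<open>m\<close>-set violates their bound.
\<close>

definition elt :: "nat \<Rightarrow> nat \<Rightarrow> nat \<Rightarrow> nat" where
  "elt m p x = (if x \<le> m then x + p else x - m)"

definition unrolled :: "nat \<Rightarrow> nat \<Rightarrow> (nat \<Rightarrow> nat \<Rightarrow> real) \<Rightarrow> nat \<Rightarrow> nat \<Rightarrow> real" where
  "unrolled m p v x = v (elt m p x)"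

lemma span_monoD: "x \<in> fv.span A \<Longrightarrow> A \<subseteq> B \<Longrightarrow> x \<in> fv.span B"
  using fv.span_mono by blast

text \<open>
  The value \<open>w l\<close> is the largest position from which the vectors before \<open>v l\<close> span it; if \<open>v l = 0\<close>,
  this is the position \<open>l + m\<close> of \<open>l\<close> itself.
\<close>

definition encodes :: "nat \<Rightarrow> nat \<Rightarrow> (nat \<Rightarrow> nat \<Rightarrow> real) \<Rightarrow> (nat \<Rightarrow> nat) \<Rightarrow> bool" where
  "encodes m p v w \<longleftrightarrow> (\<forall>l\<in>{1..m + p}. \<forall>x\<in>{1..l + m}.
     v l \<in> fv.span (unrolled m p v ` {x..<l + m}) \<longleftrightarrow> x \<le> w l)"

text \<open>
  The number of positions in the window that are not spanned by the preceding ones in the window,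
  which by \<open>window_basis\<close> is the rank of the window.
\<close>

definition window_rank :: "nat \<Rightarrow> (nat \<Rightarrow> nat) \<Rightarrow> nat \<Rightarrow> nat \<Rightarrow> nat" where
  "window_rank m w a b = card {x \<in> {a..b}. x \<le> m \<or> w (x - m) < a}"

lemma inj_on_elt: "b < a + (m + p) \<Longrightarrow> 1 \<le> a \<Longrightarrow> inj_on (elt m p) {a..b}"
proof (rule inj_onI)
  fix x y assume "b < a + (m + p)" "1 \<le> a" "x \<in> {a..b}" "y \<in> {a..b}" "elt m p x = elt m p y"
  then show "x = y" by (cases "x \<le> m"; cases "y \<le> m") (simp_all add: elt_def)
qed

lemma free_comp_iff: "inj_on f K \<Longrightarrow> free (\<lambda>x. v (f x)) K \<longleftrightarrow> free v (f ` K)"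
proof -
  assume inj: "inj_on f K"
  have "f ` K - {f k} = f ` (K - {k})" if "k \<in> K" for k
    using inj that by (auto simp: inj_on_def)
  then show ?thesis by (simp add: free_def image_image)
qed

text \<open>
  The last \<open>m\<close> of the \<open>m + p\<close> vectors form a basis, as for the configuration of a matrix.
\<close>

locale chart_config = vector_config n m v for n m v +
  fixes p :: nat
  assumes n: "n = m + p" and chart: "free v {p + 1..m + p}"
begin

abbreviation u :: "nat \<Rightarrow> nat \<Rightarrow> real" where "u \<equiv> unrolled m p v"

lemma u_low: "x \<le> m \<Longrightarrow> u x = v (x + p)" and u_high: "m < x \<Longrightarrow> u x = v (x - m)"
  by (simp_all add: unrolled_def elt_def)

lemma u_low_notin_span:
  assumes "a \<ge> 1" "x \<le> m"
  shows "1 \<le> x \<Longrightarrow> u x \<notin> fv.span (u ` {a..<x})"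
proof -
  assume x: "1 \<le> x"
  have "u ` {a..<x} \<subseteq> v ` ({p + 1..m + p} - {x + p})"
    using assms by (auto simp: unrolled_def elt_def)
  moreover have "v (x + p) \<notin> fv.span (v ` ({p + 1..m + p} - {x + p}))"
    using chart x assms(2) by (auto simp: free_def)
  ultimately show ?thesis unfolding u_low[OF assms(2)] using span_monoD by blast
qed

text \<open>
  Injectivity is the exchange property: if the vectors from position \<open>j\<close> on are needed to span
  \<open>v l\<close>, then the vector at \<open>j\<close> is spanned by those after it up to \<open>v l\<close>, hence no later vector
  needs position \<open>j\<close>. The values are at least 1 since the first \<open>m\<close> positions carry a basis, and at most
  \<open>m + p\<close> since this basis is repeated in the last \<open>m\<close> positions.
\<close>

lemma ex_encoding: "\<exists>w\<in>restricted_perms m p. encodes m p v w"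
proof -
  define S where "S l = {x \<in> {1..l + m}. v l \<in> fv.span (u ` {x..<l + m})}" for l
  define w where "w l = (if l \<in> {1..m + p} then Max (S l) else l)" for l
  have fS: "finite (S l)" for l by (simp add: S_def)
  have one: "1 \<in> S l" if "l \<in> {1..m + p}" for l
  proof -
    have "v l \<in> fv.span (v ` {p + 1..m + p})" using chart by (intro basis_spans) auto
    moreover have "v ` {p + 1..m + p} \<subseteq> u ` {1..<l + m}"
    proof
      fix y assume "y \<in> v ` {p + 1..m + p}"
      then obtain k where k: "k \<in> {p + 1..m + p}" "y = v k" by blast
      then have "y = u (k - p)" "k - p \<in> {1..<l + m}" using that by (auto simp: unrolled_def elt_def)
      then show "y \<in> u ` {1..<l + m}" by blast
    qed
    ultimately have "v l \<in> fv.span (u ` {1..<l + m})" by (rule span_monoD)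
    then show ?thesis using that by (simp add: S_def)
  qed
  have down: "x \<in> S l" if "y \<in> S l" "1 \<le> x" "x \<le> y" for l x y
  proof -
    have "u ` {y..<l + m} \<subseteq> u ` {x..<l + m}" using that by (intro image_mono) auto
    then have "fv.span (u ` {y..<l + m}) \<subseteq> fv.span (u ` {x..<l + m})" by (rule fv.span_mono)
    then show ?thesis using that by (auto simp: S_def)
  qed
  have wS: "w l \<in> S l" if "l \<in> {1..m + p}" for l
    using Max_in[OF fS] one[OF that] that by (auto simp: w_def)
  have iff: "x \<in> S l \<longleftrightarrow> x \<le> w l" if "l \<in> {1..m + p}" "x \<in> {1..l + m}" for l x
    using down[OF wS[OF that(1)], of x] Max_ge[OF fS, of x l] that by (auto simp: w_def)
  have enc: "encodes m p v w"
    unfolding encodes_def using iff by (auto simp: S_def)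
  have ge1: "1 \<le> w l" if "l \<in> {1..m + p}" for l using wS[OF that] by (simp add: S_def)
  have le: "w l \<le> l + m" if "l \<in> {1..m + p}" for l using wS[OF that] by (simp add: S_def)
  have leN: "w l \<le> m + p" if l: "l \<in> {1..m + p}" for l
  proof (cases "l \<le> p")
    case True
    then show ?thesis using le[OF l] by simp
  next
    case False
    have "v l \<notin> fv.span (v ` ({p + 1..m + p} - {l}))" using chart l False by (auto simp: free_def)
    moreover have "u ` {m + p + 1..<l + m} \<subseteq> v ` ({p + 1..m + p} - {l})"
    proof
      fix y assume "y \<in> u ` {m + p + 1..<l + m}"
      then obtain x where x: "x \<in> {m + p + 1..<l + m}" "y = u x" by blast
      then have "y = v (x - m)" "x - m \<in> {p + 1..m + p} - {l}" using l by (auto simp: unrolled_def elt_def)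
      then show "y \<in> v ` ({p + 1..m + p} - {l})" by blast
    qed
    ultimately have "m + p + 1 \<notin> S l" using span_monoD unfolding S_def by blast
    then show ?thesis using iff[OF l, of "m + p + 1"] False by auto
  qed
  have inj: "w l \<noteq> w l'" if l: "l \<in> {1..m + p}" and l': "l' \<in> {1..m + p}" and ll': "l < l'" for l l'
  proof
    assume eq: "w l = w l'"
    define j where "j = w l"
    have j1: "1 \<le> j" and jl: "j \<le> l + m" using ge1[OF l] le[OF l] by (auto simp: j_def)
    have ul: "u (l + m) = v l" using l by (simp add: unrolled_def elt_def)
    let ?T = "u ` {j + 1..<l' + m}"
    have "j \<in> S l" using wS[OF l] by (simp add: j_def)
    \<comment> \<open>if \<open>j < l + m\<close> then \<open>v l\<close> needs \<open>u j\<close> and can be exchanged for it\<close>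
    have uj: "u j \<in> fv.span ?T"
    proof (cases "j = l + m")
      case True
      then have "v l \<in> fv.span {}" using \<open>j \<in> S l\<close> by (simp add: S_def)
      then have "u j \<in> fv.span {}" using True ul by simp
      then show ?thesis by (rule span_monoD) simp
    next
      case False
      then have jlt: "j < l + m" using jl by simp
      have "u ` {j..<l + m} = insert (u j) (u ` {j + 1..<l + m})"
        using jlt by (subst image_insert[symmetric], intro arg_cong[of _ _ "image u"]) auto
      then have "v l \<in> fv.span (insert (u j) (u ` {j + 1..<l + m}))"
        using \<open>j \<in> S l\<close> by (simp add: S_def)
      moreover have "v l \<notin> fv.span (u ` {j + 1..<l + m})"
        using iff[OF l, of "j + 1"] jlt by (auto simp: S_def j_def)
      ultimately have "u j \<in> fv.span (insert (v l) (u ` {j + 1..<l + m}))"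
        by (rule fv.in_span_insert)
      moreover have "insert (v l) (u ` {j + 1..<l + m}) \<subseteq> ?T"
      proof -
        have "v l \<in> ?T" unfolding ul[symmetric] using jlt ll' by (intro imageI) auto
        moreover have "u ` {j + 1..<l + m} \<subseteq> ?T" using ll' by (intro image_mono) auto
        ultimately show ?thesis by simp
      qed
      ultimately show ?thesis using fv.span_mono by blast
    qed
    have "u ` {j..<l' + m} \<subseteq> fv.span ?T"
    proof
      fix y assume "y \<in> u ` {j..<l' + m}"
      then obtain x where x: "x \<in> {j..<l' + m}" "y = u x" by blast
      show "y \<in> fv.span ?T"
      proof (cases "x = j")
        case True then show ?thesis using x uj by simp
      next
        case False then show ?thesis using x by (auto intro!: fv.span_base)
      qed
    qed
    then have "fv.span (u ` {j..<l' + m}) \<subseteq> fv.span ?T" by (simp add: fv.span_minimal)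
    moreover have "j \<in> S l'" using wS[OF l'] eq by (simp add: j_def)
    ultimately have "j + 1 \<in> S l'" using jl ll' by (auto simp: S_def)
    then show False using iff[OF l', of "j + 1"] eq by (auto simp: S_def j_def)
  qed
  have "inj_on w {1..m + p}"
    using inj by (intro inj_onI) (metis linorder_neqE_nat)
  moreover have "w ` {1..m + p} \<subseteq> {1..m + p}" using ge1 leN by auto
  ultimately have "bij_betw w {1..m + p} {1..m + p}"
    by (simp add: bij_betw_def endo_inj_surj)
  then have perm: "w permutes {1..m + p}" 
    by (rule bij_imp_permutes) (unfold w_def, rule if_not_P)
  have lower: "l \<le> w l + p" if l: "l \<in> {1..m + p}" for l
  proof (cases "l \<le> p")
    case False
    have "u (l - p) \<in> fv.span (u ` {l - p..<l + m})"
      using l False by (intro fv.span_base imageI) auto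
    moreover have "u (l - p) = v l" using False l by (auto simp: unrolled_def elt_def)
    ultimately have "l - p \<in> S l" using False by (auto simp: S_def)
    then show ?thesis using iff[OF l, of "l - p"] False by (auto simp: S_def)
  qed simp
  have "- int p \<le> int (w l) - int l \<and> int (w l) - int l \<le> int m" if "l \<in> {1..m + p}" for l
    using lower[OF that] le[OF that] by linarith
  then have "w \<in> restricted_perms m p"
    using perm by (simp add: restricted_perms_def)
  then show ?thesis using enc by blast
qed

text \<open>
  Scanning the window from the left and keeping the positions not spanned by their predecessors
  gives a basis.
\<close>

lemma window_basis:
  assumes w: "encodes m p v w" and a: "1 \<le> a" and b: "b \<le> m + p + m"
  defines "Y \<equiv> {x \<in> {a..b}. x \<le> m \<or> w (x - m) < a}"
  shows "free u Y \<and> u ` {a..b} \<subseteq> fv.span (u ` Y)"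
  unfolding Y_def using b
proof (induction b)
  case 0
  then show ?case using a by (simp add: free_def)
next
  case (Suc b)
  let ?Y = "{x \<in> {a..b}. x \<le> m \<or> w (x - m) < a}"
  have IH: "free u ?Y" "u ` {a..b} \<subseteq> fv.span (u ` ?Y)"
    using Suc.IH[OF Suc_leD[OF Suc.prems]] by blast+
  show ?case
  proof (cases "a \<le> Suc b")
    case False
    then show ?thesis by (simp add: free_def)
  next
    case True
    have span_eq: "fv.span (u ` {a..b}) = fv.span (u ` ?Y)"
      using IH(2) by (intro subset_antisym fv.span_mono fv.span_minimal) auto
    have int: "{a..Suc b} = insert (Suc b) {a..b}" using True by auto
    have lt: "{a..<Suc b} = {a..b}" by auto
    have key: "u (Suc b) \<in> fv.span (u ` {a..b}) \<longleftrightarrow> \<not> (Suc b \<le> m \<or> w (Suc b - m) < a)"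
    proof (cases "Suc b \<le> m")
      case True
      then show ?thesis using u_low_notin_span[OF a True] lt by simp
    next
      case False
      have "Suc b - m \<in> {1..m + p}" "a \<in> {1..(Suc b - m) + m}" using False Suc.prems a True by auto
      then have "v (Suc b - m) \<in> fv.span (u ` {a..<(Suc b - m) + m}) \<longleftrightarrow> a \<le> w (Suc b - m)"
        using w unfolding encodes_def by blast
      then show ?thesis using False lt by (simp add: unrolled_def elt_def not_less)
    qed
    show ?thesis
    proof (cases "Suc b \<le> m \<or> w (Suc b - m) < a")
      case True
      then have Yeq: "{x \<in> {a..Suc b}. x \<le> m \<or> w (x - m) < a} = insert (Suc b) ?Y"
        using int by auto
      have "u (Suc b) \<notin> fv.span (u ` ?Y)" using key True span_eq by blast
      then have "free u (insert (Suc b) ?Y)" by (rule free_insert[OF IH(1)])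
      moreover have "fv.span (u ` ?Y) \<subseteq> fv.span (u ` insert (Suc b) ?Y)"
        by (intro fv.span_mono) auto
      then have "u ` {a..Suc b} \<subseteq> fv.span (u ` insert (Suc b) ?Y)"
        unfolding int using IH(2) fv.span_base[of "u (Suc b)" "u ` insert (Suc b) ?Y"] by auto
      ultimately show ?thesis unfolding Yeq by simp
    next
      case False
      then have Yeq: "{x \<in> {a..Suc b}. x \<le> m \<or> w (x - m) < a} = ?Y" using int by auto
      have "u (Suc b) \<in> fv.span (u ` ?Y)" using key False span_eq by simp
      then have "u ` {a..Suc b} \<subseteq> fv.span (u ` ?Y)" unfolding int using IH by simp
      then show ?thesis unfolding Yeq using IH by blast
    qed
  qed
qed

end

locale nonneg_chart_config = nonneg_config n m v + chart_config n m v p for n m v p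
begin

text \<open>
  The matroid of a nonnegative configuration depends on its permutation only.
\<close>

theorem free_iff_window_rank:
  assumes w: "encodes m p v w" and K: "K \<subseteq> {1..m + p}" "card K = m"
  shows "free v K \<longleftrightarrow> (\<forall>a b. 1 \<le> a \<and> a \<le> b \<and> b \<le> m + p + m \<and> b < a + (m + p) \<longrightarrow>
      card (K \<inter> elt m p ` {a..b}) \<le> window_rank m w a b)"
    (is "_ \<longleftrightarrow> (\<forall>a b. ?win a b \<longrightarrow> ?ineq a b)")
proof (intro iffI allI impI)
  fix a b assume fr: "free v K" and ab: "?win a b"
  define Y where "Y = {x \<in> {a..b}. x \<le> m \<or> w (x - m) < a}"
  have sp: "u ` {a..b} \<subseteq> fv.span (u ` Y)" using window_basis[OF w] ab by (simp add: Y_def)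
  have "v ` (K \<inter> elt m p ` {a..b}) \<subseteq> u ` {a..b}" by (auto simp: unrolled_def)
  then have "v ` (K \<inter> elt m p ` {a..b}) \<subseteq> fv.span (u ` Y)" using sp by blast
  moreover have "free v (K \<inter> elt m p ` {a..b})" using fr by (rule free_subset) auto
  moreover have "finite (u ` Y)" by (simp add: Y_def)
  ultimately have "card (K \<inter> elt m p ` {a..b}) \<le> card (u ` Y)" using free_card_le by metis
  also have "\<dots> \<le> card Y" by (rule card_image_le) (simp add: Y_def)
  finally show "?ineq a b" by (simp add: window_rank_def Y_def)
next
  assume ineq: "\<forall>a b. ?win a b \<longrightarrow> ?ineq a b"
  show "free v K"
  proof (rule ccontr)
    assume non: "\<not> free v K"
    have base: "{p + 1..m + p} \<subseteq> {1..n}" "card {p + 1..m + p} = m" by (auto simp: n)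
    obtain F X where FX: "cyclic_interval n F" "F \<subseteq> {1..n}" "finite X" "v ` F \<subseteq> fv.span (v ` X)"
      "card X < card (K \<inter> F)"
      using nonfree_imp_cyclic_rank_violation[OF base(1) chart base(2) _ K(2) non] K(1) n by metis
    have fK: "finite K" using K(1) finite_subset by blast
    have le_card: "card Z \<le> card X" if "free v Z" "Z \<subseteq> F" for Z
    proof -
      have "v ` Z \<subseteq> fv.span (v ` X)" using that FX(4) by blast
      then have "card Z \<le> card (v ` X)" using free_card_le[OF that(1)] FX(3) by simp
      then show ?thesis using card_image_le[OF FX(3), of v] by simp
    qed
    have "\<exists>a b. ?win a b \<and> F = elt m p ` {a..b}"
      using FX(1) unfolding cyclic_interval_def
    proof (elim disjE exE conjE)
      fix c d assume cd: "1 \<le> c" "c \<le> d" "d \<le> n" "F = {c..d}"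
      have "elt m p ` {c + m..d + m} = {c..d}"
      proof (intro equalityI subsetI)
        fix y assume "y \<in> {c..d}"
        then have "y = elt m p (y + m)" "y + m \<in> {c + m..d + m}" using cd by (auto simp: unrolled_def elt_def)
        then show "y \<in> elt m p ` {c + m..d + m}" by blast
      qed (use cd in \<open>auto simp: unrolled_def elt_def\<close>)
      then show ?thesis using cd n by (intro exI[of _ "c + m"] exI[of _ "d + m"]) auto
    next
      fix c d assume cd: "1 \<le> d" "d < c" "c \<le> n" "F = {c..n} \<union> {1..d}"
      show ?thesis
      proof (cases "c \<le> p")
        case True
        then have "{p + 1..m + p} \<subseteq> F" using cd n by auto
        then have "m \<le> card X" using le_card[OF chart] by simp
        moreover have "card (K \<inter> F) \<le> m" using card_mono[OF fK, of "K \<inter> F"] K(2) by simp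
        ultimately show ?thesis using FX(5) by simp
      next
        case False
        have "elt m p ` {c - p..d + m} = F"
        proof (intro equalityI subsetI)
          fix y assume y: "y \<in> F"
          show "y \<in> elt m p ` {c - p..d + m}"
          proof (cases "y \<ge> c")
            case True
            then have "y = elt m p (y - p)" "y - p \<in> {c - p..d + m}" using y cd False n by (auto simp: unrolled_def elt_def)
            then show ?thesis by blast
          next
            case False
            then have "y = elt m p (y + m)" "y + m \<in> {c - p..d + m}" using y cd n by (auto simp: unrolled_def elt_def)
            then show ?thesis by blast
          qed
        qed (use cd False n in \<open>auto simp: unrolled_def elt_def\<close>)
        then show ?thesis using cd n False
          by (intro exI[of _ "c - p"] exI[of _ "d + m"]) auto
      qed
    qed
    then obtain a b where ab: "?win a b" "F = elt m p ` {a..b}" by blast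
    define Y where "Y = {x \<in> {a..b}. x \<le> m \<or> w (x - m) < a}"
    have inj: "inj_on (elt m p) Y"
      by (rule inj_on_subset[OF inj_on_elt[of b a m p]]) (use ab(1) in \<open>simp_all add: Y_def subset_iff\<close>)
    have "free u Y" using window_basis[OF w] ab(1) by (simp add: Y_def)
    then have "free v (elt m p ` Y)"
      using free_comp_iff[OF inj, of v] by (simp add: unrolled_def[abs_def])
    then have "card (elt m p ` Y) \<le> card X" using ab(2) by (intro le_card) (auto simp: Y_def)
    then have "window_rank m w a b \<le> card X" using card_image[OF inj] by (simp add: window_rank_def Y_def)
    then show False using ineq ab FX(5) by fastforce
  qed
qed

end

section \<open>Linkages in a bipartite chain\<close>

lemma card_filter_sorted_list:
  assumes "finite (A :: nat set)"
  shows "card (A \<inter> {..s}) = length (filter (\<lambda>x. x \<le> s) (sorted_list_of_set A))"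
proof -
  have "distinct (filter (\<lambda>x. x \<le> s) (sorted_list_of_set A))" by simp
  moreover have "set (filter (\<lambda>x. x \<le> s) (sorted_list_of_set A)) = A \<inter> {..s}"
    using assms by auto
  ultimately show ?thesis using distinct_card by metis
qed

text \<open>
  It turns the comparisons in the conditions into inequalities between numbers of elements.
\<close>

lemma set_le_iff_count:
  assumes "finite L" "finite R"
  shows "L \<le>\<^sub>s R \<longleftrightarrow> card L = card R \<and> (\<forall>s. card (R \<inter> {..s}) \<le> card (L \<inter> {..s}))"
    (is "_ \<longleftrightarrow> ?count")
proof
  assume le: "L \<le>\<^sub>s R"
  have filt: "length (filter (\<lambda>x. x \<le> s) ys) \<le> length (filter (\<lambda>x. x \<le> s) xs)"
    if "list_all2 (\<le>) xs ys" for xs ys :: "nat list" and s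
    using that by (induction rule: list_all2_induct) auto
  have "card L = card R"
    using le list_all2_lengthD unfolding set_le_def by fastforce
  then show ?count
    using filt le unfolding set_le_def card_filter_sorted_list[OF assms(1)] card_filter_sorted_list[OF assms(2)]
    by blast
next
  assume cnt: ?count
  let ?xs = "sorted_list_of_set L" and ?ys = "sorted_list_of_set R"
  show "L \<le>\<^sub>s R"
    unfolding set_le_def list_all2_conv_all_nth
  proof (intro conjI allI impI)
    show "length ?xs = length ?ys" using cnt by simp
    fix k assume k: "k < length ?xs"
    show "?xs ! k \<le> ?ys ! k"
    proof (rule ccontr)
      assume "\<not> ?xs ! k \<le> ?ys ! k"
      then have lt: "?ys ! k < ?xs ! k" by simp
      let ?s = "?ys ! k"
      have kR: "k < card R" using k cnt by simp
      have "(!) ?ys ` {..k} \<subseteq> R \<inter> {..?s}"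
      proof
        fix y assume "y \<in> (!) ?ys ` {..k}"
        then obtain j where j: "j \<le> k" "y = ?ys ! j" by auto
        then have "y \<in> set ?ys" using kR by simp
        moreover have "y \<le> ?s" using j kR sorted_nth_mono[of ?ys j k] by simp
        ultimately show "y \<in> R \<inter> {..?s}" using assms(2) by simp
      qed
      moreover have "card ((!) ?ys ` {..k}) = Suc k"
        using kR by (subst card_image) (auto intro!: inj_onI simp: nth_eq_iff_index_eq)
      ultimately have "Suc k \<le> card (R \<inter> {..?s})"
        using assms(2) by (metis card_mono finite_Int)
      moreover have "L \<inter> {..?s} \<subseteq> (!) ?xs ` {..<k}"
      proof
        fix y assume y: "y \<in> L \<inter> {..?s}"
        then have "y \<in> set ?xs" using assms(1) by simp
        then obtain j where j: "j < length ?xs" "?xs ! j = y" by (metis in_set_conv_nth)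
        have "j < k"
        proof (rule ccontr)
          assume "\<not> j < k"
          then have "?xs ! k \<le> ?xs ! j" using j(1) by (intro sorted_nth_mono) auto
          then show False using j(2) y lt by simp
        qed
        then show "y \<in> (!) ?xs ` {..<k}" using j(2) by blast
      qed
      then have "card (L \<inter> {..?s}) \<le> k"
        using surj_card_le[of "{..<k}" "L \<inter> {..?s}" "(!) ?xs"] by simp
      ultimately show False using cnt by (meson not_less_eq_eq order_trans)
    qed
  qed
qed

lemma card_Int_atMost_insert:
  "finite A \<Longrightarrow> x \<notin> A \<Longrightarrow> card (insert x A \<inter> {..s}) = card (A \<inter> {..s}) + (if x \<le> s then 1 else 0)"
  by (cases "x \<le> s") simp_all

lemma set_le_insert:
  assumes "finite L" "finite R" "L \<le>\<^sub>s R" "x \<notin> L" "y \<notin> R" "x \<le> y"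
  shows "insert x L \<le>\<^sub>s insert y R"
proof -
  have cnt: "card L = card R" "card (R \<inter> {..s}) \<le> card (L \<inter> {..s})" for s
    using assms(3) set_le_iff_count[OF assms(1,2)] by blast+
  have "card (insert y R \<inter> {..s}) \<le> card (insert x L \<inter> {..s})" for s
    using cnt(2)[of s] assms(6) card_Int_atMost_insert[OF assms(1,4), of s]
      card_Int_atMost_insert[OF assms(2,5), of s] by (simp split: if_splits)
  moreover have "card (insert x L) = card (insert y R)" using cnt(1) assms by simp
  ultimately show ?thesis using set_le_iff_count[of "insert x L" "insert y R"] assms(1,2) by simp
qed

lemma card_split_at:
  assumes "finite (A :: nat set)"
  shows "card A = card (A \<inter> {..<r}) + card (A \<inter> {r..})"
proof -
  have "A = (A \<inter> {..<r}) \<union> (A \<inter> {r..})" by auto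
  then show ?thesis using assms card_Un_disjoint[of "A \<inter> {..<r}" "A \<inter> {r..}"] by fastforce
qed

text \<open>
  The elements of \<open>R\<close> up to \<open>s\<close> need as many elements of \<open>L\<close> up to \<open>s\<close>, and those of \<open>I\<close> from \<open>r\<close> on
  as many whose image is at least \<open>r\<close>; an element that serves both is counted in the last term.
\<close>

lemma linkage_cut_bound:
  assumes fin: "finite D" "finite I" "finite R" and inj: "inj_on f D" and card: "card I = card R"
    and L: "L \<subseteq> D" "card L = card I" "L \<le>\<^sub>s R" "I \<le>\<^sub>s f ` L"
  shows "card (R \<inter> {..s}) + card (I \<inter> {r..}) \<le> card I + card {d \<in> D. d \<le> s \<and> r \<le> f d}"
proof -
  have fL: "finite L" using L(1) fin(1) finite_subset by blast
  have 1: "card (R \<inter> {..s}) \<le> card (L \<inter> {..s})"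
    using L(3) set_le_iff_count[OF fL fin(3)] by blast
  have "card (f ` L \<inter> {..<r}) \<le> card (I \<inter> {..<r})"
  proof (cases r)
    case (Suc r')
    then show ?thesis using L(4) set_le_iff_count[OF fin(2), of "f ` L"] fL
      by (simp add: lessThan_Suc_atMost)
  qed simp
  moreover have "card (f ` L) = card I" using L(2) inj L(1) by (metis card_image inj_on_subset)
  ultimately have 2: "card (I \<inter> {r..}) \<le> card (f ` L \<inter> {r..})"
    using card_split_at[of "f ` L" r] card_split_at[OF fin(2), of r] fL by simp
  have "f ` L \<inter> {r..} = f ` {d \<in> L. r \<le> f d}" by auto
  then have 3: "card (f ` L \<inter> {r..}) \<le> card {d \<in> L. r \<le> f d}"
    using fL by (simp add: card_image_le)
  have "card (L \<inter> {..s}) + card {d \<in> L. r \<le> f d}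
      = card ((L \<inter> {..s}) \<union> {d \<in> L. r \<le> f d}) + card ((L \<inter> {..s}) \<inter> {d \<in> L. r \<le> f d})"
    using fL by (intro card_Un_Int) auto
  also have "\<dots> \<le> card L + card {d \<in> D. d \<le> s \<and> r \<le> f d}"
    using fL fin(1) L(1) by (intro add_mono card_mono) auto
  finally show ?thesis using 1 2 3 L(2) by linarith
qed

text \<open>
  A max-flow min-cut theorem for two chains joined by the edges from \<open>d\<close> to \<open>f d\<close>. A greedy
  choice works: the largest element of \<open>I\<close> is the hardest to serve, and among the edges that serve it
  the one that starts first is the easiest to reach from \<open>R\<close>. Removing it together with the first
  element of \<open>R\<close> from which it can be reached preserves all cut conditions.
\<close>

lemma ex_linkage:
  assumes "finite D" "finite I" "finite R" "inj_on f D" "card I = card R"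
    and "\<And>r s. card (R \<inter> {..s}) + card (I \<inter> {r..}) \<le> card I + card {d \<in> D. d \<le> s \<and> r \<le> f d}"
  shows "\<exists>L. L \<subseteq> D \<and> card L = card I \<and> L \<le>\<^sub>s R \<and> I \<le>\<^sub>s f ` L"
  using assms
proof (induction "card I" arbitrary: D I R)
  case 0
  then have "I = {}" "R = {}" by auto
  then show ?case by (intro exI[of _ "{}"]) (simp add: set_le_def)
next
  case (Suc t)
  note fin = Suc.prems(1-3) and inj = Suc.prems(4) and card = Suc.prems(5) and cut = Suc.prems(6)
  have ne: "I \<noteq> {}" "R \<noteq> {}" using Suc.hyps(2) card by auto
  define i where "i = Max I"
  have i: "i \<in> I" using ne fin by (simp add: i_def)
  have imax: "x \<le> i" if "x \<in> I" for x using that fin by (simp add: i_def)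
  have Ii: "I \<inter> {i..} = {i}" using i imax by force
  define M where "M = Max (D \<union> R)"
  have M: "x \<le> M" if "x \<in> D \<union> R" for x using that fin by (simp add: M_def)
  have "R \<inter> {..M} = R" using M by auto
  then have pos: "Suc 0 \<le> card {d \<in> D. d \<le> M \<and> i \<le> f d}" using cut[of M i] Ii card by simp
  have "{d \<in> D. i \<le> f d} \<noteq> {}"
  proof
    assume "{d \<in> D. i \<le> f d} = {}"
    then have none: "{d \<in> D. d \<le> M \<and> i \<le> f d} = {}" by auto
    show False using pos unfolding none by simp
  qed
  define d where "d = Min {d \<in> D. i \<le> f d}"
  have "d \<in> {d \<in> D. i \<le> f d}"
    unfolding d_def using fin \<open>{d \<in> D. i \<le> f d} \<noteq> {}\<close> by (intro Min_in) auto
  then have d: "d \<in> D" "i \<le> f d" by auto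
  have dmin: "d \<le> d'" if "d' \<in> D" "i \<le> f d'" for d' using that fin by (simp add: d_def)
  have "\<exists>y\<in>R. d \<le> y"
  proof (rule ccontr)
    assume n: "\<not> ?thesis"
    then have "0 < d" using ne(2) by fastforce
    have "R \<inter> {..d - 1} = R" using n \<open>0 < d\<close> by fastforce
    moreover have none: "{d' \<in> D. d' \<le> d - 1 \<and> i \<le> f d'} = {}" using dmin \<open>0 < d\<close> by fastforce
    ultimately show False using cut[of "d - 1" i] Ii card unfolding none by simp
  qed
  define y where "y = Min {y \<in> R. d \<le> y}"
  have "y \<in> {y \<in> R. d \<le> y}"
    unfolding y_def using fin \<open>\<exists>y\<in>R. d \<le> y\<close> by (intro Min_in) auto
  then have y: "y \<in> R" "d \<le> y" by auto
  have ymin: "y \<le> x" if "x \<in> R" "d \<le> x" for x using that fin by (simp add: y_def)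
  let ?I = "I - {i}" and ?R = "R - {y}" and ?D = "D - {d}"
  have cI: "card ?I = t" and cR: "card ?R = t" using Suc.hyps(2) card i y fin by auto
  have cut': "card (?R \<inter> {..s}) + card (?I \<inter> {r..}) \<le> card ?I + card {x \<in> ?D. x \<le> s \<and> r \<le> f x}" for r s
  proof (cases "r \<le> i")
    case False
    then have "?I \<inter> {r..} = {}" using imax by force
    moreover have "card (?R \<inter> {..s}) \<le> card ?R" using fin by (intro card_mono) auto
    ultimately show ?thesis using cI cR by simp
  next
    case True
    have Ir: "card (I \<inter> {r..}) = Suc (card (?I \<inter> {r..}))"
    proof -
      have "I \<inter> {r..} = insert i (?I \<inter> {r..})" using i True by auto
      then show ?thesis using fin by simp
    qed
    have Rs: "card (R \<inter> {..s}) = card (?R \<inter> {..s}) + (if y \<le> s then 1 else 0)"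
      using card_Int_atMost_insert[of ?R y s] y fin by (simp add: insert_absorb)
    let ?n = "\<lambda>D s. card {x \<in> D. x \<le> s \<and> r \<le> f x}"
    have n1: "?n D s \<le> Suc (?n ?D s)"
    proof -
      have "{x \<in> D. x \<le> s \<and> r \<le> f x} \<subseteq> insert d {x \<in> ?D. x \<le> s \<and> r \<le> f x}" by auto
      then have "?n D s \<le> card (insert d {x \<in> ?D. x \<le> s \<and> r \<le> f x})"
        using fin by (intro card_mono) auto
      also have "\<dots> \<le> Suc (?n ?D s)" by (rule card_insert_le_m1) auto
      finally show ?thesis .
    qed
    consider "s < d" | "y \<le> s" | "d \<le> s" "s < y" by linarith
    then show ?thesis
    proof cases
      case 1
      then have same: "{x \<in> D. x \<le> s \<and> r \<le> f x} = {x \<in> ?D. x \<le> s \<and> r \<le> f x}" by auto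
      show ?thesis using cut[of s r] Ir Rs cI Suc.hyps(2) y(2) 1 unfolding same by simp
    next
      case 2
      then show ?thesis using cut[of s r] Ir Rs cI Suc.hyps(2) n1 by simp
    next
      \<comment> \<open>no element of \<open>R\<close> lies in \<open>{d..s}\<close>, so the cut at \<open>d - 1\<close> gives the bound\<close>
      case 3
      have Req: "?R \<inter> {..s} = R \<inter> {..<d}" using 3 ymin y by force
      show ?thesis
      proof (cases d)
        case 0
        then have "?R \<inter> {..s} = {}" unfolding Req by simp
        moreover have "card (?I \<inter> {r..}) \<le> card ?I" using fin by (intro card_mono) auto
        ultimately show ?thesis by simp
      next
        case (Suc d')
        have "?n D d' \<le> ?n ?D s" using Suc 3 fin by (intro card_mono) auto
        moreover have "R \<inter> {..<d} = R \<inter> {..d'}" using Suc by auto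
        ultimately show ?thesis using cut[of d' r] Ir Req cI Suc.hyps(2) \<open>Suc t = card I\<close> by simp
      qed
    qed
  qed
  have "inj_on f ?D" using inj by (rule inj_on_subset) auto
  then obtain L where L: "L \<subseteq> ?D" "card L = card ?I" "L \<le>\<^sub>s ?R" "?I \<le>\<^sub>s f ` L"
    using Suc.hyps(1)[of ?I ?D ?R] cut' fin cI cR by auto
  have fL: "finite L" using L(1) fin(1) finite_subset by blast
  have "f d \<notin> f ` L" using L(1) inj d by (auto simp: inj_on_def)
  then have "insert i ?I \<le>\<^sub>s insert (f d) (f ` L)"
    using L(4) fin fL d by (intro set_le_insert) auto
  moreover have "insert d L \<le>\<^sub>s insert y ?R"
    using L(1,3) fin fL y by (intro set_le_insert) auto
  moreover have "card (insert d L) = card I" 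
  proof -
    have "d \<notin> L" using L(1) by auto
    then show ?thesis using fL L(2) cI Suc.hyps(2) by simp
  qed
  ultimately show ?case
    using L(1) d(1) i y(1) by (intro exI[of _ "insert d L"]) (auto simp: insert_absorb)
qed

lemma ex_linkage_iff:
  assumes "finite D" "finite I" "finite R" "inj_on f D" "card I = card R"
  shows "(\<exists>L. L \<subseteq> D \<and> card L = card I \<and> L \<le>\<^sub>s R \<and> I \<le>\<^sub>s f ` L) \<longleftrightarrow>
    (\<forall>r s. card (R \<inter> {..s}) + card (I \<inter> {r..}) \<le> card I + card {d \<in> D. d \<le> s \<and> r \<le> f d})"
  using linkage_cut_bound[OF assms] ex_linkage[OF assms] by blast

section \<open>The rank bounds and the four conditions\<close>

lemma restricted_permsD:
  assumes "w \<in> restricted_perms m p"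
  shows "w permutes {1..m + p}" and "l \<in> {1..m + p} \<Longrightarrow> w l \<le> l + m"
    and "l \<in> {1..m + p} \<Longrightarrow> l \<le> w l + p" and "l \<in> {1..m + p} \<Longrightarrow> w l \<in> {1..m + p}"
proof -
  have 1: "w permutes {1..m + p}"
    and 2: "\<And>l. l \<in> {1..m + p} \<Longrightarrow> - int p \<le> int (w l) - int l \<and> int (w l) - int l \<le> int m"
    using assms unfolding restricted_perms_def by blast+
  show "w permutes {1..m + p}" by (rule 1)
  show "w l \<le> l + m" if "l \<in> {1..m + p}" using 2[OF that] by linarith
  show "l \<le> w l + p" if "l \<in> {1..m + p}" using 2[OF that] by linarith
  show "w l \<in> {1..m + p}" if "l \<in> {1..m + p}" using permutes_in_image[OF 1] that by blast
qed

lemma restricted_permsI: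
  assumes "w permutes {1..m + p}" and "\<And>l. l \<in> {1..m + p} \<Longrightarrow> w l \<le> l + m \<and> l \<le> w l + p"
  shows "w \<in> restricted_perms m p"
proof -
  have "- int p \<le> int (w l) - int l \<and> int (w l) - int l \<le> int m" if "l \<in> {1..m + p}" for l
    using assms(2)[OF that] by linarith
  then show ?thesis using assms(1) by (simp add: restricted_perms_def)
qed

text \<open>
  The columns that select the minor with rows \<open>I\<close> and columns \<open>R\<close>: the unit vectors of the rows
  outside \<open>I\<close> delete these rows. Row \<open>i\<close> belongs to the element \<open>m + p + 1 - i\<close>.
\<close>

definition plucker_index :: "nat \<Rightarrow> nat \<Rightarrow> nat set \<Rightarrow> nat set \<Rightarrow> nat set" where
  "plucker_index m p I R = R \<union> (\<lambda>i. m + p + 1 - i) ` ({1..m} - I)"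

lemma elt_image_low:
  assumes "1 \<le> a" "a \<le> m + 1" "m \<le> b"
  shows "elt m p ` {a..b} = {a + p..m + p} \<union> {1..b - m}"
proof (intro equalityI subsetI)
  fix y assume "y \<in> {a + p..m + p} \<union> {1..b - m}"
  then show "y \<in> elt m p ` {a..b}"
  proof
    assume "y \<in> {a + p..m + p}"
    then have "y = elt m p (y - p)" "y - p \<in> {a..b}" using assms by (auto simp: elt_def)
    then show ?thesis by blast
  next
    assume "y \<in> {1..b - m}"
    then have "y = elt m p (y + m)" "y + m \<in> {a..b}" using assms by (auto simp: elt_def)
    then show ?thesis by blast
  qed
qed (use assms in \<open>auto simp: elt_def split: if_splits\<close>)

lemma elt_image_high:
  assumes "m < a"
  shows "elt m p ` {a..b} = {a - m..b - m}"
proof (intro equalityI subsetI)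
  fix y assume "y \<in> {a - m..b - m}"
  then have "y = elt m p (y + m)" "y + m \<in> {a..b}" using assms by (auto simp: elt_def)
  then show "y \<in> elt m p ` {a..b}" by blast
qed (use assms in \<open>auto simp: elt_def split: if_splits\<close>)

lemma window_rank_low:
  assumes "1 \<le> a" "a \<le> m + 1" "m \<le> b"
  shows "window_rank m w a b = (m + 1 - a) + card {l \<in> {1..b - m}. w l < a}"
proof -
  let ?S = "{l \<in> {1..b - m}. w l < a}"
  have "{x \<in> {a..b}. x \<le> m \<or> w (x - m) < a} = {a..m} \<union> (\<lambda>l. l + m) ` ?S"
  proof (intro equalityI subsetI)
    fix x assume x: "x \<in> {x \<in> {a..b}. x \<le> m \<or> w (x - m) < a}"
    show "x \<in> {a..m} \<union> (\<lambda>l. l + m) ` ?S"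
    proof (cases "x \<le> m")
      case False
      then have "x = (x - m) + m" "x - m \<in> ?S" using x by auto
      then show ?thesis by blast
    qed (use x in simp)
  qed (use assms in auto)
  moreover have "card ({a..m} \<union> (\<lambda>l. l + m) ` ?S) = card {a..m} + card ((\<lambda>l. l + m) ` ?S)"
    by (intro card_Un_disjoint) auto
  moreover have "card ((\<lambda>l. l + m) ` ?S) = card ?S" by (intro card_image) (simp add: inj_on_def)
  ultimately show ?thesis by (simp add: window_rank_def)
qed

lemma window_rank_high:
  assumes "m < a"
  shows "window_rank m w a b = card {l \<in> {a - m..b - m}. w l < a}"
proof -
  let ?S = "{l \<in> {a - m..b - m}. w l < a}"
  have "{x \<in> {a..b}. x \<le> m \<or> w (x - m) < a} = (\<lambda>l. l + m) ` ?S"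
  proof (intro equalityI subsetI)
    fix x assume x: "x \<in> {x \<in> {a..b}. x \<le> m \<or> w (x - m) < a}"
    then have "x = (x - m) + m" "x - m \<in> ?S" using assms by auto
    then show "x \<in> (\<lambda>l. l + m) ` ?S" by blast
  qed (use assms in auto)
  moreover have "card ((\<lambda>l. l + m) ` ?S) = card ?S" by (intro card_image) (simp add: inj_on_def)
  ultimately show ?thesis by (simp add: window_rank_def)
qed

lemma card_conj_split:
  "finite A \<Longrightarrow> card {x \<in> A. P x} + card {x \<in> A. \<not> P x} = card A"
proof -
  assume "finite A"
  then have "card ({x \<in> A. P x} \<union> {x \<in> A. \<not> P x}) = card {x \<in> A. P x} + card {x \<in> A. \<not> P x}"
    by (intro card_Un_disjoint) auto
  moreover have "{x \<in> A. P x} \<union> {x \<in> A. \<not> P x} = A" by auto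
  ultimately show ?thesis by simp
qed

text \<open>
  A label together with a permutation. The lemmas below compute, for each kind of window, both
  sides of its rank bound.
\<close>

locale minor_label =
  fixes m p :: nat and w :: "nat \<Rightarrow> nat" and I R :: "nat set"
  assumes w: "w \<in> restricted_perms m p"
    and I: "I \<subseteq> {1..m}" and R: "R \<subseteq> {1..p}" and card_eq: "card I = card R"
begin

abbreviation "N \<equiv> m + p"
abbreviation "K \<equiv> plucker_index m p I R"
abbreviation violated :: "nat \<Rightarrow> nat \<Rightarrow> bool" where
  "violated a b \<equiv> window_rank m w a b < card (K \<inter> elt m p ` {a..b})"

lemma fin: "finite I" "finite R"
  using finite_subset[OF I] finite_subset[OF R] by simp_all

lemmas w_permutes = restricted_permsD(1)[OF w] and w_upper = restricted_permsD(2)[OF w]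
  and w_lower = restricted_permsD(3)[OF w] and w_range = restricted_permsD(4)[OF w]

lemma w_inj: "inj_on w A"
  by (rule inj_on_subset[OF permutes_inj[OF w_permutes]]) simp

lemma card_w_less:
  assumes "1 \<le> a" "a \<le> N + 1"
  shows "card {l \<in> {1..N}. w l < a} = a - 1"
proof -
  have "w ` {l \<in> {1..N}. w l < a} = {1..<a}"
  proof (intro equalityI subsetI)
    fix y assume y: "y \<in> {1..<a}"
    then have "y \<in> w ` {1..N}" unfolding permutes_image[OF w_permutes] using assms by auto
    then show "y \<in> w ` {l \<in> {1..N}. w l < a}" using y by auto
  qed (use w_range in force)
  then show ?thesis using card_image[OF w_inj, of "{l \<in> {1..N}. w l < a}"] by simp
qed

lemma card_K_Int:
  assumes "finite S"
  shows "card (K \<inter> S) = card (R \<inter> S) + card {i \<in> {1..m} - I. N + 1 - i \<in> S}"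
proof -
  let ?T = "{i \<in> {1..m} - I. N + 1 - i \<in> S}"
  have "K \<inter> S = (R \<inter> S) \<union> (\<lambda>i. N + 1 - i) ` ?T" by (auto simp: plucker_index_def)
  moreover have "card ((R \<inter> S) \<union> (\<lambda>i. N + 1 - i) ` ?T) = card (R \<inter> S) + card ((\<lambda>i. N + 1 - i) ` ?T)"
  proof (rule card_Un_disjoint)
    have "N + 1 - i \<notin> R" if "i \<in> {1..m}" for i
    proof
      assume "N + 1 - i \<in> R"
      then have "N + 1 - i \<in> {1..p}" using R by blast
      then show False using that by auto
    qed
    then show "(R \<inter> S) \<inter> (\<lambda>i. N + 1 - i) ` ?T = {}" by auto
  qed (use fin in auto)
  moreover have "card ((\<lambda>i. N + 1 - i) ` ?T) = card ?T" by (intro card_image) (auto simp: inj_on_def)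
  ultimately show ?thesis by simp
qed

lemma card_interval_Diff_I: "card ({c..d} - I) + card (I \<inter> {c..d}) = d + 1 - c"
proof -
  have "card (({c..d} - I) \<union> (I \<inter> {c..d})) = card ({c..d} - I) + card (I \<inter> {c..d})"
    by (intro card_Un_disjoint) auto
  moreover have "({c..d} - I) \<union> (I \<inter> {c..d}) = {c..d}" by auto
  ultimately show ?thesis by simp
qed

text \<open>
  Windows that start at a row, or at the first column, and end at a column; they see
  the submatrix of the last rows and the first columns.
\<close>

lemma violated_SW_iff:
  assumes a: "1 \<le> a" "a \<le> m + 1" and s: "s \<le> p"
  shows "violated a (m + s) \<longleftrightarrow>
    card I + card {d \<in> {1..p} \<inter> w -` {1..m}. d \<le> s \<and> m + 2 - a \<le> w_circ m (w d)}
      < card (R \<inter> {..s}) + card (I \<inter> {m + 2 - a..})"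
proof -
  have wc: "w l < a \<longleftrightarrow> w l \<in> {1..m} \<and> m + 2 - a \<le> w_circ m (w l)" if "l \<in> {1..s}" for l
    using w_range[of l] that s a by (auto simp: w_circ_def)
  have e1: "{d \<in> {1..p} \<inter> w -` {1..m}. d \<le> s \<and> m + 2 - a \<le> w_circ m (w d)} = {l \<in> {1..s}. w l < a}"
    using wc s by auto
  have e2: "R \<inter> ({a + p..m + p} \<union> {1..s}) = R \<inter> {..s}" using R a by fastforce
  have e3: "{i \<in> {1..m} - I. N + 1 - i \<in> {a + p..m + p} \<union> {1..s}} = {1..m + 1 - a} - I"
    using a s by auto
  have e4: "I \<inter> {1..m + 1 - a} = I \<inter> {..<m + 2 - a}" using I a by fastforce
  have "card ({1..m + 1 - a} - I) + card (I \<inter> {..<m + 2 - a}) = m + 1 - a"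
    using card_interval_Diff_I[of 1 "m + 1 - a"] unfolding e4 by simp
  moreover have "card (K \<inter> elt m p ` {a..m + s}) = card (R \<inter> {..s}) + card ({1..m + 1 - a} - I)"
    using card_K_Int[of "{a + p..m + p} \<union> {1..s}"] elt_image_low[OF a, of "m + s" p]
    unfolding e2 e3 by simp
  moreover have "window_rank m w a (m + s) = m + 1 - a + card {l \<in> {1..s}. w l < a}"
    using window_rank_low[OF a, of "m + s" w] by simp
  ultimately show ?thesis
    unfolding e1 using card_split_at[OF fin(1), of "m + 2 - a"] by linarith
qed

text \<open>
  Windows that start at a column and end at a row, or at the last column; they see
  the submatrix of the first rows and the last columns.
\<close>

lemma violated_NE_iff:
  assumes s: "1 \<le> s" "s \<le> p" and r: "r \<le> m"
  shows "violated (m + s) (N + m - r) \<longleftrightarrow>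
    card R + card {l \<in> {1..m} \<inter> w_circ N ` w -` {m + 1..N}. l \<le> r \<and> m + s \<le> w (w_circ N l)}
      < card (I \<inter> {..r}) + card ((+) m ` R \<inter> {m + s..})"
proof -
  have wc: "w_circ N (w_circ N l) = l" if "l \<in> {1..N}" for l using that by (auto simp: w_circ_def)
  have wcN: "w_circ N l = N + 1 - l" if "l \<in> {1..m}" for l using that by (auto simp: w_circ_def)
  have D: "l \<in> w_circ N ` w -` {m + 1..N}" if "l \<in> {1..m}" "m + s \<le> w (w_circ N l)" for l
  proof -
    have "w (w_circ N l) \<in> {1..N}" using that wcN by (intro w_range) auto
    then have "w_circ N l \<in> w -` {m + 1..N}" using that s by auto
    moreover have "l = w_circ N (w_circ N l)" using wc that by auto
    ultimately show ?thesis by blast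
  qed
  have Aeq: "{l \<in> {1..m} \<inter> w_circ N ` w -` {m + 1..N}. l \<le> r \<and> m + s \<le> w (w_circ N l)}
      = (\<lambda>k. N + 1 - k) ` {k \<in> {N - r + 1..N}. m + s \<le> w k}" (is "?A = _ ` ?B")
  proof (intro equalityI subsetI)
    fix l assume l: "l \<in> ?A"
    then have "l = N + 1 - (N + 1 - l)" "N + 1 - l \<in> ?B" using r wcN[of l] by auto
    then show "l \<in> (\<lambda>k. N + 1 - k) ` ?B" by blast
  next
    fix l assume "l \<in> (\<lambda>k. N + 1 - k) ` ?B"
    then obtain k where k: "k \<in> ?B" "l = N + 1 - k" by blast
    have lr: "l \<in> {1..m}" "l \<le> r" using k r by auto
    then have "w_circ N l = k" using wcN k by auto
    then show "l \<in> ?A" using lr D[OF lr(1)] k by auto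
  qed
  have "inj_on (\<lambda>k. N + 1 - k) ?B" by (auto simp: inj_on_def)
  then have cA: "card ?A = card ?B" unfolding Aeq by (rule card_image)
  have cB: "card {k \<in> {N - r + 1..N}. w k < m + s} + card ?B = r"
    using card_conj_split[of "{N - r + 1..N}" "\<lambda>k. w k < m + s"] r by (simp add: not_less)
  have "{l \<in> {1..N}. w l < m + s} = {1..<s} \<union> {l \<in> {s..N - r}. w l < m + s} \<union> {k \<in> {N - r + 1..N}. w k < m + s}"
    (is "?L = ?M")
  proof -
    have "w l < m + s" if "l \<in> {1..<s}" for l using w_upper[of l] that s by auto
    then have "l \<in> ?L \<longleftrightarrow> l \<in> ?M" for l using s r by (cases "l < s"; cases "l \<le> N - r") auto
    then show ?thesis by blast
  qed
  moreover have "card ({1..<s} \<union> {l \<in> {s..N - r}. w l < m + s} \<union> {k \<in> {N - r + 1..N}. w k < m + s})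
      = card {1..<s} + card {l \<in> {s..N - r}. w l < m + s} + card {k \<in> {N - r + 1..N}. w k < m + s}"
  proof (subst card_Un_disjoint)
    show "({1..<s} \<union> {l \<in> {s..N - r}. w l < m + s}) \<inter> {k \<in> {N - r + 1..N}. w k < m + s} = {}"
      using s r by auto
    have "card ({1..<s} \<union> {l \<in> {s..N - r}. w l < m + s}) = card {1..<s} + card {l \<in> {s..N - r}. w l < m + s}"
      by (intro card_Un_disjoint) auto
    then show "card ({1..<s} \<union> {l \<in> {s..N - r}. w l < m + s}) + card {k \<in> {N - r + 1..N}. w k < m + s}
      = card {1..<s} + card {l \<in> {s..N - r}. w l < m + s} + card {k \<in> {N - r + 1..N}. w k < m + s}"
      by simp
  qed auto
  ultimately have mid: "card {l \<in> {s..N - r}. w l < m + s} + card {k \<in> {N - r + 1..N}. w k < m + s} = m"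
    using card_w_less[of "m + s"] s by simp
  have "(+) m ` R \<inter> {m + s..} = (+) m ` (R \<inter> {s..})" by auto
  then have cR: "card ((+) m ` R \<inter> {m + s..}) = card (R \<inter> {s..})" by (simp add: card_image inj_on_def)
  have e1: "R \<inter> {s..N - r} = R \<inter> {s..}" using R r by fastforce
  have e2: "{i \<in> {1..m} - I. N + 1 - i \<in> {s..N - r}} = {r + 1..m} - I" using r s by auto
  have e3: "I \<inter> {r + 1..m} = I \<inter> {r + 1..}" "I \<inter> {..<r + 1} = I \<inter> {..r}" using I by auto
  have img: "elt m p ` {m + s..N + m - r} = {s..N - r}"
    using elt_image_high[of m "m + s"] s r by simp
  have "card (K \<inter> elt m p ` {m + s..N + m - r}) = card (R \<inter> {s..}) + card ({r + 1..m} - I)"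
    unfolding img card_K_Int[OF finite_atLeastAtMost] e1 e2 ..
  moreover have "card ({r + 1..m} - I) + card (I \<inter> {r + 1..}) = m - r"
    using card_interval_Diff_I[of "r + 1" m] unfolding e3 by simp
  moreover have "card I = card (I \<inter> {..r}) + card (I \<inter> {r + 1..})"
    using card_split_at[OF fin(1), of "r + 1"] unfolding e3 .
  moreover have "window_rank m w (m + s) (N + m - r) = card {l \<in> {s..N - r}. w l < m + s}"
    using window_rank_high[of m "m + s" w "N + m - r"] s r by simp
  ultimately show ?thesis using cA cB cR mid r card_eq by linarith
qed

lemma violated_columns_iff:
  assumes r: "1 \<le> r" and s: "s \<le> p"
  shows "violated (m + r) (m + s) \<longleftrightarrow> card ({r..s} - w -` {m + r..m + s}) < card (R \<inter> {r..s})"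
proof -
  have "{r..s} - w -` {m + r..m + s} = {l \<in> {r..s}. w l < m + r}"
  proof -
    have "w l \<notin> {m + r..m + s} \<longleftrightarrow> w l < m + r" if "l \<in> {r..s}" for l
      using w_upper[of l] that r s by auto
    then show ?thesis by auto
  qed
  moreover have none: "{i \<in> {1..m} - I. N + 1 - i \<in> {r..s}} = {}" using s by auto
  have "card (K \<inter> {r..s}) = card (R \<inter> {r..s})"
    using card_K_Int[of "{r..s}"] unfolding none by simp
  ultimately show ?thesis
    using window_rank_high[of m "m + r" w "m + s"] elt_image_high[of m "m + r" p "m + s"] r by simp
qed

text \<open>
  Windows that contain all columns; the elements they miss belong to an interval of rows.
\<close>

lemma violated_rows_iff:
  assumes r: "1 \<le> r" "r \<le> s + 1" and s: "s \<le> m"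
  shows "violated (m + 2 - r) (N + m - s) \<longleftrightarrow>
    card (w_circ N ` {r..s} - w -` w_circ m ` {r..s}) < card (I \<inter> {r..s})"
proof -
  let ?a = "m + 2 - r" and ?b = "N + m - s"
  have a: "1 \<le> ?a" "?a \<le> m + 1" and b: "m \<le> ?b" using r s by auto
  have refl: "w_circ k ` {r..s} = {k + 1 - s..k + 1 - r}" if "s \<le> k" for k
  proof (intro equalityI subsetI)
    fix x assume x: "x \<in> {k + 1 - s..k + 1 - r}"
    then have "x = w_circ k (k + 1 - x)" "k + 1 - x \<in> {r..s}" using that r by (auto simp: w_circ_def)
    then show "x \<in> w_circ k ` {r..s}" by blast
  qed (use that r in \<open>auto simp: w_circ_def\<close>)
  let ?P = "{N + 1 - s..N + 1 - r}"
  have Peq: "w_circ N ` {r..s} - w -` w_circ m ` {r..s} = {l \<in> ?P. \<not> w l < ?a}"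
  proof -
    have "w l \<in> {m + 1 - s..m + 1 - r} \<longleftrightarrow> w l < ?a" if l: "l \<in> ?P" for l
    proof -
      have "l \<in> {1..N}" using l r s by auto
      then have "l \<le> w l + p" by (rule w_lower)
      then have "m + 1 - s \<le> w l" using l s by auto
      then show ?thesis using r s by auto
    qed
    then show ?thesis using refl[of N] refl[of m] s by auto
  qed
  have cP: "card {l \<in> ?P. w l < ?a} + card {l \<in> ?P. \<not> w l < ?a} = s + 1 - r"
    using card_conj_split[of ?P "\<lambda>l. w l < ?a"] r s by simp
  have "{l \<in> {1..N}. w l < ?a} = {l \<in> {1..N - s}. w l < ?a} \<union> {l \<in> ?P. w l < ?a}"
    (is "?L = ?M")
  proof -
    have "l \<le> N + 1 - r" if "l \<in> {1..N}" "w l < ?a" for l using w_lower[OF that(1)] that r s by auto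
    then have "l \<in> ?L \<longleftrightarrow> l \<in> ?M" for l using r s by (cases "l \<le> N - s") auto
    then show ?thesis by blast
  qed
  moreover have "card ({l \<in> {1..N - s}. w l < ?a} \<union> {l \<in> ?P. w l < ?a})
      = card {l \<in> {1..N - s}. w l < ?a} + card {l \<in> ?P. w l < ?a}"
    using s by (intro card_Un_disjoint) auto
  ultimately have cnt: "card {l \<in> {1..N - s}. w l < ?a} + card {l \<in> ?P. w l < ?a} = m + 1 - r"
    using card_w_less[of ?a] a by simp
  have rank: "window_rank m w ?a ?b = (r - 1) + card {l \<in> {1..N - s}. w l < ?a}"
    using window_rank_low[OF a b, of w] r s by simp
  have img: "elt m p ` {?a..?b} = {?a + p..m + p} \<union> {1..N - s}"
    using elt_image_low[OF a b, of p] s by simp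
  have e1: "R \<inter> ({?a + p..m + p} \<union> {1..N - s}) = R" using R s by fastforce
  have e2: "{i \<in> {1..m} - I. N + 1 - i \<in> {?a + p..m + p} \<union> {1..N - s}} = ({1..m} - I) - ({r..s} - I)"
    using r s by auto
  have cK: "card (K \<inter> elt m p ` {?a..?b}) = card R + card (({1..m} - I) - ({r..s} - I))"
    unfolding img using card_K_Int[of "{?a + p..m + p} \<union> {1..N - s}"] e1 e2 by simp
  have sub: "{r..s} - I \<subseteq> {1..m} - I" using r s by auto
  have "card (({1..m} - I) - ({r..s} - I)) + card ({r..s} - I) = card ({1..m} - I)"
    using sub card_Diff_subset[of "{r..s} - I" "{1..m} - I"] card_mono[OF _ sub] by simp
  moreover have "card ({1..m} - I) + card I = m"
    using card_interval_Diff_I[of 1 m] I by (simp add: Int_absorb2)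
  moreover have "card ({r..s} - I) + card (I \<inter> {r..s}) = s + 1 - r" by (rule card_interval_Diff_I)
  ultimately show ?thesis using rank cnt cP cK card_eq r s unfolding Peq by linarith
qed

lemma M_cond1_iff:
  "M_cond1 m p w I R \<longleftrightarrow> (\<exists>r s. card I + card {d \<in> {1..p} \<inter> w -` {1..m}. d \<le> s \<and> r \<le> w_circ m (w d)}
      < card (R \<inter> {..s}) + card (I \<inter> {r..}))"
proof -
  have inj: "inj_on (w_circ m \<circ> w) ({1..p} \<inter> w -` {1..m})"
    by (rule comp_inj_on[OF w_inj]) (auto simp: w_circ_def inj_on_def)
  have fD: "finite ({1..p} \<inter> w -` {1..m})" by simp
  note linkage = ex_linkage_iff[OF fD fin inj card_eq]
  have "M_cond1 m p w I R \<longleftrightarrow> \<not> (\<exists>L. L \<subseteq> {1..p} \<inter> w -` {1..m} \<and> card L = card I \<and> L \<le>\<^sub>s R \<and>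
      I \<le>\<^sub>s (w_circ m \<circ> w) ` L)"
    unfolding M_cond1_def image_comp by blast
  then show ?thesis unfolding linkage by (simp add: not_le)
qed

lemma M_cond2_iff:
  "M_cond2 m p w I R \<longleftrightarrow> (\<exists>r s. card R +
      card {l \<in> {1..m} \<inter> w_circ N ` w -` {m + 1..N}. l \<le> r \<and> s \<le> w (w_circ N l)}
      < card (I \<inter> {..r}) + card ((+) m ` R \<inter> {s..}))"
proof -
  let ?D = "{1..m} \<inter> w_circ N ` w -` {m + 1..N}"
  have "inj_on (w \<circ> w_circ N) ?D"
    by (rule comp_inj_on[OF _ w_inj]) (auto simp: w_circ_def inj_on_def)
  moreover have cR: "card ((+) m ` R) = card R" by (simp add: card_image)
  ultimately have linkage: "(\<exists>L. L \<subseteq> ?D \<and> card L = card R \<and> L \<le>\<^sub>s I \<and> (+) m ` R \<le>\<^sub>s (w \<circ> w_circ N) ` L) \<longleftrightarrow>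
    (\<forall>s r. card (I \<inter> {..r}) + card ((+) m ` R \<inter> {s..})
      \<le> card R + card {d \<in> ?D. d \<le> r \<and> s \<le> (w \<circ> w_circ N) d})"
    using ex_linkage_iff[of ?D "(+) m ` R" I "w \<circ> w_circ N"] fin card_eq by simp
  have "M_cond2 m p w I R \<longleftrightarrow> \<not> (\<exists>L. L \<subseteq> ?D \<and> card L = card R \<and> L \<le>\<^sub>s I \<and>
      (+) m ` R \<le>\<^sub>s (w \<circ> w_circ N) ` L)"
    unfolding M_cond2_def image_comp by blast
  then show ?thesis unfolding linkage by (simp add: not_le) blast
qed

text \<open>
  The windows that are not of one of the four kinds consist of unit vectors only. They are free
  and their bounds are never violated.
\<close>

lemma violated_imp_M_cond:
  assumes ab: "1 \<le> a" "a \<le> b" "b \<le> N + m" "b < a + N" and viol: "violated a b"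
  shows "M_cond1 m p w I R \<or> M_cond2 m p w I R \<or> M_cond3 m p w I R \<or> M_cond4 m p w I R"
proof -
  have card_le: "card (K \<inter> elt m p ` {a..b}) \<le> card {a..b}"
    by (rule order_trans[OF card_mono card_image_le]) auto
  have "m < b"
  proof (rule ccontr)
    assume "\<not> m < b"
    then have "{x \<in> {a..b}. x \<le> m \<or> w (x - m) < a} = {a..b}" by auto
    then have "window_rank m w a b = card {a..b}" unfolding window_rank_def by simp
    then show False using viol card_le by simp
  qed
  have "a \<le> N"
  proof (rule ccontr)
    assume "\<not> a \<le> N"
    have "w (x - m) < a" if "x \<in> {a..b}" for x
    proof -
      have "x - m \<in> {1..N}" using that ab \<open>\<not> a \<le> N\<close> by auto
      then show ?thesis using w_range[of "x - m"] \<open>\<not> a \<le> N\<close> by simp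
    qed
    then have "{x \<in> {a..b}. x \<le> m \<or> w (x - m) < a} = {a..b}" by auto
    then have "window_rank m w a b = card {a..b}" unfolding window_rank_def by simp
    then show False using viol card_le by simp
  qed
  consider "a \<le> m + 1" "b \<le> N" | "a \<le> m + 1" "N < b" | "m + 1 < a" "b \<le> N" | "m + 1 < a" "N < b"
    by linarith
  then show ?thesis
  proof cases
    case 1
    then have "violated a (m + (b - m))" "b - m \<le> p" using viol \<open>m < b\<close> by simp_all
    then have "M_cond1 m p w I R"
      unfolding M_cond1_iff using violated_SW_iff[OF ab(1) 1(1), of "b - m"] by blast
    then show ?thesis by simp
  next
    case 2
    let ?r = "m + 2 - a" and ?s = "N + m - b"
    have rs: "m + 2 - ?r = a" "N + m - ?s = b" "1 \<le> ?r" "?r \<le> ?s + 1" "?s \<le> m" using 2 ab by auto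
    then have lt: "card (w_circ N ` {?r..?s} - w -` w_circ m ` {?r..?s}) < card (I \<inter> {?r..?s})"
      using violated_rows_iff[of ?r ?s] viol by simp
    then have "{?r..?s} \<noteq> {}" by fastforce
    then have "?r \<le> ?s" by simp
    then have "M_cond4 m p w I R" unfolding M_cond4_def using rs(3,5) lt by blast
    then show ?thesis by simp
  next
    case 3
    let ?r = "a - m" and ?s = "b - m"
    have rs: "m + ?r = a" "m + ?s = b" "1 \<le> ?r" "?r \<le> ?s" "?s \<le> p" using 3 ab by auto
    then have "card ({?r..?s} - w -` {m + ?r..m + ?s}) < card (R \<inter> {?r..?s})"
      using violated_columns_iff[of ?r ?s] viol by simp
    then have "M_cond3 m p w I R" unfolding M_cond3_def using rs(3-5) by blast
    then show ?thesis by simp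
  next
    case 4
    let ?s = "a - m" and ?r = "N + m - b"
    have rs: "m + ?s = a" "N + m - ?r = b" "1 \<le> ?s" "?s \<le> p" "?r \<le> m"
      using 4 ab \<open>a \<le> N\<close> by auto
    then have "card R + card {l \<in> {1..m} \<inter> w_circ N ` w -` {m + 1..N}. l \<le> ?r \<and> m + ?s \<le> w (w_circ N l)}
      < card (I \<inter> {..?r}) + card ((+) m ` R \<inter> {m + ?s..})"
      using violated_NE_iff[of ?s ?r] viol by simp
    then have "M_cond2 m p w I R" unfolding M_cond2_iff by blast
    then show ?thesis by simp
  qed
qed

text \<open>
  A violated cut lies in the range of windows after clipping \<open>r\<close> and \<open>s\<close>: outside that range a cut is
  either never violated or says the same as one inside.
\<close>

lemma M_cond1_imp_violated:
  assumes "M_cond1 m p w I R"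
  shows "\<exists>a b. 1 \<le> a \<and> a \<le> b \<and> b \<le> N + m \<and> b < a + N \<and> violated a b"
proof -
  let ?n = "\<lambda>r s. card {d \<in> {1..p} \<inter> w -` {1..m}. d \<le> s \<and> r \<le> w_circ m (w d)}"
  obtain r s where rs: "card I + ?n r s < card (R \<inter> {..s}) + card (I \<inter> {r..})"
    using assms unfolding M_cond1_iff by blast
  have Ile: "card (I \<inter> {r..}) \<le> card I" and Rle: "card (R \<inter> {..s}) \<le> card R" for r s
    using fin by (auto intro: card_mono)
  have "s \<noteq> 0"
  proof
    assume "s = 0"
    then have none: "R \<inter> {..s} = {}" using R by auto
    show False using rs Ile[of r] unfolding none by simp
  qed
  have "r \<le> m"
  proof (rule ccontr)
    assume "\<not> r \<le> m"
    then have none: "I \<inter> {r..} = {}" using I by auto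
    show False using rs Rle[of s] card_eq unfolding none by simp
  qed
  define s' where "s' = min s p"
  define r' where "r' = max r 1"
  have eqs: "R \<inter> {..s'} = R \<inter> {..s}" "I \<inter> {r'..} = I \<inter> {r..}"
    using R I by (auto simp: s'_def r'_def)
  have "{d \<in> {1..p} \<inter> w -` {1..m}. d \<le> s' \<and> r' \<le> w_circ m (w d)}
    = {d \<in> {1..p} \<inter> w -` {1..m}. d \<le> s \<and> r \<le> w_circ m (w d)}"
    by (auto simp: s'_def r'_def w_circ_def)
  then have lt: "card I + ?n r' s' < card (R \<inter> {..s'}) + card (I \<inter> {r'..})"
    using rs eqs by metis
  define a where "a = m + 2 - r'"
  have a: "1 \<le> a" "a \<le> m + 1" "m + 2 - a = r'" using \<open>r \<le> m\<close> by (auto simp: a_def r'_def)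
  have "R \<noteq> {}"
  proof
    assume "R = {}"
    then show False using rs Ile[of r] by simp
  qed
  then have "1 \<le> p" using R by fastforce
  then have s': "1 \<le> s'" "s' \<le> p" using \<open>s \<noteq> 0\<close> by (auto simp: s'_def)
  then have "violated a (m + s')" using violated_SW_iff[OF a(1,2), of s'] lt a(3) by simp
  moreover have "1 \<le> a \<and> a \<le> m + s' \<and> m + s' \<le> N + m \<and> m + s' < a + N" using a s' by auto
  ultimately show ?thesis by blast
qed

text \<open>
  As before, \<open>r\<close> and \<open>s\<close> are clipped. The values of \<open>w\<close> on the domain of the linkage exceed \<open>m\<close>, so
  small \<open>s\<close> can be raised to \<open>m + 1\<close>.
\<close>

lemma M_cond2_imp_violated:
  assumes "M_cond2 m p w I R"
  shows "\<exists>a b. 1 \<le> a \<and> a \<le> b \<and> b \<le> N + m \<and> b < a + N \<and> violated a b"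
proof -
  let ?n = "\<lambda>r s. card {l \<in> {1..m} \<inter> w_circ N ` w -` {m + 1..N}. l \<le> r \<and> s \<le> w (w_circ N l)}"
  obtain r s where rs: "card R + ?n r s < card (I \<inter> {..r}) + card ((+) m ` R \<inter> {s..})"
    using assms unfolding M_cond2_iff by blast
  have cmR: "card ((+) m ` R) = card R" by (simp add: card_image)
  have Ile: "card (I \<inter> {..r}) \<le> card I" and Rle: "card ((+) m ` R \<inter> {s..}) \<le> card R" for r s
    unfolding cmR[symmetric] using fin by (auto intro: card_mono)
  have "s \<le> N"
  proof (rule ccontr)
    assume "\<not> s \<le> N"
    then have none: "(+) m ` R \<inter> {s..} = {}" using R by auto
    show False using rs Ile[of r] card_eq unfolding none by simp
  qed
  define r' where "r' = min r m"
  define s' where "s' = max (s - m) 1"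
  have eqs: "I \<inter> {..r'} = I \<inter> {..r}" "(+) m ` R \<inter> {m + s'..} = (+) m ` R \<inter> {s..}"
    using R I by (auto simp: s'_def r'_def)
  have wge: "m + 1 \<le> w (w_circ N l)" if "l \<in> {1..m} \<inter> w_circ N ` w -` {m + 1..N}" for l
  proof -
    have "l \<in> w_circ N ` (w -` {m + 1..N})" using that by simp
    then obtain k where "l = w_circ N k" "k \<in> w -` {m + 1..N}" by (rule imageE)
    then have k: "l = w_circ N k" "w k \<in> {m + 1..N}" by simp_all
    then have "k \<in> {1..N}" using permutes_in_image[OF w_permutes, of k] by auto
    then have "w_circ N l = k" using k by (auto simp: w_circ_def)
    then show ?thesis using k by simp
  qed
  have "{l \<in> {1..m} \<inter> w_circ N ` w -` {m + 1..N}. l \<le> r' \<and> m + s' \<le> w (w_circ N l)}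
    = {l \<in> {1..m} \<inter> w_circ N ` w -` {m + 1..N}. l \<le> r \<and> s \<le> w (w_circ N l)}"
  proof (intro Collect_cong conj_cong refl)
    fix l assume l: "l \<in> {1..m} \<inter> w_circ N ` w -` {m + 1..N}"
    show "l \<le> r' \<longleftrightarrow> l \<le> r" using l by (auto simp: r'_def)
    show "m + s' \<le> w (w_circ N l) \<longleftrightarrow> s \<le> w (w_circ N l)" using wge[OF l] by (auto simp: s'_def)
  qed
  then have lt: "card R + ?n r' (m + s') < card (I \<inter> {..r'}) + card ((+) m ` R \<inter> {m + s'..})"
    using rs eqs by metis
  have "R \<noteq> {}"
  proof
    assume "R = {}"
    then show False using rs Ile[of r] card_eq by simp
  qed
  then have "1 \<le> p" using R by fastforce
  then have s': "1 \<le> s'" "s' \<le> p" using \<open>s \<le> N\<close> by (auto simp: s'_def)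
  moreover have r': "r' \<le> m" by (simp add: r'_def)
  ultimately have "violated (m + s') (N + m - r')" using violated_NE_iff[OF s' r'] lt by simp
  moreover have "1 \<le> m + s' \<and> m + s' \<le> N + m - r' \<and> N + m - r' \<le> N + m \<and>
      N + m - r' < m + s' + N" using s' r' by auto
  ultimately show ?thesis by blast
qed

theorem ex_violated_iff_M_cond:
  "(\<exists>a b. 1 \<le> a \<and> a \<le> b \<and> b \<le> N + m \<and> b < a + N \<and> violated a b) \<longleftrightarrow>
    M_cond1 m p w I R \<or> M_cond2 m p w I R \<or> M_cond3 m p w I R \<or> M_cond4 m p w I R"
proof
  assume "\<exists>a b. 1 \<le> a \<and> a \<le> b \<and> b \<le> N + m \<and> b < a + N \<and> violated a b"
  then show "M_cond1 m p w I R \<or> M_cond2 m p w I R \<or> M_cond3 m p w I R \<or> M_cond4 m p w I R"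
    using violated_imp_M_cond by blast
next
  assume "M_cond1 m p w I R \<or> M_cond2 m p w I R \<or> M_cond3 m p w I R \<or> M_cond4 m p w I R"
  then consider "M_cond1 m p w I R" | "M_cond2 m p w I R" | "M_cond3 m p w I R" | "M_cond4 m p w I R"
    by blast
  then show "\<exists>a b. 1 \<le> a \<and> a \<le> b \<and> b \<le> N + m \<and> b < a + N \<and> violated a b"
  proof cases
    case 3
    then obtain r s where rs: "1 \<le> r" "r \<le> s" "s \<le> p"
      "card ({r..s} - w -` {m + r..m + s}) < card (R \<inter> {r..s})"
      unfolding M_cond3_def by blast
    then have "violated (m + r) (m + s)" using violated_columns_iff[of r s] by simp
    moreover have "1 \<le> m + r \<and> m + r \<le> m + s \<and> m + s \<le> N + m \<and> m + s < m + r + N"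
      using rs by auto
    ultimately show ?thesis by blast
  next
    case 4
    then obtain r s where rs: "1 \<le> r" "r \<le> s" "s \<le> m"
      "card (w_circ N ` {r..s} - w -` w_circ m ` {r..s}) < card (I \<inter> {r..s})"
      unfolding M_cond4_def by blast
    then have "violated (m + 2 - r) (N + m - s)" using violated_rows_iff[of r s] by simp
    moreover have "I \<noteq> {}" using rs(4) by auto
    then have "R \<noteq> {}" using card_eq fin by auto
    then have "1 \<le> p" using R by fastforce
    then have "1 \<le> m + 2 - r \<and> m + 2 - r \<le> N + m - s \<and> N + m - s \<le> N + m \<and>
        N + m - s < m + 2 - r + N" using rs by auto
    ultimately show ?thesis by blast
  qed (use M_cond1_imp_violated M_cond2_imp_violated in blast)+
qed

end

section \<open>Every restricted permutation is realised\<close>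

text \<open>
  The value is the position of \<open>k\<close> itself (\<open>v k\<close> is a loop) or, for \<open>k > p\<close>, its earlier copy (\<open>v k\<close> is
  a coloop). The two other combinations are impossible for a restricted permutation.
\<close>

definition fixes_elt :: "nat \<Rightarrow> nat \<Rightarrow> (nat \<Rightarrow> nat) \<Rightarrow> nat \<Rightarrow> bool" where
  "fixes_elt m p w k \<longleftrightarrow> w k = (if k \<le> p then k + m else k - p)"

text \<open>
  The values at the elements that are not fixed cannot be decreasing: the last such element, \<open>g\<close>, has a
  value above \<open>m\<close> and the first one, \<open>f\<close>, a value of at most \<open>m\<close>, as otherwise some fixed element after
  \<open>g\<close> or before \<open>f\<close> would have the same value. An ascent of minimal width then has only
  fixed elements in between.
\<close>

lemma ex_ascent_between_fixed:
  assumes w: "w \<in> restricted_perms m p" and k: "k \<in> {1..m + p}" "\<not> fixes_elt m p w k"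
  obtains i j where "1 \<le> i" "i < j" "j \<le> m + p" "\<not> fixes_elt m p w i" "\<not> fixes_elt m p w j"
    "w i < w j" "\<And>l. i < l \<Longrightarrow> l < j \<Longrightarrow> fixes_elt m p w l"
proof -
  note wD = restricted_permsD[OF w]
  define NF where "NF = {l \<in> {1..m + p}. \<not> fixes_elt m p w l}"
  have NF: "finite NF" "NF \<noteq> {}" using k by (auto simp: NF_def)
  define f where "f = Min NF"
  define g where "g = Max NF"
  have f: "f \<in> NF" "\<And>l. l \<in> NF \<Longrightarrow> f \<le> l" and g: "g \<in> NF" "\<And>l. l \<in> NF \<Longrightarrow> l \<le> g"
    using NF by (auto simp: f_def g_def)
  have winj: "w x = w y \<longleftrightarrow> x = y" for x y using permutes_inj[OF wD(1)] by (auto simp: inj_def)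
  have "w g > m"
  proof (rule ccontr)
    assume "\<not> m < w g"
    define y where "y = w g + p"
    have "g \<le> y" "y \<in> {1..m + p}" "p < y"
      using wD(3)[of g] wD(4)[of g] g(1) \<open>\<not> m < w g\<close> by (auto simp: y_def NF_def)
    moreover have "y \<noteq> g" using g(1) \<open>p < y\<close> by (auto simp: NF_def fixes_elt_def y_def)
    ultimately have "y \<notin> NF" using g(2)[of y] by auto
    then have "w y = w g" using \<open>y \<in> _\<close> \<open>p < y\<close> by (simp add: NF_def fixes_elt_def y_def)
    then show False using winj \<open>y \<noteq> g\<close> by simp
  qed
  moreover have "w f \<le> m"
  proof (rule ccontr)
    assume "\<not> w f \<le> m"
    define y where "y = w f - m"
    have "y \<le> f" "y \<in> {1..m + p}" "y \<le> p" "w f = y + m"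
      using wD(2)[of f] wD(4)[of f] f(1) \<open>\<not> w f \<le> m\<close> by (auto simp: y_def NF_def)
    moreover have "y \<noteq> f" using f(1) \<open>y \<le> p\<close> \<open>w f = y + m\<close> by (auto simp: NF_def fixes_elt_def)
    ultimately have "y \<notin> NF" using f(2)[of y] by auto
    then have "w y = w f" using \<open>y \<in> _\<close> \<open>y \<le> p\<close> \<open>w f = y + m\<close> by (simp add: NF_def fixes_elt_def)
    then show False using winj \<open>y \<noteq> f\<close> by simp
  qed
  ultimately have "w f < w g" "f \<noteq> g" by auto
  moreover have "f \<le> g" using f(2) g(1) by blast
  ultimately have fg: "f < g" "w f < w g" by auto
  \<comment> \<open>splitting a non-fixed element off an ascent leaves a shorter ascent\<close>
  let ?P = "\<lambda>i j. i \<in> NF \<and> j \<in> NF \<and> i < j \<and> w i < w j"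
  have "\<exists>i j. ?P i j \<and> (\<forall>l. i < l \<and> l < j \<longrightarrow> l \<notin> NF)" if "?P i j" for i j
    using that
  proof (induction "j - i" arbitrary: i j rule: less_induct)
    case less
    show ?case
    proof (cases "\<forall>l. i < l \<and> l < j \<longrightarrow> l \<notin> NF")
      case False
      then obtain l where l: "i < l" "l < j" "l \<in> NF" by blast
      show ?thesis
      proof (cases "w i < w l")
        case True
        then show ?thesis using less.hyps[of l i] l less.prems by auto
      next
        case False
        then have "w l < w j" using less.prems by auto
        then show ?thesis using less.hyps[of j l] l less.prems by auto
      qed
    qed (use less.prems in blast)
  qed
  from this[of f g] obtain i j where ij: "?P i j" "\<And>l. i < l \<Longrightarrow> l < j \<Longrightarrow> l \<notin> NF"
    using f g fg by blast
  show thesis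
  proof (rule that[of i j])
    show "fixes_elt m p w l" if "i < l" "l < j" for l
      using ij(2)[OF that] ij(1) that by (auto simp: NF_def)
  qed (use ij(1) in \<open>auto simp: NF_def\<close>)
qed

text \<open>
  If a bound failed after the interchange, the element at the offending value would be a fixed
  element strictly between \<open>i\<close> and \<open>j\<close> with the same value.
\<close>

lemma restricted_perms_transpose:
  assumes w: "w \<in> restricted_perms m p" and ij: "1 \<le> i" "i < j" "j \<le> m + p"
    and nf: "\<not> fixes_elt m p w i" "\<not> fixes_elt m p w j" and lt: "w i < w j"
    and fx: "\<And>l. i < l \<Longrightarrow> l < j \<Longrightarrow> fixes_elt m p w l"
  shows "w \<circ> transpose i j \<in> restricted_perms m p"
proof (rule restricted_permsI)
  note wD = restricted_permsD[OF w]
  have i: "i \<in> {1..m + p}" and j: "j \<in> {1..m + p}" using ij by auto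
  have winj: "w x = w y \<longleftrightarrow> x = y" for x y using permutes_inj[OF wD(1)] by (auto simp: inj_def)
  show "w \<circ> transpose i j permutes {1..m + p}"
    using wD(1) permutes_swap_id[OF i j] by (intro permutes_compose) auto
  have up: "w j \<le> i + m"
  proof (rule ccontr)
    assume n: "\<not> w j \<le> i + m"
    define y where "y = w j - m"
    have y: "i < y" "y \<le> j" "y \<le> p" "w j = y + m"
      using n wD(2)[OF j] wD(4)[OF j] by (auto simp: y_def)
    have "y \<noteq> j" using nf(2) y by (auto simp: fixes_elt_def)
    then have "w y = w j" using fx[of y] y by (simp add: fixes_elt_def)
    then show False using winj \<open>y \<noteq> j\<close> by simp
  qed
  have low: "j \<le> w i + p"
  proof (rule ccontr)
    assume n: "\<not> j \<le> w i + p"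
    define y where "y = w i + p"
    have y: "y < j" "i \<le> y" "p < y" "w i = y - p"
      using n wD(3)[OF i] wD(4)[OF i] by (auto simp: y_def)
    have "y \<noteq> i" using nf(1) y by (auto simp: fixes_elt_def)
    then have "w y = w i" using fx[of y] y by (simp add: fixes_elt_def)
    then show False using winj \<open>y \<noteq> i\<close> by simp
  qed
  show "(w \<circ> transpose i j) l \<le> l + m \<and> l \<le> (w \<circ> transpose i j) l + p" if l: "l \<in> {1..m + p}" for l
    using wD(2)[OF l] wD(3)[OF l] wD(2)[OF i] wD(3)[OF i] up low lt ij
    by (auto simp: transpose_def)
qed

lemma elt_image_window:
  assumes "l \<in> {1..m + p}" "1 \<le> x" "x \<le> l + m" "l < x + p"
  shows "elt m p ` {x..<l + m} = {y \<in> {1..m + p}. y < l \<and> x \<le> y + m \<or> l < y \<and> x + p \<le> y}"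
proof (intro equalityI subsetI)
  fix y assume y: "y \<in> {y \<in> {1..m + p}. y < l \<and> x \<le> y + m \<or> l < y \<and> x + p \<le> y}"
  show "y \<in> elt m p ` {x..<l + m}"
  proof (cases "y < l")
    case True
    then have "y = elt m p (y + m)" "y + m \<in> {x..<l + m}" using y by (auto simp: elt_def)
    then show ?thesis by blast
  next
    case False
    then have "y = elt m p (y - p)" "y - p \<in> {x..<l + m}" using y assms by (auto simp: elt_def)
    then show ?thesis by blast
  qed
qed (use assms in \<open>auto simp: elt_def\<close>)

lemma unrolled_image: "unrolled m p v ` A = v ` elt m p ` A"
  by (simp add: unrolled_def image_image)

context chart_config
begin

text \<open>
  A loop adds nothing to a span. If \<open>v y\<close> were lost with a coloop, the exchange property would express
  the coloop by the other elements.
\<close>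

lemma drop_loops_coloops:
  assumes "finite F" "\<And>k. k \<in> F \<Longrightarrow> v k = 0 \<or> v k \<notin> fv.span (v ` (E - {k}))"
    and "S \<subseteq> E" "F \<subseteq> E" "y \<in> E" "y \<notin> F" "S \<inter> F = {}" "v y \<in> fv.span (v ` (S \<union> F))"
  shows "v y \<in> fv.span (v ` S)"
  using assms
proof (induction F arbitrary: S rule: finite_induct)
  case (insert k F)
  have in_ins: "v y \<in> fv.span (v ` insert k S)"
    using insert.IH[of "insert k S"] insert.prems insert.hyps by auto
  show ?case
  proof (cases "v k = 0")
    case True
    then show ?thesis using in_ins by (simp add: fv.span_insert_0)
  next
    case False
    show ?thesis
    proof (rule ccontr)
      assume "v y \<notin> fv.span (v ` S)"
      then have "v k \<in> fv.span (insert (v y) (v ` S))" using in_ins fv.in_span_insert by auto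
      moreover have "insert (v y) (v ` S) \<subseteq> v ` (E - {k})" using insert.prems by auto
      ultimately have "v k \<in> fv.span (v ` (E - {k}))" by (rule span_monoD)
      then show False using insert.prems(1)[OF insertI1] False by blast
    qed
  qed
qed simp

lemma fixed_elt_loop_or_coloop:
  assumes w: "encodes m p v w" and k: "k \<in> {1..m + p}" "fixes_elt m p w k"
  shows "k \<le> p \<Longrightarrow> v k = 0" and "p < k \<Longrightarrow> v k \<notin> fv.span (v ` ({1..m + p} - {k}))"
proof -
  have enc: "v k \<in> fv.span (u ` {x..<k + m}) \<longleftrightarrow> x \<le> w k" if "x \<in> {1..k + m}" for x
    using w k(1) that unfolding encodes_def by blast
  show "v k = 0" if "k \<le> p"
    using enc[of "k + m"] that k by (simp add: fixes_elt_def)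
  show "v k \<notin> fv.span (v ` ({1..m + p} - {k}))" if "p < k"
  proof -
    have "elt m p ` {k - p + 1..<k + m} = {1..m + p} - {k}"
      using k that by (subst elt_image_window) auto
    then have "u ` {k - p + 1..<k + m} = v ` ({1..m + p} - {k})"
      unfolding unrolled_image by simp
    moreover have "\<not> k - p + 1 \<le> w k" using k(2) that by (simp add: fixes_elt_def)
    moreover have "k - p + 1 \<in> {1..k + m}" using that k by auto
    ultimately show ?thesis using enc by metis
  qed
qed

end

text \<open>
  One step of the construction: the configuration \<open>v\<close> realises \<open>w'\<close>, and adding \<open>v j\<close> to \<open>v i\<close>
  realises \<open>w\<close>, in which the values at \<open>i\<close> and \<open>j\<close> are interchanged to form an ascent.
\<close>

locale bridge = nonneg_chart_config +
  fixes w' w :: "nat \<Rightarrow> nat" and i j :: nat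
  assumes w': "w' \<in> restricted_perms m p" "encodes m p v w'"
    and w: "w \<in> restricted_perms m p" "w i = w' j" "w j = w' i"
      "\<And>l. l \<noteq> i \<Longrightarrow> l \<noteq> j \<Longrightarrow> w l = w' l"
    and ij: "1 \<le> i" "i < j" "j \<le> m + p" and lt: "w i < w j"
    and fixes_between: "\<And>l. i < l \<Longrightarrow> l < j \<Longrightarrow> fixes_elt m p w' l"
begin

abbreviation "E \<equiv> {1..m + p}"

text \<open>
  The sign that moving \<open>v j\<close> to the place of \<open>v i\<close> causes in a nonzero Pluecker coordinate: a basis
  contains all the coloops between \<open>i\<close> and \<open>j\<close> and none of the loops, and by \<open>fixes_between\<close> there is nothing
  else in between.
\<close>

definition s :: real where "s = (-1) ^ card {l \<in> {i<..<j}. p < l}"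

definition v' :: "nat \<Rightarrow> nat \<Rightarrow> real" where "v' = v(i := v i + s *\<^sub>f v j)"

lemma ss: "s * s = 1" and s_nonzero: "s \<noteq> 0"
  by (simp_all add: s_def flip: power_add)

lemma v'_other: "k \<noteq> i \<Longrightarrow> v' k = v k" and v'_i: "v' i = v i + s *\<^sub>f v j"
  by (simp_all add: v'_def)

lemma between: assumes "i < l" "l < j"
  shows "l \<le> p \<Longrightarrow> v l = 0" and "p < l \<Longrightarrow> v l \<notin> fv.span (v ` (E - {l}))"
  using fixed_elt_loop_or_coloop[OF w'(2) _ fixes_between[OF assms]] assms ij by auto

lemma plucker_bridge_ge:
  assumes K: "K \<subseteq> {1..n}" "card K = m"
  shows "plucker m v K \<le> plucker m v' K"
proof (cases "i \<in> K")
  case False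
  then have "map v' (sorted_list_of_set K) = map v (sorted_list_of_set K)"
    using finite_subset[OF K(1)] by (intro map_cong refl v'_other) auto
  then have "plucker m v' K = plucker m v K" unfolding plucker_def by (rule arg_cong)
  then show ?thesis by simp
next
  case True
  define L where "L = K - {i}"
  have L: "finite L" "i \<notin> L" "K = insert i L" "L \<subseteq> {1..n}" and cL: "Suc (card L) = m"
    using True K finite_subset[OF K(1)] card_Suc_Diff1[of K i] by (auto simp: L_def)
  let ?d = "\<lambda>x. detv [0..<m] (map v (sorted_list_of_set L) @ [x])"
  let ?e = "(-1) ^ card {a \<in> L. i < a} :: real"
  have mapL: "map v' (sorted_list_of_set L) = map v (sorted_list_of_set L)"
    using L(1,2) by (intro map_cong refl v'_other) auto
  have "plucker m v K = ?e * ?d (v i)"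
    using detv_insert[OF L(1,2), of _ v "[]"] by (simp add: plucker_def L(3))
  moreover have "plucker m v' K = ?e * ?d (v' i)"
    unfolding mapL[symmetric] using detv_insert[OF L(1,2), of _ v' "[]"] by (simp add: plucker_def L(3))
  moreover have "?d (v' i) = ?d (v i) + s * ?d (v j)"
    unfolding v'_i detv_add detv_smul ..
  ultimately have eq: "plucker m v' K = plucker m v K + s * ?e * ?d (v j)" by (simp add: algebra_simps)
  have "0 \<le> s * ?e * ?d (v j)"
  proof (cases "j \<in> L")
    case True
    then have "?d (v j) = 0" using L(1) by (intro detv_mem_left) simp
    then show ?thesis by simp
  next
    case False
    have jL: "plucker m v (insert j L) = (-1) ^ card {a \<in> L. j < a} * ?d (v j)"
      using detv_insert[OF L(1) False, of _ v "[]"] by (simp add: plucker_def)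
    have jLE: "insert j L \<subseteq> {1..n}" "card (insert j L) = m" using L cL False ij n by auto
    show ?thesis
    proof (cases "plucker m v (insert j L) = 0")
      case True
      then show ?thesis using jL by simp
    next
      case nz: False
      then have fr: "free v (insert j L)" using plucker_nonzero[of "insert j L"] jLE L by simp
      \<comment> \<open>a basis avoids loops and contains coloops, so the sign does not depend on it\<close>
      have mid: "{a \<in> L. i < a \<and> a < j} = {l \<in> {i<..<j}. p < l}"
      proof (intro equalityI subsetI)
        fix a assume a: "a \<in> {a \<in> L. i < a \<and> a < j}"
        have "p < a"
        proof (rule ccontr)
          assume "\<not> p < a"
          then have "v a = 0" using between(1)[of a] a by simp
          then have "v a \<in> fv.span (v ` (insert j L - {a}))" by (simp only: fv.span_zero)
          then show False using fr a by (auto simp: free_def)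
        qed
        then show "a \<in> {l \<in> {i<..<j}. p < l}" using a by simp
      next
        fix l assume l: "l \<in> {l \<in> {i<..<j}. p < l}"
        have "l \<in> L"
        proof (rule ccontr)
          assume "l \<notin> L"
          then have "insert j L \<subseteq> E - {l}" using jLE n l by auto
          moreover have "v l \<in> fv.span (v ` insert j L)" by (rule basis_spans[OF fr jLE(2)])
          ultimately have "v l \<in> fv.span (v ` (E - {l}))" using span_monoD image_mono by metis
          then show False using between(2)[of l] l by simp
        qed
        then show "l \<in> {a \<in> L. i < a \<and> a < j}" using l by simp
      qed
      have "i < a \<longleftrightarrow> i < a \<and> a < j \<or> j < a" if "a \<in> L" for a
        using that False ij by (metis less_trans linorder_neqE_nat)
      then have "{a \<in> L. i < a} = {a \<in> L. i < a \<and> a < j} \<union> {a \<in> L. j < a}" by blast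
      then have "card {a \<in> L. i < a} = card ({a \<in> L. i < a \<and> a < j} \<union> {a \<in> L. j < a})"
        by (rule arg_cong)
      also have "\<dots> = card {a \<in> L. i < a \<and> a < j} + card {a \<in> L. j < a}"
        using L(1) by (intro card_Un_disjoint) auto
      also have "\<dots> = card {l \<in> {i<..<j}. p < l} + card {a \<in> L. j < a}" unfolding mid ..
      finally have "?e = s * (-1) ^ card {a \<in> L. j < a}" by (simp add: s_def power_add)
      then have "s * ?e * ?d (v j) = s * s * plucker m v (insert j L)" by (simp add: jL)
      then show ?thesis using nonneg[OF jLE] by (simp add: ss)
    qed
  qed
  then show ?thesis using eq by simp
qed

lemma nonneg_chart_bridge: "nonneg_chart_config n m v' p"
proof
  show supp': "v' k i' = 0" if "m \<le> i'" for i' k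
    using supp[OF that] by (simp add: v'_def smul_apply)
  show "0 \<le> plucker m v' K" if "K \<subseteq> {1..n}" "card K = m" for K
    using nonneg[OF that] plucker_bridge_ge[OF that] by linarith
  show "n = m + p" by (rule n)
  have C: "{p + 1..m + p} \<subseteq> {1..n}" "card {p + 1..m + p} = m" by (auto simp: n)
  have "plucker m v {p + 1..m + p} \<noteq> 0" using plucker_nonzero[of "{p + 1..m + p}"] chart by simp
  then have "plucker m v' {p + 1..m + p} \<noteq> 0" using nonneg[OF C] plucker_bridge_ge[OF C] by linarith
  then show "free v' {p + 1..m + p}"
    using plucker_nonzero_iff[of "{p + 1..m + p}" m v'] supp' by simp
qed

lemma vj_eq: "v j = s *\<^sub>f (v' i - v i)"
  by (simp add: v'_i fun_eq_iff smul_apply ss mult.assoc[symmetric])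

lemma vj_in_span:
  assumes "v i \<in> fv.span A" "v' i \<in> fv.span A"
  shows "v j \<in> fv.span A"
  unfolding vj_eq using assms by (intro fv.span_scale fv.span_diff)

lemma v'i_in_span:
  assumes "v i \<in> fv.span A" "v j \<in> fv.span A"
  shows "v' i \<in> fv.span A"
  unfolding v'_i using assms by (intro fv.span_add fv.span_scale)

lemma v'_image: "i \<notin> W \<Longrightarrow> v' ` W = v ` W"
  by (intro image_cong refl v'_other) auto

lemma span_v'_image:
  assumes "i \<in> W" "j \<in> W"
  shows "fv.span (v' ` W) = fv.span (v ` W)"
proof (rule subset_antisym)
  have "v' k \<in> fv.span (v ` W)" if "k \<in> W" for k
  proof (cases "k = i")
    case True
    have "v i \<in> fv.span (v ` W)" "v j \<in> fv.span (v ` W)"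
      using assms by (auto intro: fv.span_base)
    then show ?thesis using True v'i_in_span by simp
  next
    case False
    then have "v' k = v k" by (rule v'_other)
    then show ?thesis using that by (auto intro: fv.span_base)
  qed
  then show "fv.span (v' ` W) \<subseteq> fv.span (v ` W)" by (intro fv.span_minimal) auto
  have oth: "v k \<in> fv.span (v' ` W)" if "k \<in> W" "k \<noteq> i" for k
    using that v'_other[of k] by (metis fv.span_base image_eqI)
  have vi: "v i = v' i - s *\<^sub>f v j" by (simp add: v'_i)
  have "v i \<in> fv.span (v' ` W)"
  proof -
    have "v' i \<in> fv.span (v' ` W)" using assms(1) by (intro fv.span_base imageI)
    moreover have "v j \<in> fv.span (v' ` W)" using oth[of j] assms(2) ij by simp
    ultimately show ?thesis unfolding vi by (intro fv.span_diff fv.span_scale)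
  qed
  then show "fv.span (v ` W) \<subseteq> fv.span (v' ` W)" using oth by (intro fv.span_minimal) auto
qed

lemma drop_between:
  assumes "S \<subseteq> E" "y \<in> E" "y \<notin> {i<..<j}" "S \<inter> {i<..<j} = {}"
    "v y \<in> fv.span (v ` (S \<union> {i<..<j}))"
  shows "v y \<in> fv.span (v ` S)"
proof (rule drop_loops_coloops[OF _ _ assms(1) _ assms(2-5)])
  show "v k = 0 \<or> v k \<notin> fv.span (v ` (E - {k}))" if "k \<in> {i<..<j}" for k
    using between[of k] that by (cases "k \<le> p") auto
qed (use ij in auto)

text \<open>
  Only windows containing \<open>i\<close> but not \<open>j\<close> change their span, and only \<open>v i\<close> itself changes. A
  window that ends before \<open>i\<close> and misses \<open>j\<close> spans the new vector if and only if it spans both \<open>v i\<close> and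
  \<open>v j\<close>, which depends on the smaller value \<open>w' j\<close>. A window that contains \<open>i\<close> and ends before \<open>j\<close> now
  spans \<open>v j\<close> as soon as its part before \<open>i\<close> spans \<open>v i\<close>, which depends on \<open>w' i\<close>.
\<close>

lemma encodes_bridge: "encodes m p v' w"
  unfolding encodes_def
proof (intro ballI)
  fix l x assume l: "l \<in> E" and x: "x \<in> {1..l + m}"
  note wD = restricted_permsD[OF w(1)] and wD' = restricted_permsD[OF w'(1)]
  have iE: "i \<in> E" and jE: "j \<in> E" using ij by auto
  define W where "W = elt m p ` {x..<l + m}"
  have enc: "v k \<in> fv.span (v ` elt m p ` {x..<k + m}) \<longleftrightarrow> x \<le> w' k" if "k \<in> E" "x \<le> k + m" for k
    using w'(2) that x unfolding encodes_def unrolled_image by auto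
  have encW: "v l \<in> fv.span (v ` W) \<longleftrightarrow> x \<le> w' l"
    using enc[OF l] x by (simp add: W_def)
  have "v' l \<in> fv.span (v' ` W) \<longleftrightarrow> x \<le> w l"
  proof (cases "l < x + p")
    case False
    then have "l = elt m p (l - p)" "l - p \<in> {x..<l + m}" using x l by (auto simp: elt_def)
    then have "l \<in> W" unfolding W_def by blast
    then have "v' l \<in> fv.span (v' ` W)" by (intro fv.span_base imageI)
    moreover have "x \<le> w l" using wD(3)[OF l] False by simp
    ultimately show ?thesis by simp
  next
    case lx: True
    have W: "W = {y \<in> E. y < l \<and> x \<le> y + m \<or> l < y \<and> x + p \<le> y}"
      unfolding W_def using l x lx by (intro elt_image_window) auto
    consider "l = i" | "l = j" | "l \<noteq> i" "l \<noteq> j" by blast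
    then show ?thesis
    proof cases
      case 1
      have img: "v' ` W = v ` W" using 1 W by (intro v'_image) auto
      show ?thesis
      proof (cases "j \<in> W")
        case True
        then have "x + p \<le> j" using W 1 ij by auto
        then have le: "x \<le> w i" using wD'(3)[OF jE] w(2) by simp
        then have "v i \<in> fv.span (v ` W)" using encW 1 lt w(3) by simp
        moreover have "v j \<in> fv.span (v ` W)" using True by (intro fv.span_base imageI)
        ultimately show ?thesis using le 1 img v'i_in_span by simp
      next
        case False
        then have jx: "j < x + p" using W 1 ij by auto
        define W1 where "W1 = elt m p ` {x..<j + m}"
        have W1: "W1 = insert i W \<union> {i<..<j}"
        proof -
          have "W1 = {y \<in> E. y < j \<and> x \<le> y + m \<or> j < y \<and> x + p \<le> y}"
            unfolding W1_def using x jx jE ij 1 by (intro elt_image_window) auto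
          also have "\<dots> = insert i W \<union> {i<..<j}" unfolding W using x ij jx 1 by auto
          finally show ?thesis .
        qed
        have enc1: "v j \<in> fv.span (v ` W1) \<longleftrightarrow> x \<le> w i"
          using enc[OF jE] x ij 1 w(2) by (simp add: W1_def)
        have sub: "v ` W \<subseteq> v ` W1" unfolding W1 by auto
        have i1: "v i \<in> fv.span (v ` W1)" unfolding W1 by (intro fv.span_base) auto
        show ?thesis
        proof
          assume "v' l \<in> fv.span (v' ` W)"
          then have "v' i \<in> fv.span (v ` W1)" using span_monoD[OF _ sub] img 1 by simp
          then show "x \<le> w l" using vj_in_span[OF i1] enc1 1 by simp
        next
          assume le: "x \<le> w l"
          then have vi: "v i \<in> fv.span (v ` W)" using encW 1 lt w(3) by simp
          have "v j \<in> fv.span (v ` (insert i W \<union> {i<..<j}))" using le enc1 1 W1 by simp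
          then have "v j \<in> fv.span (v ` insert i W)"
            by (rule drop_between[rotated 4]) (use W 1 jx ij in auto)
          then have "v j \<in> fv.span (v ` W)" using vi by (simp add: fv.span_redundant)
          then show "v' l \<in> fv.span (v' ` W)" using v'i_in_span[OF vi] img 1 by simp
        qed
      qed
    next
      case 2
      have v'j: "v' j = v j" using ij by (intro v'_other) auto
      show ?thesis
      proof (cases "i \<in> W")
        case False
        then have "i + m < x" using W 2 ij iE by auto
        moreover have "w j \<le> i + m" using wD'(2)[OF iE] w(3) by simp
        ultimately have "\<not> x \<le> w j" "\<not> x \<le> w' j" using lt w(2) by simp_all
        then show ?thesis using encW 2 v'j v'_image[OF False] by simp
      next
        case True
        then have xi: "x \<le> i + m" using W 2 ij by auto
        define W0 where "W0 = elt m p ` {x..<i + m}"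
        have W0: "W0 = {y \<in> E. y < i \<and> x \<le> y + m \<or> i < y \<and> x + p \<le> y}"
          unfolding W0_def using x xi iE ij lx 2 by (intro elt_image_window) auto
        have Weq: "W = insert i (W0 \<union> {i<..<j})"
          unfolding W W0 using xi ij lx 2 by auto
        have i0: "i \<notin> W0 \<union> {i<..<j}" unfolding W0 by auto
        have enc0: "v i \<in> fv.span (v ` W0) \<longleftrightarrow> x \<le> w j"
          using enc[OF iE xi] w(3) by (simp add: W0_def)
        let ?Q = "v ` (W0 \<union> {i<..<j})"
        have img: "v' ` W = insert (v' i) ?Q"
          unfolding Weq image_insert v'_image[OF i0] ..
        have Qsub: "?Q \<subseteq> v ` W" unfolding Weq by auto
        show ?thesis
        proof
          assume "x \<le> w l"
          then have "v i \<in> fv.span (v ` W0)" using enc0 2 by simp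
          moreover have "v ` W0 \<subseteq> v' ` W" unfolding img by auto
          ultimately have "v i \<in> fv.span (v' ` W)" by (rule span_monoD)
          moreover have "v' i \<in> fv.span (v' ` W)" unfolding img by (intro fv.span_base) simp
          ultimately show "v' l \<in> fv.span (v' ` W)" using vj_in_span v'j 2 by simp
        next
          assume in_sp: "v' l \<in> fv.span (v' ` W)"
          show "x \<le> w l"
          proof (rule ccontr)
            assume nle: "\<not> x \<le> w l"
            have "v i \<notin> fv.span (v ` W0)" using nle enc0 2 by simp
            moreover have "v i \<in> fv.span (v ` W0)" if "v i \<in> fv.span ?Q"
              by (rule drop_between[OF _ iE _ _ that]) (use W0 lx 2 in auto)
            ultimately have niQ: "v i \<notin> fv.span ?Q" by blast
            have njW: "v j \<notin> fv.span (v ` W)" using encW nle 2 lt w(2) by simp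
            obtain k where z: "v j - k *\<^sub>f v' i \<in> fv.span ?Q"
              using in_sp 2 v'j img fv.span_breakdown_eq[of "v j" "v' i" ?Q] by auto
            \<comment> \<open>solving \<open>v j - k (v i + s v j)\<close> for \<open>v j\<close>, or for \<open>v i\<close> if \<open>v j\<close> cancels\<close>
            show False
            proof (cases "k * s = 1")
              case True
              then have "v i = (- s) *\<^sub>f (v j - k *\<^sub>f v' i)"
                by (auto simp: fun_eq_iff smul_apply v'_i algebra_simps)
              then have "v i \<in> fv.span ?Q" using z fv.span_scale by metis
              then show False using niQ by simp
            next
              case False
              then have nz: "1 - k * s \<noteq> 0" by simp
              have "v j = (1 / (1 - k * s)) *\<^sub>f ((v j - k *\<^sub>f v' i) + k *\<^sub>f v i)"
              proof
                fix t
                have "v j t = (1 / (1 - k * s)) * ((1 - k * s) * v j t)" using nz by simp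
                also have "(1 - k * s) * v j t = ((v j - k *\<^sub>f v' i) + k *\<^sub>f v i) t"
                  by (simp add: v'_i smul_apply algebra_simps)
                finally show "v j t = ((1 / (1 - k * s)) *\<^sub>f ((v j - k *\<^sub>f v' i) + k *\<^sub>f v i)) t"
                  by (simp only: smul_apply)
              qed
              moreover have "v j - k *\<^sub>f v' i \<in> fv.span (v ` W)" using z Qsub by (rule span_monoD)
              moreover have "v i \<in> fv.span (v ` W)" using True by (intro fv.span_base imageI)
              ultimately have "v j \<in> fv.span (v ` W)" by (metis fv.span_add fv.span_scale)
              then show False using njW by simp
            qed
          qed
        qed
      qed
    next
      case 3
      have eqs: "v' l = v l" "w l = w' l" using v'_other[OF 3(1)] w(4)[OF 3] by simp_all
      show ?thesis
      proof (cases "i \<notin> W \<or> j \<in> W")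
        case True
        then have "fv.span (v' ` W) = fv.span (v ` W)"
          using v'_image[of W] span_v'_image[of W] by (cases "i \<in> W") auto
        then show ?thesis using encW eqs by simp
      next
        case False
        then have lij: "i < l" "l < j" using W 3 ij iE jE by auto
        have fx: "fixes_elt m p w' l" by (rule fixes_between[OF lij])
        show ?thesis
        proof (cases "l \<le> p")
          case True
          then have "v l = 0" by (rule between(1)[OF lij])
          then have "v l \<in> fv.span (v' ` W)" by (simp only: fv.span_zero)
          moreover have "x \<le> w l" using fx True x eqs by (simp add: fixes_elt_def)
          ultimately show ?thesis using eqs by simp
        next
          case pl: False
          have "v' k \<in> fv.span (v ` (E - {l}))" if "k \<in> W" for k
          proof (cases "k = i")
            case True
            have "v i \<in> fv.span (v ` (E - {l}))" "v j \<in> fv.span (v ` (E - {l}))"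
              using iE jE 3 by (auto intro!: fv.span_base imageI)
            then show ?thesis using True v'i_in_span by simp
          next
            case False
            have "k \<in> E - {l}" using that W by auto
            then show ?thesis unfolding v'_other[OF False] by (intro fv.span_base imageI)
          qed
          then have "fv.span (v' ` W) \<subseteq> fv.span (v ` (E - {l}))" by (intro fv.span_minimal) auto
          then have "v l \<notin> fv.span (v' ` W)" using between(2)[OF lij] pl by auto
          moreover have "\<not> x \<le> w l" using fx pl eqs lx by (simp add: fixes_elt_def)
          ultimately show ?thesis using eqs by simp
        qed
      qed
    qed
  qed
  then show "v' l \<in> fv.span (unrolled m p v' ` {x..<l + m}) \<longleftrightarrow> x \<le> w l"
    by (simp add: W_def unrolled_def image_image)
qed

end

text \<open>
  The configuration of the zero matrix up to the order and the signs of the unit vectors: the only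
  nonzero Pluecker coordinate is that of the unit vectors, which is 1.
\<close>

lemma minimal_config:
  assumes w: "w \<in> restricted_perms m p" and fx: "\<And>k. k \<in> {1..m + p} \<Longrightarrow> fixes_elt m p w k"
  defines "v \<equiv> (\<lambda>k i. if i < m \<and> k = p + 1 + i then 1 else 0 :: real)"
  shows "nonneg_chart_config (m + p) m v p \<and> encodes m p v w"
proof -
  let ?C = "{p + 1..m + p}"
  have supp: "v k i = 0" if "m \<le> i" for i k using that by (simp add: v_def)
  have v_low: "v k = 0" if "k \<le> p" for k using that by (auto simp: v_def fun_eq_iff)
  have sorted_C: "sorted_list_of_set ?C = [p + 1..<m + p + 1]"
    by (metis atLeastLessThanSuc_atLeastAtMost Suc_eq_plus1 sorted_list_of_set_range)
  have pluC: "plucker m v ?C = 1"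
  proof -
    have len: "length (map v [p + 1..<m + p + 1]) = m" by simp
    have "mat m m (\<lambda>(i, j). (map v [p + 1..<m + p + 1] ! j) ([0..<m] ! i)) = 1\<^sub>m m"
    proof (rule eq_matI)
      fix i j assume ij: "i < dim_row (1\<^sub>m m)" "j < dim_col (1\<^sub>m m)"
      have "map v [p + 1..<m + p + 1] ! j = v (p + 1 + j)"
        using ij by (subst nth_map) (simp_all del: upt_Suc)
      then show "mat m m (\<lambda>(i, j). (map v [p + 1..<m + p + 1] ! j) ([0..<m] ! i)) $$ (i, j) = 1\<^sub>m m $$ (i, j)"
        using ij by (simp add: v_def del: upt_Suc)
    qed auto
    then show ?thesis unfolding plucker_def detv_def sorted_C len by simp
  qed
  have freeC: "free v ?C"
    using plucker_nonzero_iff[of ?C m v] pluC supp by simp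
  have nonneg: "0 \<le> plucker m v K" if K: "K \<subseteq> {1..m + p}" "card K = m" for K
  proof (cases "K \<subseteq> ?C")
    case True
    then have "K = ?C" using K(2) by (intro card_subset_eq) auto
    then show ?thesis using pluC by simp
  next
    case False
    then obtain k where k: "k \<in> K" "k \<notin> ?C" by blast
    then have "k \<in> {1..m + p}" using K(1) by blast
    then have "k \<le> p" using k(2) by simp
    then have "v k \<in> fv.span (v ` (K - {k}))" using v_low[of k] by (simp only: fv.span_zero)
    then have "\<not> free v K" using k(1) by (auto simp: free_def)
    moreover have "finite K" using K(1) finite_subset by blast
    ultimately have "plucker m v K = 0" using plucker_nonzero_iff[of K m v] K(2) supp by blast
    then show ?thesis by simp
  qed
  have config: "nonneg_chart_config (m + p) m v p"
  proof
    show "v k i = 0" if "m \<le> i" for i k by (rule supp[OF that])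
    show "0 \<le> plucker m v K" if "K \<subseteq> {1..m + p}" "card K = m" for K by (rule nonneg[OF that])
    show "m + p = m + p" by (rule refl)
    show "free v ?C" by (rule freeC)
  qed
  have "v l \<in> fv.span (unrolled m p v ` {x..<l + m}) \<longleftrightarrow> x \<le> w l"
    if l: "l \<in> {1..m + p}" and x: "x \<in> {1..l + m}" for l x
  proof (cases "l \<le> p")
    case True
    then have "v l \<in> fv.span (unrolled m p v ` {x..<l + m})"
      using v_low[OF True] by (simp only: fv.span_zero)
    moreover have "x \<le> w l" using fx[OF l] True x by (simp add: fixes_elt_def)
    ultimately show ?thesis by simp
  next
    case False
    have wl: "w l = l - p" using fx[OF l] False by (simp add: fixes_elt_def)
    show ?thesis
    proof (cases "x \<le> l - p")
      case True
      then have "l = elt m p (l - p)" "l - p \<in> {x..<l + m}" using l False x by (auto simp: elt_def)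
      then have "v l \<in> unrolled m p v ` {x..<l + m}" 
        unfolding unrolled_image by (intro image_eqI[of _ v l] image_eqI[of l]) simp_all
      then show ?thesis using True wl by (simp add: fv.span_base)
    next
      case nle: False
      have "elt m p ` {x..<l + m} \<subseteq> {1..m + p} - {l}"
        using x l nle False by (subst elt_image_window) auto
      then have "unrolled m p v ` {x..<l + m} \<subseteq> v ` ({1..m + p} - {l})"
        unfolding unrolled_image by (rule image_mono)
      also have "\<dots> \<subseteq> insert 0 (v ` (?C - {l}))"
      proof
        fix y assume "y \<in> v ` ({1..m + p} - {l})"
        then obtain k where k: "k \<in> {1..m + p} - {l}" "y = v k" by blast
        show "y \<in> insert 0 (v ` (?C - {l}))"
        proof (cases "k \<le> p")
          case True
          then show ?thesis using v_low[OF True] k(2) by blast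
        next
          case False
          then have "k \<in> ?C - {l}" using k(1) by auto
          then show ?thesis using k(2) by blast
        qed
      qed
      finally have "fv.span (unrolled m p v ` {x..<l + m}) \<subseteq> fv.span (v ` (?C - {l}))"
        using fv.span_mono fv.span_insert_0 by metis
      moreover have "v l \<notin> fv.span (v ` (?C - {l}))" using freeC l False by (auto simp: free_def)
      ultimately show ?thesis using nle wl by auto
    qed
  qed
  then have "encodes m p v w" by (simp add: encodes_def)
  then show ?thesis using config by blast
qed

text \<open>
  By induction on \<open>\<Sum>k. k * w k\<close>, which an interchange that removes an ascent decreases.
\<close>

theorem ex_config_encoding:
  "w \<in> restricted_perms m p \<Longrightarrow> \<exists>v. nonneg_chart_config (m + p) m v p \<and> encodes m p v w"
proof (induction "\<Sum>k\<in>{1..m + p}. k * w k" arbitrary: w rule: less_induct)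
  case less
  show ?case
  proof (cases "\<forall>k\<in>{1..m + p}. fixes_elt m p w k")
    case True
    then show ?thesis using minimal_config[OF less.prems] by blast
  next
    case False
    then obtain i j where ij: "1 \<le> i" "i < j" "j \<le> m + p"
      "\<not> fixes_elt m p w i" "\<not> fixes_elt m p w j" "w i < w j"
      and fx: "\<And>l. i < l \<Longrightarrow> l < j \<Longrightarrow> fixes_elt m p w l"
      using ex_ascent_between_fixed[OF less.prems] by metis
    define w' where "w' = w \<circ> transpose i j"
    have w': "w' i = w j" "w' j = w i" "\<And>l. l \<noteq> i \<Longrightarrow> l \<noteq> j \<Longrightarrow> w' l = w l"
      by (simp_all add: w'_def transpose_def)
    have w'_in: "w' \<in> restricted_perms m p"
      unfolding w'_def by (rule restricted_perms_transpose[OF less.prems ij fx])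
    have "(\<Sum>k\<in>{1..m + p}. k * w' k) < (\<Sum>k\<in>{1..m + p}. k * w k)"
    proof -
      let ?R = "{1..m + p} - {i} - {j}"
      have split: "(\<Sum>k\<in>{1..m + p}. k * f k) = i * f i + (j * f j + (\<Sum>k\<in>?R. k * f k))"
        for f :: "nat \<Rightarrow> nat"
        using ij by (subst sum.remove[of _ i], simp, simp, subst sum.remove[of _ j]) auto
      have "(\<Sum>k\<in>?R. k * w' k) = (\<Sum>k\<in>?R. k * w k)" using w'(3) by (intro sum.cong) auto
      moreover have "i * w j + j * w i < i * w i + j * w j"
      proof -
        obtain a where a: "i + a = j" "a > 0" using less_imp_add_positive[OF ij(2)] by metis
        obtain b where b: "w i + b = w j" "b > 0" using less_imp_add_positive[OF ij(6)] by metis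
        show ?thesis unfolding b(1)[symmetric] unfolding a(1)[symmetric] using a(2) b(2)
          by (simp add: algebra_simps)
      qed
      ultimately show ?thesis unfolding split w' by simp
    qed
    then obtain v where v: "nonneg_chart_config (m + p) m v p" "encodes m p v w'"
      using less.hyps w'_in by blast
    have fx': "fixes_elt m p w' l" if "i < l" "l < j" for l
      using fx[OF that] w'(3)[of l] that by (simp add: fixes_elt_def)
    interpret c: nonneg_chart_config "m + p" m v p by (rule v(1))
    interpret bridge "m + p" m v p w' w i j
    proof
      show "w' \<in> restricted_perms m p" by (rule w'_in)
      show "encodes m p v w'" by (rule v(2))
      show "w \<in> restricted_perms m p" by (rule less.prems)
      show "w i = w' j" "w j = w' i" using w' by simp_all
      show "w l = w' l" if "l \<noteq> i" "l \<noteq> j" for l using w'(3)[OF that] by simp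
      show "1 \<le> i" "i < j" "j \<le> m + p" "w i < w j" using ij by simp_all
      show "fixes_elt m p w' l" if "i < l" "l < j" for l by (rule fx'[OF that])
    qed
    show ?thesis using nonneg_chart_bridge encodes_bridge by blast
  qed
qed

section \<open>Minors as Pluecker coordinates\<close>

lemma pick_eq_nth:
  assumes "finite S" "a < card S"
  shows "pick S a = sorted_list_of_set S ! a"
proof -
  let ?xs = "sorted_list_of_set S"
  have len: "length ?xs = card S" by simp
  have mem: "?xs ! a \<in> S" using assms by (metis len nth_mem set_sorted_list_of_set)
  have "{b \<in> S. b < ?xs ! a} = (!) ?xs ` {..<a}"
  proof (intro equalityI subsetI)
    fix b assume b: "b \<in> {b \<in> S. b < ?xs ! a}"
    then have "b \<in> set ?xs" using assms(1) by simp
    then obtain k where k: "k < length ?xs" "?xs ! k = b" by (metis in_set_conv_nth)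
    have "k < a"
    proof (rule ccontr)
      assume "\<not> k < a"
      then have "?xs ! a \<le> ?xs ! k" using k(1) by (intro sorted_nth_mono) auto
      then show False using k(2) b by simp
    qed
    then show "b \<in> (!) ?xs ` {..<a}" using k(2) by blast
  next
    fix b assume "b \<in> (!) ?xs ` {..<a}"
    then obtain k where k: "k < a" "b = ?xs ! k" by auto
    have "?xs ! k < ?xs ! a"
      using sorted_wrt_nth_less[OF strict_sorted_list_of_set k(1)] assms(2) by simp
    moreover have "?xs ! k \<in> S" using k(1) assms len by (metis less_trans nth_mem set_sorted_list_of_set)
    ultimately show "b \<in> {b \<in> S. b < ?xs ! a}" using k(2) by simp
  qed
  moreover have "inj_on ((!) ?xs) {..<a}"
    using assms(2) len by (intro inj_onI) (simp add: nth_eq_iff_index_eq)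
  ultimately have "card {b \<in> S. b < ?xs ! a} = a" by (simp add: card_image)
  then show ?thesis using pick_card_in_set[OF mem] by simp
qed

lemma sorted_list_of_set_Suc_image:
  assumes "finite S"
  shows "sorted_list_of_set (Suc ` S) = map Suc (sorted_list_of_set S)"
proof (rule strict_sorted_equal)
  show "sorted_wrt (<) (map Suc (sorted_list_of_set S))"
    using strict_sorted_list_of_set[of S] by (simp add: sorted_wrt_map)
  show "set (sorted_list_of_set (Suc ` S)) = set (map Suc (sorted_list_of_set S))"
    using assms by simp
qed (rule strict_sorted_list_of_set)

lemma minor_eq_detv:
  assumes M: "M \<in> carrier_mat m p" and IR: "(I, R) \<in> minors m p"
    and v: "\<And>i k. i < m \<Longrightarrow> k \<in> R \<Longrightarrow> v k i = M $$ (i, k - 1)"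
  shows "minor I R M = detv (sorted_list_of_set {i. Suc i \<in> I}) (map v (sorted_list_of_set R))"
proof -
  let ?I = "{i. Suc i \<in> I}" and ?R = "{j. Suc j \<in> R}"
  have I: "I \<subseteq> {1..m}" and R: "R \<subseteq> {1..p}" and card: "card I = card R"
    using IR by (auto simp: minors_def)
  have fin: "finite ?I" "finite ?R"
  proof -
    have "?I \<subseteq> {..<m}" "?R \<subseteq> {..<p}" using I R by fastforce+
    then show "finite ?I" "finite ?R" using finite_subset finite_lessThan by blast+
  qed
  have pre: "x \<in> Suc ` {i. Suc i \<in> A}" if "x \<in> A" "A \<subseteq> {1..k}" for x A k
    using that by (cases x) auto
  have IS: "I = Suc ` ?I" and RS: "R = Suc ` ?R" using pre[OF _ I] pre[OF _ R] by auto
  have cards: "card ?I = card I" "card ?R = card I"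
    using card_image[of Suc ?I] card_image[of Suc ?R] IS RS card by simp_all
  have dims: "{i. i < m \<and> Suc i \<in> I} = ?I" "{j. j < p \<and> Suc j \<in> R} = ?R" using I R by auto
  let ?X = "mat (card I) (card I) (\<lambda>(i, j). (map v (sorted_list_of_set R) ! j) (sorted_list_of_set ?I ! i))"
  let ?Y = "mat (card I) (card I) (\<lambda>(i, j). M $$ (pick ?I i, pick ?R j))"
  have "minor I R M = det ?Y"
    using M unfolding minor_def submatrix_def by (simp add: dims cards)
  also have "?Y = ?X"
  proof (rule eq_matI)
    fix i j assume ij: "i < dim_row ?X" "j < dim_col ?X"
    then have i: "i < card ?I" and j: "j < card ?R" using cards by simp_all
    have len: "length (sorted_list_of_set R) = card I" using card by simp
    have "map v (sorted_list_of_set R) ! j = v (sorted_list_of_set R ! j)"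
      using j cards len by (intro nth_map) simp
    also have "sorted_list_of_set R ! j = Suc (sorted_list_of_set ?R ! j)"
      using j by (subst RS, subst sorted_list_of_set_Suc_image[OF fin(2)]) simp
    finally have vj: "map v (sorted_list_of_set R) ! j = v (Suc (sorted_list_of_set ?R ! j))" .
    have "sorted_list_of_set ?R ! j \<in> ?R"
      using j fin(2) by (metis length_sorted_list_of_set nth_mem set_sorted_list_of_set)
    moreover have "sorted_list_of_set ?I ! i \<in> ?I"
      using i fin(1) by (metis length_sorted_list_of_set nth_mem set_sorted_list_of_set)
    ultimately have "v (Suc (sorted_list_of_set ?R ! j)) (sorted_list_of_set ?I ! i)
        = M $$ (sorted_list_of_set ?I ! i, sorted_list_of_set ?R ! j)"
      using v[of "sorted_list_of_set ?I ! i" "Suc (sorted_list_of_set ?R ! j)"] I by auto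
    then show "?Y $$ (i, j) = ?X $$ (i, j)"
      using i j cards vj pick_eq_nth[OF fin(1) i] pick_eq_nth[OF fin(2) j] by simp
  qed simp_all
  finally show ?thesis unfolding detv_def using card by simp
qed

lemma detv_unit_last:
  assumes len: "length rs = Suc (length vs)" and t: "t < length rs"
    and x: "\<And>i. i < length rs \<Longrightarrow> x (rs ! i) = (if i = t then c else 0)"
  shows "detv rs (vs @ [x]) = c * (-1) ^ (t + length vs) * detv (take t rs @ drop (Suc t) rs) vs"
proof -
  let ?k = "length vs"
  let ?A = "mat (Suc ?k) (Suc ?k) (\<lambda>(i, j). ((vs @ [x]) ! j) (rs ! i))"
  have "detv rs (vs @ [x]) = det ?A" by (simp add: detv_def)
  also have "\<dots> = (\<Sum>i<Suc ?k. ?A $$ (i, ?k) * cofactor ?A i ?k)"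
    by (rule laplace_expansion_column) auto
  also have "\<dots> = (\<Sum>i<Suc ?k. if i = t then c * cofactor ?A t ?k else 0)"
    using x len by (intro sum.cong) auto
  also have "\<dots> = c * cofactor ?A t ?k" using t len by simp
  also have "mat_delete ?A t ?k = mat ?k ?k (\<lambda>(i, j). (vs ! j) ((take t rs @ drop (Suc t) rs) ! i))"
    using t len by (intro eq_matI) (auto simp: mat_delete_def nth_append)
  then have "cofactor ?A t ?k = (-1) ^ (t + ?k) * detv (take t rs @ drop (Suc t) rs) vs"
    unfolding cofactor_def detv_def by simp
  finally show ?thesis by (simp add: mult.assoc)
qed

text \<open>
  The columns of \<open>M\<close> followed by the unit vectors from last to first. The sign of the one with entry
  in row \<open>i\<close>, counted from 0, makes the expansion along it sign-free (\<open>detv_remove_units\<close>).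
\<close>

definition chart_vectors :: "nat \<Rightarrow> nat \<Rightarrow> real mat \<Rightarrow> nat \<Rightarrow> nat \<Rightarrow> real" where
  "chart_vectors m p M k i =
     (if i < m then if k \<le> p then M $$ (i, k - 1) else if i + k = m + p then (-1) ^ (i + 1 + m) else 0
      else 0)"

text \<open>
  The unit vectors are expanded from the right, that is for increasing \<open>z\<close>. When \<open>z\<close> is removed, all
  rows of \<open>A\<close> from \<open>z\<close> on are still present, so the place of \<open>z\<close> in \<open>A\<close> is determined by the number of
  rows, and the sign of the expansion cancels that of the unit vector.
\<close>

lemma detv_remove_units:
  assumes "finite Z" "Z \<subseteq> A" "A \<subseteq> {..<m}" "\<And>z. z \<in> Z \<Longrightarrow> {z..<m} \<subseteq> A" "card A = length vs + card Z"
    and v: "v = chart_vectors m p M"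
  shows "detv (sorted_list_of_set A) (vs @ map v (sorted_list_of_set ((\<lambda>z. m + p - z) ` Z)))
    = detv (sorted_list_of_set (A - Z)) vs"
  using assms(1-5)
proof (induction Z arbitrary: A rule: finite_linorder_min_induct)
  case (insert z Z)
  let ?pos = "\<lambda>z. m + p - z"
  have fA: "finite A" using insert.prems(2) finite_subset by blast
  have zA: "z \<in> A" "z < m" using insert.prems by auto
  have zZ: "z \<notin> Z" using insert.hyps by auto
  have Zm: "y < m" if "y \<in> Z" for y using insert.prems(1,2) that by auto
  have pos_sorted: "sorted_list_of_set (?pos ` insert z Z) = sorted_list_of_set (?pos ` Z) @ [?pos z]"
  proof -
    have lt: "?pos y < ?pos z" if "y \<in> Z" for y using insert.hyps(2) that Zm[OF that] by auto
    have "?pos z \<notin> ?pos ` Z" using lt by force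
    moreover have "{a \<in> ?pos ` Z. a < ?pos z} = ?pos ` Z" "{a \<in> ?pos ` Z. ?pos z < a} = {}"
      using lt by force+
    ultimately show ?thesis
      using sorted_list_of_set_insert_split(1)[of "?pos ` Z" "?pos z"] insert.hyps(1) by simp
  qed
  have "{z..<m} \<subseteq> A" using insert.prems(3)[of z] by simp
  then have "{a \<in> A - {z}. z < a} = {z + 1..<m}" using insert.prems(2) by fastforce
  then have "length (sorted_list_of_set {a \<in> A - {z}. z < a}) = m - (z + 1)" by simp
  then obtain xs ys where Asplit: "sorted_list_of_set A = xs @ z # ys" "sorted_list_of_set (A - {z}) = xs @ ys"
    and hi: "length ys = m - (z + 1)"
    using sorted_list_of_set_insert_split[of "A - {z}" z] fA zA(1) by (simp add: insert_absorb)
  define t where "t = length xs"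
  let ?vs = "vs @ map v (sorted_list_of_set (?pos ` Z))"
  have cpos: "card (?pos ` Z) = card Z" using Zm by (intro card_image) (force simp: inj_on_def)
  have cA: "length (sorted_list_of_set A) = Suc (length ?vs)"
    using insert.prems(4) insert.hyps(1) zZ cpos by simp
  have tk: "length ?vs = t + (m - (z + 1))" using cA Asplit(1) hi by (simp add: t_def)
  have nth: "sorted_list_of_set A ! i = z \<longleftrightarrow> i = t" if "i < length (sorted_list_of_set A)" for i
  proof -
    have "sorted_list_of_set A ! t = z" unfolding Asplit(1) t_def by simp
    moreover have "t < length (sorted_list_of_set A)" unfolding Asplit(1) t_def by simp
    ultimately show ?thesis using nth_eq_iff_index_eq[OF distinct_sorted_list_of_set that] by metis
  qed
  have unit: "v (?pos z) (sorted_list_of_set A ! i) = (if i = t then (-1) ^ (z + 1 + m) else 0)"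
    if i: "i < length (sorted_list_of_set A)" for i
  proof -
    have "sorted_list_of_set A ! i \<in> A" using i fA by (metis nth_mem set_sorted_list_of_set)
    then have "sorted_list_of_set A ! i < m" using insert.prems(2) by auto
    then show ?thesis using nth[OF i] zA(2) unfolding v chart_vectors_def by auto
  qed
  have "detv (sorted_list_of_set A) (?vs @ [v (?pos z)]) =
      (-1) ^ (z + 1 + m) * (-1) ^ (t + length ?vs) *
      detv (take t (sorted_list_of_set A) @ drop (Suc t) (sorted_list_of_set A)) ?vs"
    by (rule detv_unit_last[OF cA _ unit]) (simp add: Asplit(1) t_def)
  also have "take t (sorted_list_of_set A) @ drop (Suc t) (sorted_list_of_set A) = sorted_list_of_set (A - {z})"
    unfolding Asplit t_def by simp
  also have "(-1) ^ (z + 1 + m) * (-1) ^ (t + length ?vs) = (1 :: real)"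
  proof -
    have "z + 1 + m + (t + length ?vs) = 2 * (t + m)" using tk zA(2) by simp
    then show ?thesis by (metis power_add power_minus1_even)
  qed
  also have "detv (sorted_list_of_set (A - {z})) ?vs = detv (sorted_list_of_set (A - {z} - Z)) vs"
  proof (rule insert.IH)
    show "Z \<subseteq> A - {z}" using insert.prems(1) zZ by auto
    show "A - {z} \<subseteq> {..<m}" using insert.prems(2) by auto
    show "{y..<m} \<subseteq> A - {z}" if "y \<in> Z" for y
      using insert.prems(3)[of y] insert.hyps(2) that by auto
    show "card (A - {z}) = length vs + card Z"
      using insert.prems(4) insert.hyps(1) zZ zA fA by simp
  qed
  also have "A - {z} - Z = A - insert z Z" by auto
  finally show ?case unfolding pos_sorted by simp
qed simp

lemma minor_eq_plu:
  assumes M: "M \<in> carrier_mat m p" and IR: "(I, R) \<in> minors m p"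
  shows "minor I R M = plucker m (chart_vectors m p M) (plucker_index m p I R)"
proof -
  let ?v = "chart_vectors m p M"
  have I: "I \<subseteq> {1..m}" and R: "R \<subseteq> {1..p}" and card: "card I = card R"
    using IR by (auto simp: minors_def)
  have fin: "finite I" "finite R" using finite_subset[OF I] finite_subset[OF R] by simp_all
  define Z where "Z = {z \<in> {..<m}. Suc z \<notin> I}"
  have pos: "(\<lambda>i. m + p + 1 - i) ` ({1..m} - I) = (\<lambda>z. m + p - z) ` Z"
  proof -
    have "{1..m} - I = Suc ` Z"
    proof (intro equalityI subsetI)
      fix x assume "x \<in> {1..m} - I"
      then show "x \<in> Suc ` Z" by (cases x) (auto simp: Z_def)
    qed (auto simp: Z_def)
    then show ?thesis by (simp add: image_image)
  qed
  have cI: "card {i. Suc i \<in> I} = card I" "{..<m} - Z = {i. Suc i \<in> I}"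
  proof -
    have "I = Suc ` {i. Suc i \<in> I}"
    proof (intro equalityI subsetI)
      fix x assume "x \<in> I"
      then show "x \<in> Suc ` {i. Suc i \<in> I}" using I by (cases x) auto
    qed auto
    then show "card {i. Suc i \<in> I} = card I" by (metis card_image inj_Suc inj_on_subset subset_UNIV)
    show "{..<m} - Z = {i. Suc i \<in> I}" using I by (auto simp: Z_def)
  qed
  have "card Z + card {i. Suc i \<in> I} = m"
    using card_conj_split[of "{..<m}" "\<lambda>z. Suc z \<notin> I"] I
    by (simp add: Z_def) (metis (no_types, lifting) Collect_cong Suc_le_lessD atLeastAtMost_iff lessThan_iff subset_iff)
  then have cZ: "card {..<m} = length (map ?v (sorted_list_of_set R)) + card Z"
    using cI(1) card by simp
  have gt: "p < y" if "y \<in> (\<lambda>z. m + p - z) ` Z" for y using that by (auto simp: Z_def)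
  have "sorted_list_of_set (R \<union> (\<lambda>z. m + p - z) ` Z) =
    sorted_list_of_set R @ sorted_list_of_set ((\<lambda>z. m + p - z) ` Z)"
  proof (rule strict_sorted_equal)
    show "sorted_wrt (<) (sorted_list_of_set R @ sorted_list_of_set ((\<lambda>z. m + p - z) ` Z))"
      using fin R gt by (fastforce simp: sorted_wrt_append Z_def)
    show "set (sorted_list_of_set (R \<union> (\<lambda>z. m + p - z) ` Z)) =
      set (sorted_list_of_set R @ sorted_list_of_set ((\<lambda>z. m + p - z) ` Z))"
      using fin by (simp add: Z_def)
  qed (rule strict_sorted_list_of_set)
  then have "plucker m ?v (plucker_index m p I R) = detv (sorted_list_of_set {..<m})
      (map ?v (sorted_list_of_set R) @ map ?v (sorted_list_of_set ((\<lambda>z. m + p - z) ` Z)))"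
    unfolding plucker_def plucker_index_def pos
    by (simp add: atLeast0LessThan[symmetric])
  also have "\<dots> = detv (sorted_list_of_set ({..<m} - Z)) (map ?v (sorted_list_of_set R))"
    by (rule detv_remove_units[OF _ _ _ _ cZ refl]) (auto simp: Z_def)
  also have "\<dots> = minor I R M"
    unfolding cI(2)
    by (rule minor_eq_detv[OF M IR, symmetric]) (use R in \<open>auto simp: chart_vectors_def\<close>)
  finally show ?thesis ..
qed

section \<open>Admissible families\<close>

lemma plucker_index_props:
  assumes "(I, R) \<in> minors m p"
  shows "plucker_index m p I R \<subseteq> {1..m + p}" "card (plucker_index m p I R) = m"
proof -
  have I: "I \<subseteq> {1..m}" and R: "R \<subseteq> {1..p}" and card: "card I = card R"
    using assms by (auto simp: minors_def)
  have fin: "finite I" "finite R" using finite_subset[OF I] finite_subset[OF R] by simp_all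
  show "plucker_index m p I R \<subseteq> {1..m + p}" using R by (fastforce simp: plucker_index_def)
  have "card (plucker_index m p I R) = card R + card ((\<lambda>i. m + p + 1 - i) ` ({1..m} - I))"
    unfolding plucker_index_def
  proof (rule card_Un_disjoint)
    have "p < y" if "y \<in> (\<lambda>i. m + p + 1 - i) ` ({1..m} - I)" for y using that by auto
    moreover have "y \<le> p" if "y \<in> R" for y using that R by auto
    ultimately show "R \<inter> (\<lambda>i. m + p + 1 - i) ` ({1..m} - I) = {}" by fastforce
  qed (use fin in auto)
  also have "card ((\<lambda>i. m + p + 1 - i) ` ({1..m} - I)) = card ({1..m} - I)"
    by (intro card_image) (auto simp: inj_on_def)
  also have "card ({1..m} - I) = m - card I" using I fin by (simp add: card_Diff_subset)
  finally show "card (plucker_index m p I R) = m"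
    using card card_mono[OF _ I] by simp
qed

lemma ex_plu_index:
  assumes "K \<subseteq> {1..m + p}" "card K = m"
  obtains I R where "(I, R) \<in> minors m p" "plucker_index m p I R = K"
proof
  let ?I = "{i \<in> {1..m}. m + p + 1 - i \<notin> K}" and ?R = "K \<inter> {1..p}"
  have fK: "finite K" using assms(1) finite_subset by blast
  have img: "(\<lambda>i. m + p + 1 - i) ` ({1..m} - ?I) = K \<inter> {p + 1..m + p}"
  proof (intro equalityI subsetI)
    fix y assume "y \<in> K \<inter> {p + 1..m + p}"
    then have "y = m + p + 1 - (m + p + 1 - y)" "m + p + 1 - y \<in> {1..m} - ?I" by auto
    then show "y \<in> (\<lambda>i. m + p + 1 - i) ` ({1..m} - ?I)" by blast
  qed auto
  show "plucker_index m p ?I ?R = K"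
    unfolding plucker_index_def img using assms(1) by fastforce
  have "card (K \<inter> {p + 1..m + p}) = card ({1..m} - ?I)"
    unfolding img[symmetric] by (intro card_image) (auto simp: inj_on_def)
  also have "\<dots> = m - card ?I" by (subst card_Diff_subset) auto
  finally have hi: "card (K \<inter> {p + 1..m + p}) = m - card ?I" .
  have "card (?R \<union> (K \<inter> {p + 1..m + p})) = card ?R + card (K \<inter> {p + 1..m + p})"
    using fK by (intro card_Un_disjoint) auto
  moreover have "?R \<union> (K \<inter> {p + 1..m + p}) = K" using assms(1) by fastforce
  moreover have "card ?I \<le> card {1..m}" by (intro card_mono) auto
  ultimately have "card ?I = card ?R" using hi assms(2) by simp
  then show "(?I, ?R) \<in> minors m p" by (auto simp: minors_def)
qed

lemma empty_label: "({}, {}) \<in> minors m p" "plucker_index m p {} {} = {p + 1..m + p}"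
proof -
  show "({}, {}) \<in> minors m p" by (simp add: minors_def)
  show "plucker_index m p {} {} = {p + 1..m + p}"
    unfolding plucker_index_def
  proof (intro equalityI subsetI)
    fix y assume y: "y \<in> {p + 1..m + p}"
    then have "y = m + p + 1 - (m + p + 1 - y)" "m + p + 1 - y \<in> {1..m} - {}" by auto
    then show "y \<in> {} \<union> (\<lambda>i. m + p + 1 - i) ` ({1..m} - {})" by blast
  qed auto
qed

lemma plucker_chart_eq_1:
  assumes "M \<in> carrier_mat m p"
  shows "plucker m (chart_vectors m p M) {p + 1..m + p} = 1"
proof -
  have "minor {} {} M = 1" by (simp add: minor_def submatrix_def)
  then show ?thesis using minor_eq_plu[OF assms empty_label(1)] by (simp add: empty_label(2))
qed

lemma (in nonneg_chart_config) plucker_eq_0_iff_M_family: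
  assumes wR: "w \<in> restricted_perms m p" and enc: "encodes m p v w" and IR: "(I, R) \<in> minors m p"
  shows "plucker m v (plucker_index m p I R) = 0 \<longleftrightarrow> (I, R) \<in> M_family m p w"
proof -
  interpret minor_label m p w I R
    by unfold_locales (use wR IR in \<open>auto simp: minors_def\<close>)
  let ?K = "plucker_index m p I R"
  note K = plucker_index_props[OF IR]
  have "finite ?K" using K(1) finite_subset by blast
  then have "plucker m v ?K = 0 \<longleftrightarrow> \<not> free v ?K" using plucker_nonzero K(2) by blast
  also have "\<dots> \<longleftrightarrow> (\<exists>a b. 1 \<le> a \<and> a \<le> b \<and> b \<le> m + p + m \<and> b < a + (m + p) \<and> violated a b)"
    unfolding free_iff_window_rank[OF enc K] by (auto simp: not_le)
  also have "\<dots> \<longleftrightarrow> (I, R) \<in> M_family m p w"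
    unfolding ex_violated_iff_M_cond using IR by (simp add: M_family_def)
  finally show ?thesis .
qed

lemma nonneg_chart_config_chart_vectors:
  assumes "M \<in> tnn_mats m p"
  shows "nonneg_chart_config (m + p) m (chart_vectors m p M) p"
proof
  have M: "M \<in> carrier_mat m p" using assms by (simp add: tnn_mats_def)
  let ?v = "chart_vectors m p M"
  show supp: "?v k i = 0" if "m \<le> i" for i k using that by (simp add: chart_vectors_def)
  show "0 \<le> plucker m ?v K" if K: "K \<subseteq> {1..m + p}" "card K = m" for K
  proof -
    obtain I R where IR: "(I, R) \<in> minors m p" "plucker_index m p I R = K"
      using ex_plu_index[OF K] by blast
    have "0 \<le> minor I R M" using assms IR(1) by (auto simp: tnn_mats_def)
    then show ?thesis using minor_eq_plu[OF M IR(1)] IR(2) by simp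
  qed
  show "free ?v {p + 1..m + p}"
    using plucker_nonzero_iff[of "{p + 1..m + p}" m ?v] plucker_chart_eq_1[OF M] supp by simp
qed simp

lemma admissible_imp_M_family:
  assumes "admissible m p F"
  shows "\<exists>w\<in>restricted_perms m p. F = M_family m p w"
proof -
  obtain M where F: "F \<subseteq> minors m p" and M: "M \<in> tnn_mats m p"
    and cell: "\<And>I R. (I, R) \<in> minors m p \<Longrightarrow> minor I R M = 0 \<longleftrightarrow> (I, R) \<in> F"
  proof -
    obtain M where "F \<subseteq> minors m p" "M \<in> tnn_cell m p F"
      using assms by (auto simp: admissible_def)
    then show thesis by (intro that[of M]) (auto simp: tnn_cell_def)
  qed
  interpret nonneg_chart_config "m + p" m "chart_vectors m p M" p
    by (rule nonneg_chart_config_chart_vectors[OF M])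
  obtain w where w: "w \<in> restricted_perms m p" "encodes m p (chart_vectors m p M) w"
    using ex_encoding by blast
  have "(I, R) \<in> F \<longleftrightarrow> (I, R) \<in> M_family m p w" if IR: "(I, R) \<in> minors m p" for I R
    using cell[OF IR] minor_eq_plu[OF _ IR, of M] M plucker_eq_0_iff_M_family[OF w IR]
    by (simp add: tnn_mats_def)
  moreover have "M_family m p w \<subseteq> minors m p" by (auto simp: M_family_def)
  ultimately have "F = M_family m p w" using F by auto
  then show ?thesis using w(1) by blast
qed

text \<open>
  Expressing all vectors in the basis formed by the last \<open>m\<close> of them, with the signs of the unit
  vectors, gives the configuration of a matrix; all Pluecker coordinates are divided by the
  determinant \<open>g\<close> of the change of basis. It is positive since the coordinate of the basis itself is
  1 for the matrix.
\<close>

lemma (in nonneg_chart_config) ex_matrix: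
  "\<exists>M g. M \<in> carrier_mat m p \<and> 0 < g \<and>
    (\<forall>K\<subseteq>{1..m + p}. card K = m \<longrightarrow> plucker m v K = g * plucker m (chart_vectors m p M) K)"
proof -
  \<comment> \<open>the basis vector that becomes the unit vector of row \<open>z\<close>\<close>
  define b where "b z = ((-1) ^ (z + 1 + m)) *\<^sub>f v (m + p - z)" for z
  define B where "B = mat m m (\<lambda>(i, z). b z i)"
  define A where "A = mat m p (\<lambda>(i, j). v (Suc j) i)"
  have B: "B \<in> carrier_mat m m" and A: "A \<in> carrier_mat m p" by (simp_all add: B_def A_def)
  have sgn: "(-1) ^ (z + 1 + m) * ((-1) ^ (z + 1 + m) * r) = (r :: real)" for z r
    by (simp add: mult.assoc[symmetric] flip: power_add)
  have vb: "v (m + p - z) = ((-1) ^ (z + 1 + m)) *\<^sub>f b z" for z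
    by (rule ext) (simp add: b_def smul_apply sgn)
  have "free b {0..<m}"
    unfolding free_def
  proof (intro ballI notI)
    fix z assume z: "z \<in> {0..<m}" and inb: "b z \<in> fv.span (b ` ({0..<m} - {z}))"
    let ?S = "v ` ({p + 1..m + p} - {m + p - z})"
    have "b y \<in> fv.span ?S" if "y \<in> {0..<m} - {z}" for y
    proof -
      have "m + p - y \<in> {p + 1..m + p} - {m + p - z}" using that z by auto
      then show ?thesis unfolding b_def by (intro fv.span_scale fv.span_base imageI)
    qed
    then have "b ` ({0..<m} - {z}) \<subseteq> fv.span ?S" by (rule image_subsetI)
    then have "fv.span (b ` ({0..<m} - {z})) \<subseteq> fv.span ?S" by (simp add: fv.span_minimal)
    then have "v (m + p - z) \<in> fv.span ?S" unfolding vb using inb by (intro fv.span_scale) auto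
    moreover have "m + p - z \<in> {p + 1..m + p}" using z by auto
    ultimately show False using chart by (auto simp: free_def)
  qed
  then have "plucker m b {0..<m} \<noteq> 0"
    using plucker_nonzero_iff[of "{0..<m}" m b] supp by (simp add: b_def smul_apply)
  moreover have "plucker m b {0..<m} = det B"
    unfolding plucker_def detv_def B_def by (simp, intro arg_cong[of _ _ det] eq_matI) simp_all
  ultimately have dB: "det B \<noteq> 0" by simp
  define M where "M = (1 / det B) \<cdot>\<^sub>m (adj_mat B * A)"
  have M: "M \<in> carrier_mat m p" using adj_mat(1)[OF B] A by (simp add: M_def)
  have BM: "B * M = A"
  proof -
    have "B * M = (1 / det B) \<cdot>\<^sub>m (B * (adj_mat B * A))"
      unfolding M_def using mult_smult_distrib[OF B mult_carrier_mat[OF adj_mat(1)[OF B] A]] by simp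
    also have "B * (adj_mat B * A) = (det B \<cdot>\<^sub>m 1\<^sub>m m) * A"
      using assoc_mult_mat[OF B adj_mat(1)[OF B] A] adj_mat(2)[OF B] by simp
    also have "\<dots> = det B \<cdot>\<^sub>m A"
      using mult_smult_assoc_mat[OF one_carrier_mat A] left_mult_one_mat[OF A] by simp
    also have "(1 / det B) \<cdot>\<^sub>m (det B \<cdot>\<^sub>m A) = A" using dB by (intro eq_matI) simp_all
    finally show ?thesis .
  qed
  let ?c = "chart_vectors m p M"
  have vc: "v k i = (\<Sum>z<m. B $$ (i, z) * ?c k z)" if k: "k \<in> {1..m + p}" and i: "i < m" for k i
  proof (cases "k \<le> p")
    case True
    have "v k i = (B * M) $$ (i, k - 1)" unfolding BM using True k i by (simp add: A_def)
    also have "\<dots> = (\<Sum>z<m. B $$ (i, z) * M $$ (z, k - 1))"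
      using True k i B M by (simp add: scalar_prod_def lessThan_atLeast0)
    also have "\<dots> = (\<Sum>z<m. B $$ (i, z) * ?c k z)"
      using True by (intro sum.cong) (simp_all add: chart_vectors_def)
    finally show ?thesis .
  next
    case False
    define y where "y = m + p - k"
    have y: "y < m" "k = m + p - y" using False k by (auto simp: y_def)
    have "(\<Sum>z<m. B $$ (i, z) * ?c k z) = (\<Sum>z<m. if z = y then b y i * (-1) ^ (y + 1 + m) else 0)"
      using False k i y by (intro sum.cong) (auto simp: chart_vectors_def B_def)
    also have "\<dots> = b y i * (-1) ^ (y + 1 + m)" using y(1) by simp
    also have "\<dots> = v k i" using vb[of y] y(2) by (simp add: smul_apply mult.commute)
    finally show ?thesis ..
  qed
  have main: "plucker m v K = det B * plucker m ?c K" if K: "K \<subseteq> {1..m + p}" "card K = m" for K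
  proof -
    let ?ks = "sorted_list_of_set K"
    have fK: "finite K" using K(1) finite_subset by blast
    have len: "length ?ks = m" using K(2) by simp
    define V where "V f = mat m m (\<lambda>(i, j). f (?ks ! j) i)" for f :: "nat \<Rightarrow> nat \<Rightarrow> real"
    have plucker: "plucker m f K = det (V f)" for f
      unfolding plucker_def detv_def length_map len V_def
      by (intro arg_cong[of _ _ det] eq_matI) (simp_all add: K)
    have "V v = B * V ?c"
    proof (rule eq_matI)
      fix i j assume "i < dim_row (B * V ?c)" "j < dim_col (B * V ?c)"
      then have ij: "i < m" "j < m" using B by (simp_all add: V_def)
      have "?ks ! j \<in> K" using ij(2) len fK by (metis nth_mem set_sorted_list_of_set)
      then have "?ks ! j \<in> {1..m + p}" using K(1) by blast
      then show "V v $$ (i, j) = (B * V ?c) $$ (i, j)"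
        using vc ij B by (simp add: V_def scalar_prod_def lessThan_atLeast0)
    qed (use B in \<open>simp_all add: V_def\<close>)
    then show ?thesis unfolding plucker using det_mult[OF B, of "V ?c"] by (simp add: V_def)
  qed
  have "det B = plucker m v {p + 1..m + p}"
    using main[of "{p + 1..m + p}"] plucker_chart_eq_1[OF M] by simp
  then have "0 \<le> det B" using nonneg[of "{p + 1..m + p}"] n by simp
  then have "0 < det B" using dB by simp
  then show ?thesis using M main by blast
qed

lemma M_family_admissible:
  assumes w: "w \<in> restricted_perms m p"
  shows "admissible m p (M_family m p w)"
proof -
  obtain v where v: "nonneg_chart_config (m + p) m v p" "encodes m p v w"
    using ex_config_encoding[OF w] by blast
  interpret nonneg_chart_config "m + p" m v p by (rule v(1))
  obtain M g where M: "M \<in> carrier_mat m p" and g: "0 < g"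
    and plucker: "\<And>K. K \<subseteq> {1..m + p} \<Longrightarrow> card K = m \<Longrightarrow> plucker m v K = g * plucker m (chart_vectors m p M) K"
    using ex_matrix by blast
  have minor: "g * minor I R M = plucker m v (plucker_index m p I R)" if "(I, R) \<in> minors m p" for I R
    using plucker[OF plucker_index_props[OF that]] minor_eq_plu[OF M that] by simp
  have "0 \<le> minor I R M" if IR: "(I, R) \<in> minors m p" for I R
    using nonneg[OF plucker_index_props[OF IR]] minor[OF IR] g by (metis zero_le_mult_iff not_less)
  moreover have "minor I R M = 0 \<longleftrightarrow> (I, R) \<in> M_family m p w" if IR: "(I, R) \<in> minors m p" for I R
    using plucker_eq_0_iff_M_family[OF w v(2) IR] minor[OF IR] g by auto
  ultimately have "M \<in> tnn_cell m p (M_family m p w)"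
    using M by (auto simp: tnn_cell_def tnn_mats_def)
  then show ?thesis by (auto simp: admissible_def M_family_def)
qed

theorem theorem6p2:
  fixes m p :: nat
  assumes "m \<ge> 2" and "p \<ge> 2"
  shows "{F. admissible m p F} = M_family m p ` restricted_perms m p"
  using admissible_imp_M_family M_family_admissible by fastforce

end
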